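(* Let $\theta$ be an action of an inverse semigroup $S$ on a locally compact Hausdorff space $X$. Then the following are equivalent. (i) There exists a finite (resp. countable) family of pairs $\{(f_i,K_i)\}_{i\in I}$ such that $f_i\in E(S)$ and $K_i\subset X_{f_i}$ is compact for each $i\in I$, and $X_e\subset\bigcup_{i\in I,\,f_i\ge e}K_i$ for each $e\in E(S)$. (ii) $X^{\mathrm{KS}}$ is compact (resp. $\sigma$-compact). (iii) $S\ltimes^{\mathrm{KS}}C_0(X)$ is unital (resp. $\sigma$-unital). (iv) $S\ltimes^{\mathrm{KS}}_rC_0(X)$ is unital (resp. $\sigma$-unital).
   Context: An inverse semigroup is a semigroup $S$ in which every $s$ has a unique $s^*$ with $ss^*s=s$, $s^*ss^*=s^*$; $E(S)$ is its commutative subsemigroup of idempotents; $s\le t$ means $ts^*s=s$. An action $\theta$ of $S$ on a topological space $X$ is a semigroup homomorphism $s\mapsto\theta_s$ from $S$ to the inverse semigroup of partial bijections of $X$ (bijections between subsets, composed on the largest possible domain) such that, writing $X_e$ for the subset on which $\theta_e$ ($e\in E(S)$) is the identity (so $\theta_s$ is a bijection $X_{s^*s}\to X_{ss^*}$): each $X_e$ is open, each $\theta_s\colon X_{s^*s}\to X_{ss^*}$ is continuous, and $\bigcup_{e\in E(S)}X_e=X$. The space $X^{\mathrm{KS}}$: let $\widetilde{X_e}=X_e\sqcup\{\infty_e\}$ be the one-point compactification of $X_e$ (a point $\infty_e$ is added even when $X_e$ is compact). Let $\widetilde{X^{\mathrm{KS}}}$ be the set of $\tau\in\prod_{e\in E(S)}\widetilde{X_e}$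 such that (1) if $e_1\le e_2$ and $\tau(e_1)\ne\infty_{e_1}$, then $\tau(e_2)=\tau(e_1)$; (2) if $\tau(e_1)\neq\infty_{e_1}$ and $\tau(e_2)\neq\infty_{e_2}$, then $\tau(e_1e_2)\neq\infty_{e_1e_2}$; with the topology induced from the product topology. Set $X^{\mathrm{KS}}=\widetilde{X^{\mathrm{KS}}}\setminus\{\infty\}$, $\infty=(\infty_e)_{e\in E(S)}$. KS-crossed products: $S$ acts on $A=C_0(X)$ via ideals $A_e=C_0(X_e)$ and $\alpha_s\colon C_0(X_{s^*s})\to C_0(X_{ss^*})$, $\alpha_s(f)=f\circ\theta_{s^*}$. Let $S\ltimes^{\mathrm{KS}}_{\mathrm{alg}}A=\bigoplus_{s\in S}A_{s^*s}$ (algebraic direct sum), with $\delta_s\,a$ the element having $a\in A_{s^*s}$ in the $s$-th component and $0$ elsewhere; it is a $*$-algebra with $(\delta_s a)(\delta_t b)=\delta_{st}\,\alpha_{t^*}(a\alpha_t(b))$ and $(\delta_s a)^*=\delta_{s^*}\,\alpha_s(a^* )$. The full KS-crossed product $S\ltimes^{\mathrm{KS}}A$ is its universal enveloping C*-algebra. For $e\in E(S)$ put $S_e=\{s\in S\mid s^*s=e\}$ and let $l^2(S_e,A_e)$ be the Hilbert $A_e$-module of square-summable families, with elementary vectors $\delta_t\,y$ ($t\in S_e$, $y\in A_e$). There is a $*$-homomorphism $\ell_e\colon S\ltimes^{\mathrm{KS}}_{\mathrm{alg}}A\to\mathbb B(l^2(S_e,A_e))$ into adjointable operators with $\ell_e(\delta_s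 a)(\delta_t y)=\delta_{st}\,\alpha_{t^*}(a\alpha_t(y))$ if $s^*st=t$, and $0$ otherwise. The reduced KS-crossed product $S\ltimes^{\mathrm{KS}}_rA$ is the completion of $S\ltimes^{\mathrm{KS}}_{\mathrm{alg}}A$ in the C*-norm $\|T\|_{\mathrm{KS},r}=\sup_{e\in E(S)}\|\ell_e(T)\|$. A C*-algebra is $\sigma$-unital if it has a countable approximate unit. *)

theory Defs
  imports "HOL-Analysis.Analysis"
begin

section \<open>Inverse semigroups and their actions\<close>

class inverse_semigroup = semigroup_mult +
  assumes ex1_generalized_inverse: "\<exists>!t. s * t * s = s \<and> t * s * t = t"

definition sinv :: "'s::inverse_semigroup \<Rightarrow> 's"  (\<open>_\<^sup>\<star>\<close> [1000] 999)
  where "s\<^sup>\<star> = (THE t. s * t * s = s \<and> t * s * t = t)"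

definition idempotents :: "'s::inverse_semigroup set"
  where "idempotents = {e. e * e = e}"

definition natural_le :: "'s::inverse_semigroup \<Rightarrow> 's \<Rightarrow> bool"  (infix \<open>\<preceq>\<close> 50)
  where "s \<preceq> t \<longleftrightarrow> t * s\<^sup>\<star> * s = s"

text \<open>The subset on which \<open>\<theta>\<^sub>e\<close> is the identity.\<close>

definition act_dom :: "('s \<Rightarrow> 'x \<rightharpoonup> 'x) \<Rightarrow> 's \<Rightarrow> 'x set"
  where "act_dom \<theta> e = {x. \<theta> e x = Some x}"

text \<open>A partial bijection of \<open>topspace X\<close> is a partial map that is injective on its domain;
  \<open>\<circ>\<^sub>m\<close> is composition on the largest possible domain.\<close>

definition semigroup_action :: "'x topology \<Rightarrow> ('s::inverse_semigroup \<Rightarrow> 'x \<rightharpoonup> 'x) \<Rightarrow> bool"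
  where "semigroup_action X \<theta> \<longleftrightarrow>
    (\<forall>s. dom (\<theta> s) \<subseteq> topspace X \<and> ran (\<theta> s) \<subseteq> topspace X \<and> inj_on (\<theta> s) (dom (\<theta> s))) \<and>
    (\<forall>s t. \<theta> (s * t) = \<theta> s \<circ>\<^sub>m \<theta> t) \<and>
    (\<forall>e\<in>idempotents. openin X (act_dom \<theta> e)) \<and>
    (\<forall>s. continuous_map (subtopology X (act_dom \<theta> (s\<^sup>\<star> * s)))
                        (subtopology X (act_dom \<theta> (s * s\<^sup>\<star>))) (\<lambda>x. the (\<theta> s x))) \<and>
    (\<Union>e\<in>idempotents. act_dom \<theta> e) = topspace X"

definition compact_family_cover ::
    "'x topology \<Rightarrow> ('s::inverse_semigroup \<Rightarrow> 'x \<rightharpoonup> 'x) \<Rightarrow> ('s \<times> 'x set) set \<Rightarrow> bool"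
  where "compact_family_cover X \<theta> P \<longleftrightarrow>
    (\<forall>(f, K)\<in>P. f \<in> idempotents \<and> K \<subseteq> act_dom \<theta> f \<and> compactin X K) \<and>
    (\<forall>e\<in>idempotents. act_dom \<theta> e \<subseteq> \<Union>{K. \<exists>f. (f, K) \<in> P \<and> e \<preceq> f})"


section \<open>The space of the Khoshkam--Skandalis construction\<close>

text \<open>The point \<open>\<infinity>\<^sub>e\<close> is \<open>None\<close>, which is added by \<^const>\<open>Alexandroff_compactification\<close> even to a
  compact space.\<close>

definition KS_closure_set :: "('s::inverse_semigroup \<Rightarrow> 'x \<rightharpoonup> 'x) \<Rightarrow> ('s \<Rightarrow> 'x option) set"
  where "KS_closure_set \<theta> =
    {\<tau> \<in> (\<Pi>\<^sub>E e\<in>idempotents. insert None (Some ` act_dom \<theta> e)).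
      (\<forall>e\<^sub>1\<in>idempotents. \<forall>e\<^sub>2\<in>idempotents. e\<^sub>1 \<preceq> e\<^sub>2 \<and> \<tau> e\<^sub>1 \<noteq> None \<longrightarrow> \<tau> e\<^sub>2 = \<tau> e\<^sub>1) \<and>
      (\<forall>e\<^sub>1\<in>idempotents. \<forall>e\<^sub>2\<in>idempotents. \<tau> e\<^sub>1 \<noteq> None \<and> \<tau> e\<^sub>2 \<noteq> None \<longrightarrow> \<tau> (e\<^sub>1 * e\<^sub>2) \<noteq> None)}"

definition KS_space ::
    "'x topology \<Rightarrow> ('s::inverse_semigroup \<Rightarrow> 'x \<rightharpoonup> 'x) \<Rightarrow> ('s \<Rightarrow> 'x option) topology"
  where "KS_space X \<theta> =
    subtopology
      (product_topology (\<lambda>e. Alexandroff_compactification (subtopology X (act_dom \<theta> e))) idempotents)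
      (KS_closure_set \<theta> - {\<lambda>e\<in>idempotents. None})"

definition sigma_compact_space :: "'a topology \<Rightarrow> bool"
  where "sigma_compact_space X \<longleftrightarrow>
    (\<exists>\<K>. countable \<K> \<and> (\<forall>K\<in>\<K>. compactin X K) \<and> \<Union>\<K> = topspace X)"


section \<open>Star-algebras, their completions and enveloping C*-algebras\<close>

record 'a star_algebra =
  alg_carrier :: "'a set"
  alg_add :: "'a \<Rightarrow> 'a \<Rightarrow> 'a"
  alg_scale :: "complex \<Rightarrow> 'a \<Rightarrow> 'a"
  alg_mult :: "'a \<Rightarrow> 'a \<Rightarrow> 'a"
  alg_star :: "'a \<Rightarrow> 'a"

record 'a normed_star_algebra = "'a star_algebra" +
  alg_norm :: "'a \<Rightarrow> real"

definition alg_diff :: "('a, 'b) star_algebra_scheme \<Rightarrow> 'a \<Rightarrow> 'a \<Rightarrow> 'a"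
  where "alg_diff A x y = alg_add A x (alg_scale A (-1) y)"

definition cstar_seminorm :: "('a, 'b) star_algebra_scheme \<Rightarrow> ('a \<Rightarrow> real) \<Rightarrow> bool"
  where "cstar_seminorm A p \<longleftrightarrow>
    (\<forall>x\<in>alg_carrier A. 0 \<le> p x) \<and>
    (\<forall>x\<in>alg_carrier A. \<forall>c. p (alg_scale A c x) = cmod c * p x) \<and>
    (\<forall>x\<in>alg_carrier A. \<forall>y\<in>alg_carrier A. p (alg_add A x y) \<le> p x + p y) \<and>
    (\<forall>x\<in>alg_carrier A. \<forall>y\<in>alg_carrier A. p (alg_mult A x y) \<le> p x * p y) \<and>
    (\<forall>x\<in>alg_carrier A. p (alg_mult A (alg_star A x) x) = (p x)\<^sup>2)"

definition cauchy_seqs :: "('a, 'b) star_algebra_scheme \<Rightarrow> ('a \<Rightarrow> real) \<Rightarrow> (nat \<Rightarrow> 'a) set"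
  where "cauchy_seqs A p =
    {u. (\<forall>n. u n \<in> alg_carrier A) \<and>
        (\<forall>\<epsilon>>0. \<exists>N. \<forall>m\<ge>N. \<forall>n\<ge>N. p (alg_diff A (u m) (u n)) < \<epsilon>)}"

definition cauchy_class ::
    "('a, 'b) star_algebra_scheme \<Rightarrow> ('a \<Rightarrow> real) \<Rightarrow> (nat \<Rightarrow> 'a) \<Rightarrow> (nat \<Rightarrow> 'a) set"
  where "cauchy_class A p u =
    {v \<in> cauchy_seqs A p. (\<lambda>n. p (alg_diff A (u n) (v n))) \<longlonglongrightarrow> 0}"

text \<open>The Hausdorff completion of \<open>A\<close> in the seminorm \<open>p\<close>: Cauchy sequences modulo null sequences,
  with operations computed on chosen representatives.\<close>

definition seq_rep :: "(nat \<Rightarrow> 'a) set \<Rightarrow> nat \<Rightarrow> 'a"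
  where "seq_rep \<xi> = (SOME u. u \<in> \<xi>)"

definition completion_alg ::
    "('a, 'b) star_algebra_scheme \<Rightarrow> ('a \<Rightarrow> real) \<Rightarrow> (nat \<Rightarrow> 'a) set normed_star_algebra"
  where "completion_alg A p =
    \<lparr> alg_carrier = cauchy_class A p ` cauchy_seqs A p,
      alg_add = (\<lambda>\<xi> \<eta>. cauchy_class A p (\<lambda>n. alg_add A (seq_rep \<xi> n) (seq_rep \<eta> n))),
      alg_scale = (\<lambda>c \<xi>. cauchy_class A p (\<lambda>n. alg_scale A c (seq_rep \<xi> n))),
      alg_mult = (\<lambda>\<xi> \<eta>. cauchy_class A p (\<lambda>n. alg_mult A (seq_rep \<xi> n) (seq_rep \<eta> n))),
      alg_star = (\<lambda>\<xi>. cauchy_class A p (\<lambda>n. alg_star A (seq_rep \<xi> n))),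
      alg_norm = (\<lambda>\<xi>. lim (\<lambda>n. p (seq_rep \<xi> n))) \<rparr>"

text \<open>The universal enveloping C*-algebra is the completion in the largest C*-seminorm. C*-seminorms
  are exactly the functions \<open>x \<mapsto> \<parallel>\<phi> x\<parallel>\<close> for star-homomorphisms \<open>\<phi>\<close> into C*-algebras, so this supremum
  ranges over all of these without quantifying over types. It is a supremum of a bounded set whenever
  \<open>A\<close> has an enveloping C*-algebra; for the crossed products below every C*-seminorm is bounded by
  the sum of the supremum norms of the components.\<close>

definition max_cstar_seminorm :: "('a, 'b) star_algebra_scheme \<Rightarrow> 'a \<Rightarrow> real"
  where "max_cstar_seminorm A x = (SUP p\<in>{p. cstar_seminorm A p}. p x)"

definition enveloping_cstar_algebra ::
    "('a, 'b) star_algebra_scheme \<Rightarrow> (nat \<Rightarrow> 'a) set normed_star_algebra"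
  where "enveloping_cstar_algebra A = completion_alg A (max_cstar_seminorm A)"

text \<open>The zero algebra counts as unital (it arises for empty \<open>X\<close>).\<close>

definition unital_alg :: "('a, 'b) star_algebra_scheme \<Rightarrow> bool"
  where "unital_alg B \<longleftrightarrow>
    (\<exists>u\<in>alg_carrier B. \<forall>b\<in>alg_carrier B. alg_mult B u b = b \<and> alg_mult B b u = b)"

text \<open>An approximate unit consists of positive elements (those of the form \<open>c\<^sup>* c\<close>) of norm at most
  one. A countable directed set has a cofinal sequence, so countable nets reduce to sequences.\<close>

definition countable_approximate_unit ::
    "('a, 'b) normed_star_algebra_scheme \<Rightarrow> (nat \<Rightarrow> 'a) \<Rightarrow> bool"
  where "countable_approximate_unit B u \<longleftrightarrow>
    (\<forall>n. u n \<in> alg_carrier B \<and> alg_norm B (u n) \<le> 1 \<and>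
         (\<exists>c\<in>alg_carrier B. u n = alg_mult B (alg_star B c) c)) \<and>
    (\<forall>b\<in>alg_carrier B. (\<lambda>n. alg_norm B (alg_diff B (alg_mult B (u n) b) b)) \<longlonglongrightarrow> 0 \<and>
                     (\<lambda>n. alg_norm B (alg_diff B (alg_mult B b (u n)) b)) \<longlonglongrightarrow> 0)"

definition sigma_unital_alg :: "('a, 'b) normed_star_algebra_scheme \<Rightarrow> bool"
  where "sigma_unital_alg B \<longleftrightarrow> (\<exists>u. countable_approximate_unit B u)"


section \<open>The crossed products\<close>

text \<open>For open \<open>U\<close>, the algebra \<open>C\<^sub>0(U)\<close>, realised as functions that vanish off \<open>U\<close>.\<close>

definition C0_on :: "'x topology \<Rightarrow> 'x set \<Rightarrow> ('x \<Rightarrow> complex) set"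
  where "C0_on X U =
    {f. continuous_map (subtopology X U) euclidean f \<and> (\<forall>x. x \<notin> U \<longrightarrow> f x = 0) \<and>
        (\<forall>\<epsilon>>0. compactin X {x \<in> U. \<epsilon> \<le> cmod (f x)})}"

definition sup_norm :: "('x \<Rightarrow> complex) \<Rightarrow> real"
  where "sup_norm f = (SUP x. cmod (f x))"

text \<open>\<open>f \<circ> \<theta>\<^bsub>s\<^sup>\<star>\<^esub>\<close>, extended by zero outside the domain of \<open>\<theta>\<^bsub>s\<^sup>\<star>\<^esub>\<close>.\<close>

definition act_fun ::
    "('s::inverse_semigroup \<Rightarrow> 'x \<rightharpoonup> 'x) \<Rightarrow> 's \<Rightarrow> ('x \<Rightarrow> complex) \<Rightarrow> 'x \<Rightarrow> complex"
  where "act_fun \<theta> s f = (\<lambda>x. case \<theta> (s\<^sup>\<star>) x of None \<Rightarrow> 0 | Some y \<Rightarrow> f y)"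

definition supp :: "('s \<Rightarrow> 'x \<Rightarrow> complex) \<Rightarrow> 's set"
  where "supp T = {s. T s \<noteq> (\<lambda>_. 0)}"

definition delta :: "'s \<Rightarrow> ('x \<Rightarrow> complex) \<Rightarrow> 's \<Rightarrow> 'x \<Rightarrow> complex"
  where "delta s a = (\<lambda>t. if t = s then a else (\<lambda>_. 0))"

text \<open>The product and the involution are the (bi)additive extensions of their values on the elements
  \<^const>\<open>delta\<close>, see \<open>KS_mult_delta\<close> and \<open>KS_star_delta\<close> below.\<close>

definition KS_alg ::
    "'x topology \<Rightarrow> ('s::inverse_semigroup \<Rightarrow> 'x \<rightharpoonup> 'x) \<Rightarrow> ('s \<Rightarrow> 'x \<Rightarrow> complex) star_algebra"
  where "KS_alg X \<theta> =
    \<lparr> alg_carrier = {T. finite (supp T) \<and> (\<forall>s. T s \<in> C0_on X (act_dom \<theta> (s\<^sup>\<star> * s)))},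
      alg_add = (\<lambda>T U s x. T s x + U s x),
      alg_scale = (\<lambda>c T s x. c * T s x),
      alg_mult = (\<lambda>T U r x. \<Sum>(s, t)\<in>{(s, t). s \<in> supp T \<and> t \<in> supp U \<and> s * t = r}.
                    act_fun \<theta> (t\<^sup>\<star>) (\<lambda>y. T s y * act_fun \<theta> t (U t) y) x),
      alg_star = (\<lambda>T r. act_fun \<theta> (r\<^sup>\<star>) (\<lambda>y. cnj (T (r\<^sup>\<star>) y))) \<rparr>"

definition KS_full ::
    "'x topology \<Rightarrow> ('s::inverse_semigroup \<Rightarrow> 'x \<rightharpoonup> 'x) \<Rightarrow>
      (nat \<Rightarrow> 's \<Rightarrow> 'x \<Rightarrow> complex) set normed_star_algebra"
  where "KS_full X \<theta> = enveloping_cstar_algebra (KS_alg X \<theta>)"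

definition source_fibre :: "'s::inverse_semigroup \<Rightarrow> 's set"
  where "source_fibre e = {s. s\<^sup>\<star> * s = e}"

text \<open>The Hilbert module \<open>l\<^sup>2(S\<^sub>e, A\<^sub>e)\<close>: families \<open>\<xi>\<close> (extended by zero outside \<open>S\<^sub>e\<close>) for which
  \<open>\<Sum>\<^sub>t \<xi>\<^sub>t\<^sup>* \<xi>\<^sub>t\<close> converges unconditionally in the norm of \<open>A\<^sub>e\<close>.\<close>

definition l2_module ::
    "'x topology \<Rightarrow> ('s::inverse_semigroup \<Rightarrow> 'x \<rightharpoonup> 'x) \<Rightarrow> 's \<Rightarrow> ('s \<Rightarrow> 'x \<Rightarrow> complex) set"
  where "l2_module X \<theta> e =
    {\<xi>. (\<forall>t\<in>source_fibre e. \<xi> t \<in> C0_on X (act_dom \<theta> e)) \<and>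
        (\<forall>t. t \<notin> source_fibre e \<longrightarrow> \<xi> t = (\<lambda>_. 0)) \<and>
        (\<exists>h\<in>C0_on X (act_dom \<theta> e).
           uniform_limit UNIV (\<lambda>F x. \<Sum>t\<in>F. cnj (\<xi> t x) * \<xi> t x) h
             (finite_subsets_at_top (source_fibre e)))}"

definition l2_inner ::
    "'s::inverse_semigroup \<Rightarrow> ('s \<Rightarrow> 'x \<Rightarrow> complex) \<Rightarrow> ('s \<Rightarrow> 'x \<Rightarrow> complex) \<Rightarrow> 'x \<Rightarrow> complex"
  where "l2_inner e \<xi> \<eta> = (\<lambda>x. \<Sum>\<^sub>\<infinity>t\<in>source_fibre e. cnj (\<xi> t x) * \<eta> t x)"

definition l2_norm :: "'s::inverse_semigroup \<Rightarrow> ('s \<Rightarrow> 'x \<Rightarrow> complex) \<Rightarrow> real"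
  where "l2_norm e \<xi> = sqrt (sup_norm (l2_inner e \<xi> \<xi>))"

text \<open>The operator \<open>\<ell>\<^sub>e(T)\<close>, which is determined by its values on elementary vectors, see \<open>KS_ell_delta\<close>
  below. For given \<open>r\<close> and \<open>s\<close> at most \<open>t = s\<^sup>\<star> r\<close> contributes, so the sum is finite.\<close>

definition KS_ell ::
    "('s::inverse_semigroup \<Rightarrow> 'x \<rightharpoonup> 'x) \<Rightarrow> 's \<Rightarrow> ('s \<Rightarrow> 'x \<Rightarrow> complex) \<Rightarrow>
      ('s \<Rightarrow> 'x \<Rightarrow> complex) \<Rightarrow> 's \<Rightarrow> 'x \<Rightarrow> complex"
  where "KS_ell \<theta> e T \<xi> = (\<lambda>r x.
    \<Sum>(s, t)\<in>{(s, t). s \<in> supp T \<and> t \<in> source_fibre e \<and> s\<^sup>\<star> * s * t = t \<and> s * t = r}.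
      act_fun \<theta> (t\<^sup>\<star>) (\<lambda>y. T s y * act_fun \<theta> t (\<xi> t) y) x)"

definition l2_operator_norm ::
    "'x topology \<Rightarrow> ('s::inverse_semigroup \<Rightarrow> 'x \<rightharpoonup> 'x) \<Rightarrow> 's \<Rightarrow>
      (('s \<Rightarrow> 'x \<Rightarrow> complex) \<Rightarrow> ('s \<Rightarrow> 'x \<Rightarrow> complex)) \<Rightarrow> real"
  where "l2_operator_norm X \<theta> e L =
    (SUP \<xi>\<in>{\<xi> \<in> l2_module X \<theta> e. l2_norm e \<xi> \<le> 1}. l2_norm e (L \<xi>))"

definition KS_reduced_norm ::
    "'x topology \<Rightarrow> ('s::inverse_semigroup \<Rightarrow> 'x \<rightharpoonup> 'x) \<Rightarrow> ('s \<Rightarrow> 'x \<Rightarrow> complex) \<Rightarrow> real"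
  where "KS_reduced_norm X \<theta> T = (SUP e\<in>idempotents. l2_operator_norm X \<theta> e (KS_ell \<theta> e T))"

definition KS_reduced ::
    "'x topology \<Rightarrow> ('s::inverse_semigroup \<Rightarrow> 'x \<rightharpoonup> 'x) \<Rightarrow>
      (nat \<Rightarrow> 's \<Rightarrow> 'x \<Rightarrow> complex) set normed_star_algebra"
  where "KS_reduced X \<theta> = completion_alg (KS_alg X \<theta>) (KS_reduced_norm X \<theta>)"

lemma sinv_unique:
  fixes s :: "'s::inverse_semigroup"
  shows "s * s\<^sup>\<star> * s = s \<and> s\<^sup>\<star> * s * s\<^sup>\<star> = s\<^sup>\<star>"
    and "s * t * s = s \<Longrightarrow> t * s * t = t \<Longrightarrow> t = s\<^sup>\<star>"
proof -
  show *: "s * s\<^sup>\<star> * s = s \<and> s\<^sup>\<star> * s * s\<^sup>\<star> = s\<^sup>\<star>"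
    unfolding sinv_def by (rule theI') (rule ex1_generalized_inverse)
  show "t = s\<^sup>\<star>" if "s * t * s = s" "t * s * t = t"
    using * that ex1_generalized_inverse[of s] by blast
qed

lemma sinv_sinv: "(s\<^sup>\<star>)\<^sup>\<star> = (s::'s::inverse_semigroup)"
  using sinv_unique(1)[of s] sinv_unique(2)[of "s\<^sup>\<star>" s] by metis

lemma act_fun_zero: "act_fun \<theta> s (\<lambda>_. 0) = (\<lambda>_. 0)"
  by (auto simp: act_fun_def split: option.split)

lemma KS_mult_delta:
  "alg_mult (KS_alg X \<theta>) (delta s a) (delta t b) =
    delta (s * t) (act_fun \<theta> (t\<^sup>\<star>) (\<lambda>y. a y * act_fun \<theta> t b y))"
proof (intro ext)
  fix r x
  let ?I = "{(p, q). p \<in> supp (delta s a) \<and> q \<in> supp (delta t b) \<and> p * q = r}"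
  let ?g = "\<lambda>(p, q). act_fun \<theta> (q\<^sup>\<star>) (\<lambda>y. delta s a p y * act_fun \<theta> q (delta t b q) y) x"
  have sub: "?I \<subseteq> (if s * t = r then {(s, t)} else {})"
    by (auto simp: supp_def delta_def split: if_splits)
  have "sum ?g ?I = sum ?g (if s * t = r then {(s, t)} else {})"
  proof (rule sum.mono_neutral_left[OF _ sub])
    show "\<forall>i\<in>(if s * t = r then {(s, t)} else {}) - ?I. ?g i = 0"
      by (auto simp: supp_def delta_def act_fun_zero split: if_splits)
  qed auto
  then show "alg_mult (KS_alg X \<theta>) (delta s a) (delta t b) r x =
      delta (s * t) (act_fun \<theta> (t\<^sup>\<star>) (\<lambda>y. a y * act_fun \<theta> t b y)) r x"
    by (auto simp: KS_alg_def delta_def split: if_splits)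
qed

lemma KS_star_delta:
  "alg_star (KS_alg X \<theta>) (delta s a) = delta (s\<^sup>\<star>) (act_fun \<theta> s (\<lambda>y. cnj (a y)))"
proof (rule ext)
  fix r
  show "alg_star (KS_alg X \<theta>) (delta s a) r = delta (s\<^sup>\<star>) (act_fun \<theta> s (\<lambda>y. cnj (a y))) r"
  proof (cases "r = s\<^sup>\<star>")
    case False
    then have "r\<^sup>\<star> \<noteq> s" using sinv_sinv by metis
    with False show ?thesis by (simp add: KS_alg_def delta_def act_fun_zero)
  qed (simp add: KS_alg_def delta_def sinv_sinv)
qed

lemma KS_ell_delta:
  assumes "t \<in> source_fibre e"
  shows "KS_ell \<theta> e (delta s a) (delta t y) =
    (if s\<^sup>\<star> * s * t = t then delta (s * t) (act_fun \<theta> (t\<^sup>\<star>) (\<lambda>z. a z * act_fun \<theta> t y z))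
     else (\<lambda>_ _. 0))"
proof (intro ext)
  fix r x
  let ?I = "{(p, q). p \<in> supp (delta s a) \<and> q \<in> source_fibre e \<and> p\<^sup>\<star> * p * q = q \<and> p * q = r}"
  let ?J = "if s\<^sup>\<star> * s * t = t \<and> s * t = r then {(s, t)} else {}"
  let ?g = "\<lambda>(p, q). act_fun \<theta> (q\<^sup>\<star>) (\<lambda>z. delta s a p z * act_fun \<theta> q (delta t y q) z) x"
  have "?I \<subseteq> {(s, s\<^sup>\<star> * r)}"
    by (auto simp: supp_def delta_def mult.assoc split: if_splits)
  then have fin: "finite ?I" by (rule finite_subset) simp
  have "sum ?g ?I = sum ?g (?I \<inter> {(s, t)})"
    by (rule sum.mono_neutral_right[OF fin])
      (auto simp: supp_def delta_def act_fun_zero split: if_splits)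
  also have "\<dots> = sum ?g ?J"
    by (rule sum.mono_neutral_left)
      (use assms in \<open>auto simp: supp_def delta_def act_fun_zero split: if_splits\<close>)
  finally show "KS_ell \<theta> e (delta s a) (delta t y) r x =
    (if s\<^sup>\<star> * s * t = t then delta (s * t) (act_fun \<theta> (t\<^sup>\<star>) (\<lambda>z. a z * act_fun \<theta> t y z))
     else (\<lambda>_ _. 0)) r x"
    by (auto simp: KS_ell_def delta_def split: if_splits)
qed

end

theory Submission
  imports Defs "HOL-Library.Function_Algebras"
begin

text \<open>
  The elements \<open>\<delta>\<^sub>f a\<close> with \<open>f\<close> idempotent commute, \<open>\<delta>\<^sub>e a \<delta>\<^sub>f b = \<delta>\<^bsub>ef\<^esub> a b\<close>, and their characters are the
  points of the space of Khoshkam and Skandalis: \<open>\<tau>\<close> sends \<open>\<delta>\<^sub>e a\<close> to \<open>a(\<tau>(e))\<close>. This is why compactness of that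
  space is the same as unitality of the crossed products. All three notions are compared with the
  existence of a finite or countable cover by pairs \<open>(f, K)\<close>.

  \<^bold>\<open>Covers and the space.\<close> For compact \<open>K\<close> in \<open>X\<^sub>f\<close> the set of the families \<open>\<tau>\<close> with \<open>\<tau>(f) \<in> K\<close> is compact, because
  together with \<open>\<infinity>\<close> the space is closed in a product of compact spaces
  (\<open>closedin_KS_closure_set\<close>). A cover by pairs becomes a cover by such sets, since \<open>\<tau>(e) = x\<close>
  finite and \<open>f \<ge> e\<close> give \<open>\<tau>(f) = x\<close>. Conversely, a compact set of families is covered by the sets of
  finitely many pairs, and a point \<open>x\<close> of \<open>X\<^sub>e\<close> is tested on the family that is \<open>x\<close> above \<open>e\<close> and \<open>\<infinity>\<close> elsewhere.

  \<^bold>\<open>From covers to units.\<close> Let \<open>a\<^sub>i\<close> be bump functions on \<open>X\<^bsub>f i\<^esub>\<close> that equal \<open>1\<close> near \<open>K\<^sub>i\<close>, and put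
  \<open>1 - u\<^sub>n = \<Prod>\<^bsub>i<n\<^esub> (1 - \<delta>\<^bsub>f i\<^esub> a\<^sub>i)\<close>. If \<open>f i \<ge> e\<close> then \<open>(1 - \<delta>\<^bsub>f i\<^esub> a\<^sub>i) \<delta>\<^sub>e b = \<delta>\<^sub>e ((1 - a\<^sub>i) b)\<close>. So \<open>(1 - u\<^sub>n) \<delta>\<^sub>e b\<close> vanishes for
  large \<open>n\<close> when the cover is finite, and it tends to \<open>0\<close> when the cover is countable, because the set where
  \<open>\<bar>b\<bar> \<ge> \<epsilon>\<close> is compact. The factors with other indices do no harm: each \<open>1 - \<delta>\<^sub>f a\<close> is the real part of a
  unitary over the unitization and thus contractive for every C*-seminorm
  (\<open>norm_one_minus_delta\<close>). The same trick shows that the supremum norm bounds every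
  C*-seminorm on \<open>\<delta>\<^sub>s a\<close> (\<open>norm_delta_le\<close>), so that the largest C*-seminorm exists. An approximate
  unit has to consist of elements \<open>c\<^sup>* c\<close> of norm at most \<open>1\<close>; these are obtained from \<open>u\<^sub>n\<close> in
  \<open>norm_correction\<close>. The argument applies to every C*-seminorm on the algebra, hence to the full
  and to the reduced norm.

  \<^bold>\<open>From units to covers.\<close> Suppose that \<open>U = \<Sum>\<^sub>s \<delta>\<^sub>s U\<^sub>s\<close>, a finite sum, satisfies \<open>\<parallel>U \<delta>\<^sub>e b - \<delta>\<^sub>e b\<parallel> \<le> 1/2\<close>, where \<open>b(x) = 1\<close>.
  The matrix coefficient of \<open>\<ell>\<^sub>e(U \<delta>\<^sub>e b - \<delta>\<^sub>e b)\<close> at the basis vector \<open>e\<close>, evaluated at \<open>x\<close>, is the sum of the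
  numbers \<open>U\<^sub>s(x)\<close> over \<open>s \<ge> e\<close> minus \<open>1\<close> (\<open>reduced_norm_coefficient\<close>). So some \<open>\<bar>U\<^sub>s(x)\<bar>\<close> with \<open>s \<ge> e\<close>
  is bounded below by a constant depending only on the number of components of \<open>U\<close>, and the pairs of
  \<open>s\<^sup>* s\<close> and the compact set where \<open>\<bar>U\<^sub>s\<bar>\<close> is at least this constant cover. This uses the reduced norm,
  which is at most the full norm once it is known to be a C*-seminorm
  (\<open>cstar_seminorm_reduced\<close>); that in turn is seen on the fibres of the Hilbert modules.
\<close>

section \<open>Inverse semigroups\<close>

lemma sinv_mult_self [simp]: "s * s\<^sup>\<star> * s = (s::'s::inverse_semigroup)"
  and self_mult_sinv [simp]: "s\<^sup>\<star> * s * s\<^sup>\<star> = (s\<^sup>\<star>::'s::inverse_semigroup)"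
  using sinv_unique(1)[of s] by simp_all

lemma sinv_mult_self2 [simp]: "s * (s\<^sup>\<star> * s) = (s::'s::inverse_semigroup)"
  and self_mult_sinv2 [simp]: "s\<^sup>\<star> * (s * s\<^sup>\<star>) = (s\<^sup>\<star>::'s::inverse_semigroup)"
  by (simp_all flip: mult.assoc)

lemma sinv_mult_self3 [simp]: "s * (s\<^sup>\<star> * (s * t)) = s * (t::'s::inverse_semigroup)"
  and self_mult_sinv3 [simp]: "s\<^sup>\<star> * (s * (s\<^sup>\<star> * t)) = s\<^sup>\<star> * (t::'s::inverse_semigroup)"
  by (simp_all flip: mult.assoc)

lemma sinv_idempotent: "e \<in> idempotents \<Longrightarrow> e\<^sup>\<star> = (e::'s::inverse_semigroup)"
  using sinv_unique(2)[of e e] by (simp add: idempotents_def)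

lemma idempotents_iff: "e \<in> idempotents \<longleftrightarrow> e * e = e"
  by (simp add: idempotents_def)

lemma source_idempotent [simp]: "s\<^sup>\<star> * s \<in> idempotents"
  and range_idempotent [simp]: "s * s\<^sup>\<star> \<in> idempotents"
  by (simp_all add: idempotents_def mult.assoc)

text \<open>The element \<open>f (ef)\<^sup>\<star> e\<close> is another inverse of \<open>ef\<close>, hence equals \<open>(ef)\<^sup>\<star>\<close>; this makes
  \<open>(ef)\<^sup>\<star>\<close>, and with it \<open>ef\<close>, idempotent.\<close>

lemma idempotent_mult_closed:
  assumes e: "e \<in> idempotents" and f: "f \<in> idempotents"
  shows "e * f \<in> idempotents"
proof -
  have ee: "e * e = e" and ff: "f * f = f" using e f by (auto simp: idempotents_def)
  have ee': "e * (e * t) = e * t" and ff': "f * (f * t) = f * t" for t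
    using ee ff by (metis mult.assoc)+
  define x where "x = (e * f)\<^sup>\<star>"
  have a: "e * f * x * (e * f) = e * f" and b: "x * (e * f) * x = x"
    unfolding x_def by simp_all
  have "f * x * e = x"
    unfolding x_def
  proof (rule sinv_unique(2)[of "e * f"])
    show "e * f * (f * (e * f)\<^sup>\<star> * e) * (e * f) = e * f"
      using a by (simp add: mult.assoc x_def ee' ff')
    show "f * (e * f)\<^sup>\<star> * e * (e * f) * (f * (e * f)\<^sup>\<star> * e) = f * (e * f)\<^sup>\<star> * e"
      using b by (simp add: mult.assoc x_def ee' ff') (metis mult.assoc)
  qed
  then have "x * x = f * x * e * (f * x * e)" by simp
  also have "\<dots> = f * (x * (e * f) * x) * e" by (simp add: mult.assoc)
  also have "\<dots> = x" using b \<open>f * x * e = x\<close> by simp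
  finally have xx: "x * x = x" .
  then have "x\<^sup>\<star> = x" using sinv_idempotent by (auto simp: idempotents_def)
  then have "e * f = x" unfolding x_def by (simp add: sinv_sinv)
  then show ?thesis using xx by (simp add: idempotents_def)
qed

lemma idempotent_commute:
  fixes e f :: "'s::inverse_semigroup"
  assumes e: "e \<in> idempotents" and f: "f \<in> idempotents"
  shows "e * f = f * e"
proof -
  have ee: "e * e = e" and ff: "f * f = f" using e f by (auto simp: idempotents_def)
  have ee': "e * (e * t) = e * t" and ff': "f * (f * t) = f * t" for t
    using ee ff by (metis mult.assoc)+
  have ef: "e * f * (e * f) = e * f" and fe: "f * e * (f * e) = f * e"
    using idempotent_mult_closed[OF e f] idempotent_mult_closed[OF f e]
    by (auto simp: idempotents_def)
  have "f * e = (e * f)\<^sup>\<star>"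
    by (rule sinv_unique(2)) (use ef fe in \<open>simp_all add: mult.assoc ee' ff'\<close>)
  then show ?thesis using sinv_idempotent[OF idempotent_mult_closed[OF e f]] by simp
qed

lemma sinv_mult: "(s * t)\<^sup>\<star> = t\<^sup>\<star> * (s\<^sup>\<star> :: 's::inverse_semigroup)"
proof (rule sinv_unique(2)[symmetric])
  have c: "t * t\<^sup>\<star> * (s\<^sup>\<star> * s) = s\<^sup>\<star> * s * (t * t\<^sup>\<star>)"
    by (rule idempotent_commute) simp_all
  have "s * t * (t\<^sup>\<star> * s\<^sup>\<star>) * (s * t) = s * (t * t\<^sup>\<star> * (s\<^sup>\<star> * s)) * t"
    by (simp add: mult.assoc)
  also have "\<dots> = s * t" unfolding c by (simp add: mult.assoc)
  finally show "s * t * (t\<^sup>\<star> * s\<^sup>\<star>) * (s * t) = s * t" .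
  have "t\<^sup>\<star> * s\<^sup>\<star> * (s * t) * (t\<^sup>\<star> * s\<^sup>\<star>) = t\<^sup>\<star> * (s\<^sup>\<star> * s * (t * t\<^sup>\<star>)) * s\<^sup>\<star>"
    by (simp add: mult.assoc)
  also have "\<dots> = t\<^sup>\<star> * s\<^sup>\<star>" unfolding c[symmetric] by (simp add: mult.assoc)
  finally show "t\<^sup>\<star> * s\<^sup>\<star> * (s * t) * (t\<^sup>\<star> * s\<^sup>\<star>) = t\<^sup>\<star> * s\<^sup>\<star>" .
qed

lemma natural_le_idempotent:
  "e \<in> idempotents \<Longrightarrow> e \<preceq> t \<longleftrightarrow> t * e = e"
  by (simp add: natural_le_def sinv_idempotent mult.assoc idempotents_iff)

lemma natural_le_idempotent_left:
  "e \<in> idempotents \<Longrightarrow> f \<in> idempotents \<Longrightarrow> e \<preceq> f \<longleftrightarrow> e * f = e"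
  by (simp add: natural_le_idempotent idempotent_commute)

lemma natural_le_imp_le_source:
  fixes e t :: "'s::inverse_semigroup"
  assumes e: "e \<in> idempotents" and le: "e \<preceq> t"
  shows "e \<preceq> t\<^sup>\<star> * t"
proof -
  have te: "t * e = e" using assms by (simp add: natural_le_idempotent)
  then have "e * t\<^sup>\<star> = e" using sinv_mult[of t e] sinv_idempotent[OF e] by simp
  then have "e * (t\<^sup>\<star> * t) = e * t" by (simp flip: mult.assoc)
  moreover have "t * e = t * e * (t\<^sup>\<star> * t)"
  proof -
    have "t * e * (t\<^sup>\<star> * t) = t * (t\<^sup>\<star> * t * e)"
      using idempotent_commute[OF e source_idempotent[of t]] by (simp add: mult.assoc)
    then show ?thesis by (simp add: mult.assoc)
  qed
  ultimately have "e * (t\<^sup>\<star> * t) = e" using te by simp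
  then show ?thesis using e by (simp add: natural_le_idempotent_left)
qed

text \<open>\<open>\<ell>\<^sub>e(\<delta>\<^sub>s a)\<close> annihilates the elementary vectors at those \<open>t\<close> with \<open>s\<^sup>\<star> s t \<noteq> t\<close>. This truncation is
  compatible with products, which is what makes \<open>\<ell>\<^sub>e\<close> multiplicative.\<close>

lemma source_mult_fixes_iff:
  fixes s u t :: "'s::inverse_semigroup"
  shows "(s * u)\<^sup>\<star> * (s * u) * t = t \<longleftrightarrow> u\<^sup>\<star> * u * t = t \<and> s\<^sup>\<star> * s * (u * t) = u * t"
proof (intro iffI conjI)
  assume h: "(s * u)\<^sup>\<star> * (s * u) * t = t"
  then have t: "t = u\<^sup>\<star> * (s\<^sup>\<star> * (s * (u * t)))" by (simp add: sinv_mult mult.assoc)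
  then show *: "u\<^sup>\<star> * u * t = t" by (metis mult.assoc self_mult_sinv3)
  have c: "u * u\<^sup>\<star> * (s\<^sup>\<star> * s) = s\<^sup>\<star> * s * (u * u\<^sup>\<star>)"
    by (rule idempotent_commute) simp_all
  have "u * t = u * u\<^sup>\<star> * (s\<^sup>\<star> * s) * (u * t)" by (subst t) (simp add: mult.assoc)
  also have "\<dots> = s\<^sup>\<star> * s * (u * t)" unfolding c by (simp add: mult.assoc)
  finally show "s\<^sup>\<star> * s * (u * t) = u * t" by simp
next
  assume "u\<^sup>\<star> * u * t = t \<and> s\<^sup>\<star> * s * (u * t) = u * t"
  then show "(s * u)\<^sup>\<star> * (s * u) * t = t" by (simp add: sinv_mult mult.assoc)
qed

section \<open>Actions\<close>

locale inverse_semigroup_action =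
  fixes X :: "'x topology" and \<theta> :: "'s::inverse_semigroup \<Rightarrow> 'x \<rightharpoonup> 'x"
  assumes action: "semigroup_action X \<theta>"
begin

lemma act_mult: "\<theta> (s * t) = \<theta> s \<circ>\<^sub>m \<theta> t"
  and act_inj: "inj_on (\<theta> s) (dom (\<theta> s))"
  and act_dom_open: "e \<in> idempotents \<Longrightarrow> openin X (act_dom \<theta> e)"
  and act_continuous: "continuous_map (subtopology X (act_dom \<theta> (s\<^sup>\<star> * s)))
        (subtopology X (act_dom \<theta> (s * s\<^sup>\<star>))) (\<lambda>x. the (\<theta> s x))"
  using action unfolding semigroup_action_def by blast+

lemma act_idempotent:
  assumes e: "e \<in> idempotents" and x: "\<theta> e x = Some y"
  shows "y = x"
proof -
  have "\<theta> e x = \<theta> (e * e) x" using e by (simp add: idempotents_def)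
  then have "\<theta> e y = Some y" using x by (simp add: act_mult map_comp_def)
  then show ?thesis using x act_inj[of e] unfolding inj_on_def by (metis domI)
qed

lemma act_dom_eq_dom: "e \<in> idempotents \<Longrightarrow> act_dom \<theta> e = dom (\<theta> e)"
  by (auto simp: act_dom_def dest: act_idempotent)

lemma act_sinv: "\<theta> s x = Some y \<Longrightarrow> \<theta> (s\<^sup>\<star>) y = Some x"
proof -
  assume a: "\<theta> s x = Some y"
  have "\<theta> s x = \<theta> (s * (s\<^sup>\<star> * s)) x" by simp
  then obtain z where "\<theta> (s\<^sup>\<star> * s) x = Some z"
    using a unfolding act_mult[of s "s\<^sup>\<star> * s"] by (auto simp: map_comp_def split: option.splits)
  with act_idempotent[OF source_idempotent this] a show ?thesis
    by (simp add: act_mult map_comp_def)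
qed

lemma act_sinv_iff: "\<theta> (s\<^sup>\<star>) y = Some x \<longleftrightarrow> \<theta> s x = Some y"
  using act_sinv[of s x y] act_sinv[of "s\<^sup>\<star>" y x] by (auto simp: sinv_sinv)

lemma mem_act_dom_source: "x \<in> act_dom \<theta> (s\<^sup>\<star> * s) \<longleftrightarrow> (\<exists>y. \<theta> s x = Some y)"
  using act_sinv[of s x]
  by (auto simp: act_dom_eq_dom act_mult map_comp_def dom_def split: option.splits)

lemma mem_act_dom_range: "y \<in> act_dom \<theta> (s * s\<^sup>\<star>) \<longleftrightarrow> (\<exists>x. \<theta> s x = Some y)"
  using mem_act_dom_source[of y "s\<^sup>\<star>"] by (simp add: sinv_sinv act_sinv_iff)

lemma act_dom_subset_topspace: "e \<in> idempotents \<Longrightarrow> act_dom \<theta> e \<subseteq> topspace X"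
  by (rule openin_subset[OF act_dom_open])

lemma act_dom_mult:
  assumes "e \<in> idempotents" "f \<in> idempotents"
  shows "act_dom \<theta> (e * f) = act_dom \<theta> e \<inter> act_dom \<theta> f"
  using assms act_idempotent
  by (fastforce simp: act_dom_def act_mult map_comp_def split: option.splits)

lemma act_dom_mono: "e \<in> idempotents \<Longrightarrow> f \<in> idempotents \<Longrightarrow> e \<preceq> f \<Longrightarrow> act_dom \<theta> e \<subseteq> act_dom \<theta> f"
  using act_dom_mult[of f e] by (auto simp: natural_le_idempotent)

end

section \<open>Functions vanishing at infinity\<close>

lemma continuous_map_complex_mult:
  fixes f g :: "'x \<Rightarrow> complex"
  assumes "continuous_map Y euclidean f" "continuous_map Y euclidean g"
  shows "continuous_map Y euclidean (\<lambda>x. f x * g x)"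
  using assms by (auto simp: continuous_map_atin limitin_canonical_iff intro: tendsto_mult)

lemma continuous_map_continuous_on_comp:
  assumes "continuous_map Y euclidean f" "continuous_on UNIV h"
  shows "continuous_map Y euclidean (\<lambda>x. h (f x))"
  using continuous_map_compose[of Y euclidean f euclidean h] assms by (simp add: o_def)

lemma C0_onI:
  assumes cont: "continuous_map (subtopology X U) euclidean f" and off: "\<And>x. x \<notin> U \<Longrightarrow> f x = 0"
    and comp: "\<And>\<epsilon>. \<epsilon> > 0 \<Longrightarrow> \<exists>K. compactin X K \<and> K \<subseteq> U \<and> (\<forall>x\<in>U. \<epsilon> \<le> cmod (f x) \<longrightarrow> x \<in> K)"
  shows "f \<in> C0_on X U"
  unfolding C0_on_def
proof (intro CollectI conjI allI impI)
  fix \<epsilon> :: real assume "\<epsilon> > 0"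
  then obtain K where K: "compactin X K" "K \<subseteq> U" "\<And>x. x \<in> U \<Longrightarrow> \<epsilon> \<le> cmod (f x) \<Longrightarrow> x \<in> K"
    using comp by meson
  have "closedin (subtopology X U) {x \<in> topspace (subtopology X U). cmod (f x) \<in> {\<epsilon>..}}"
    by (rule closedin_continuous_map_preimage[of _ euclidean])
      (use continuous_map_continuous_on_comp[OF cont, of cmod] in \<open>auto intro: continuous_intros\<close>)
  moreover have "compactin (subtopology X U) K" using K by (simp add: compactin_subtopology)
  ultimately have "compactin (subtopology X U)
      ({x \<in> topspace (subtopology X U). cmod (f x) \<in> {\<epsilon>..}} \<inter> K)"
    by (rule closed_Int_compactin)
  moreover have "{x \<in> topspace (subtopology X U). cmod (f x) \<in> {\<epsilon>..}} \<inter> K = {x \<in> U. \<epsilon> \<le> cmod (f x)}"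
    using K compactin_subset_topspace[OF K(1)] by auto
  ultimately show "compactin X {x \<in> U. \<epsilon> \<le> cmod (f x)}" by (simp add: compactin_subtopology)
qed (use cont off in auto)

lemma C0_on_continuous: "f \<in> C0_on X U \<Longrightarrow> continuous_map (subtopology X U) euclidean f"
  and C0_on_off: "f \<in> C0_on X U \<Longrightarrow> x \<notin> U \<Longrightarrow> f x = 0"
  and C0_on_compact: "f \<in> C0_on X U \<Longrightarrow> \<epsilon> > 0 \<Longrightarrow> compactin X {x \<in> U. \<epsilon> \<le> cmod (f x)}"
  by (auto simp: C0_on_def)

lemma C0_on_zero [simp]: "(\<lambda>_. 0) \<in> C0_on X U"
  by (auto simp: C0_on_def)

lemma C0_on_bounded:
  assumes f: "f \<in> C0_on X U"
  obtains B where "B > 0" "\<And>x. cmod (f x) \<le> B"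
proof -
  define K where "K = {x \<in> U. 1 \<le> cmod (f x)}"
  have "compactin (subtopology X U) K"
    using C0_on_compact[OF f, of 1] by (simp add: compactin_subtopology K_def)
  then have "compactin euclidean (f ` K)"
    using C0_on_continuous[OF f] image_compactin by blast
  then have "bounded (f ` K)" by (simp add: compact_imp_bounded)
  then obtain B where B: "\<And>x. x \<in> K \<Longrightarrow> cmod (f x) \<le> B" by (auto simp: bounded_iff)
  have "cmod (f x) \<le> max B 1" for x
  proof (cases "x \<in> K")
    case False
    then show ?thesis using C0_on_off[OF f, of x] by (cases "x \<in> U") (auto simp: K_def)
  qed (use B in fastforce)
  then show ?thesis using that[of "max B 1"] by auto
qed

lemma C0_on_comp:
  assumes f: "f \<in> C0_on X U" and h: "continuous_on UNIV h" and h0: "h 0 = (0::complex)"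
  shows "(\<lambda>x. h (f x)) \<in> C0_on X U"
proof (rule C0_onI)
  show "continuous_map (subtopology X U) euclidean (\<lambda>x. h (f x))"
    by (rule continuous_map_continuous_on_comp[OF C0_on_continuous[OF f] h])
  fix \<epsilon> :: real assume "\<epsilon> > 0"
  then obtain d where d: "d > 0" "\<And>z. dist z 0 < d \<Longrightarrow> dist (h z) (h 0) < \<epsilon>"
    using h unfolding continuous_on_iff by (meson UNIV_I)
  show "\<exists>K. compactin X K \<and> K \<subseteq> U \<and> (\<forall>x\<in>U. \<epsilon> \<le> cmod (h (f x)) \<longrightarrow> x \<in> K)"
    by (rule exI[of _ "{x \<in> U. d \<le> cmod (f x)}"])
      (use C0_on_compact[OF f d(1)] d(2) h0 in \<open>force simp: not_less[symmetric]\<close>)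
qed (use C0_on_off[OF f] h0 in auto)

lemma C0_on_cmult: "f \<in> C0_on X U \<Longrightarrow> (\<lambda>x. c * f x) \<in> C0_on X U"
  by (rule C0_on_comp) (auto intro: continuous_intros)

lemma C0_on_cnj: "f \<in> C0_on X U \<Longrightarrow> (\<lambda>x. cnj (f x)) \<in> C0_on X U"
  by (rule C0_on_comp) (auto intro: continuous_intros)

lemma C0_on_add:
  assumes f: "f \<in> C0_on X U" and g: "g \<in> C0_on X U"
  shows "(\<lambda>x. f x + g x) \<in> C0_on X U"
proof (rule C0_onI)
  show "continuous_map (subtopology X U) euclidean (\<lambda>x. f x + g x)"
    by (intro continuous_map_add C0_on_continuous f g)
  fix \<epsilon> :: real assume "\<epsilon> > 0"
  then have *: "\<epsilon> / 2 > 0" by simp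
  show "\<exists>K. compactin X K \<and> K \<subseteq> U \<and> (\<forall>x\<in>U. \<epsilon> \<le> cmod (f x + g x) \<longrightarrow> x \<in> K)"
  proof (intro exI conjI ballI impI)
    show "compactin X ({x \<in> U. \<epsilon> / 2 \<le> cmod (f x)} \<union> {x \<in> U. \<epsilon> / 2 \<le> cmod (g x)})"
      by (intro compactin_Un C0_on_compact f g *)
    fix x assume "x \<in> U" "\<epsilon> \<le> cmod (f x + g x)"
    then show "x \<in> {x \<in> U. \<epsilon> / 2 \<le> cmod (f x)} \<union> {x \<in> U. \<epsilon> / 2 \<le> cmod (g x)}"
      using norm_triangle_ineq[of "f x" "g x"] by auto
  qed auto
qed (use C0_on_off[OF f] C0_on_off[OF g] in auto)

lemma C0_on_mult:
  assumes H: "Hausdorff_space X" and f: "f \<in> C0_on X U" and g: "g \<in> C0_on X V"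
  shows "(\<lambda>x. f x * g x) \<in> C0_on X (U \<inter> V)"
proof (rule C0_onI)
  have "continuous_map (subtopology X (U \<inter> V)) euclidean f"
       "continuous_map (subtopology X (U \<inter> V)) euclidean g"
    using continuous_map_from_subtopology_mono[OF C0_on_continuous[OF f], of "U \<inter> V"]
      continuous_map_from_subtopology_mono[OF C0_on_continuous[OF g], of "U \<inter> V"] by auto
  then show "continuous_map (subtopology X (U \<inter> V)) euclidean (\<lambda>x. f x * g x)"
    by (rule continuous_map_complex_mult)
  obtain B C where B: "B > 0" "\<And>x. cmod (f x) \<le> B" and C: "C > 0" "\<And>x. cmod (g x) \<le> C"
    using C0_on_bounded[OF f] C0_on_bounded[OF g] by metis
  fix \<epsilon> :: real assume \<epsilon>: "\<epsilon> > 0"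
  show "\<exists>K. compactin X K \<and> K \<subseteq> U \<inter> V \<and> (\<forall>x\<in>U \<inter> V. \<epsilon> \<le> cmod (f x * g x) \<longrightarrow> x \<in> K)"
  proof (intro exI conjI ballI impI)
    show "compactin X ({x \<in> U. \<epsilon> / C \<le> cmod (f x)} \<inter> {x \<in> V. \<epsilon> / B \<le> cmod (g x)})"
      using H B(1) C(1) \<epsilon> by (intro compactin_Int C0_on_compact f g) auto
    fix x assume x: "x \<in> U \<inter> V" "\<epsilon> \<le> cmod (f x * g x)"
    have "cmod (f x * g x) \<le> cmod (f x) * C" "cmod (f x * g x) \<le> B * cmod (g x)"
      by (auto simp: norm_mult intro: mult_left_mono mult_right_mono B C)
    then show "x \<in> {x \<in> U. \<epsilon> / C \<le> cmod (f x)} \<inter> {x \<in> V. \<epsilon> / B \<le> cmod (g x)}"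
      using x B(1) C(1) by (auto simp: field_simps)
  qed auto
qed (use C0_on_off[OF f] C0_on_off[OF g] in auto)

text \<open>Two compact neighbourhoods are nested around \<open>K\<close>: the function is \<open>1\<close> on the inner one, so that
  finitely many of the open sets \<open>W\<close> cover any compact set that such sets cover, and is supported in
  the outer one.\<close>

lemma C0_on_bump:
  assumes lc: "locally_compact_space X" and H: "Hausdorff_space X"
    and U: "openin X U" and K: "compactin X K" "K \<subseteq> U"
  obtains a :: "'x \<Rightarrow> real" and W where "\<And>x. 0 \<le> a x" "\<And>x. a x \<le> 1"
    "(\<lambda>x. complex_of_real (a x)) \<in> C0_on X U" "openin X W" "K \<subseteq> W" "W \<subseteq> U" "\<And>x. x \<in> W \<Longrightarrow> a x = 1"
proof -
  let ?Y = "subtopology X U"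
  have topY: "topspace ?Y = U" using openin_subset[OF U] by auto
  have lcY: "locally_compact_space ?Y" and HY: "Hausdorff_space ?Y"
    using lc H U by (auto intro: locally_compact_space_open_subset Hausdorff_space_subtopology)
  have *: "\<exists>V L. openin ?Y V \<and> compactin ?Y L \<and> closedin ?Y L \<and> C \<subseteq> V \<and> V \<subseteq> L"
    if "compactin ?Y C" for C
    using lcY HY that locally_compact_space_compact_closed_compact by blast
  obtain W L where W: "openin ?Y W" and L: "compactin ?Y L" "K \<subseteq> W" "W \<subseteq> L"
    using *[of K] K by (auto simp: compactin_subtopology)
  obtain V M where V: "openin ?Y V" and M: "compactin ?Y M" "L \<subseteq> V" "V \<subseteq> M"
    using *[OF L(1)] by auto
  have cr: "completely_regular_space ?Y"
    using lcY HY locally_compact_Hausdorff_imp_regular_space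
      locally_compact_regular_imp_completely_regular_space by blast
  have cl: "closedin ?Y (U - V)" using closedin_diff[OF closedin_topspace V] topY by simp
  obtain f where f: "continuous_map ?Y (subtopology euclidean {0..1}) f"
      "f ` (U - V) \<subseteq> {0}" "f ` L \<subseteq> {1::real}"
    by (rule Urysohn_completely_regular_compact_closed[OF _ cr L(1) cl, of 0 1])
      (use M in \<open>auto simp: disjnt_def\<close>)
  have fr: "f x \<in> {0..1}" if "x \<in> U" for x
    using f(1) that topY unfolding continuous_map_in_subtopology Pi_iff by metis
  define a where "a = (\<lambda>x. if x \<in> U then f x else 0)"
  have WU: "W \<subseteq> U" using openin_subset[OF W] topY by auto
  have "(\<lambda>x. complex_of_real (a x)) \<in> C0_on X U"
  proof (rule C0_onI)
    have "continuous_map ?Y euclidean f" using f(1) continuous_map_into_fulltopology by blast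
    then have "continuous_map ?Y euclidean (\<lambda>x. complex_of_real (f x))"
      by (rule continuous_map_continuous_on_comp) (intro continuous_intros)
    then show "continuous_map ?Y euclidean (\<lambda>x. complex_of_real (a x))"
      by (rule continuous_map_eq) (simp add: a_def topY)
    fix \<epsilon> :: real assume "\<epsilon> > 0"
    then show "\<exists>K. compactin X K \<and> K \<subseteq> U \<and> (\<forall>x\<in>U. \<epsilon> \<le> cmod (complex_of_real (a x)) \<longrightarrow> x \<in> K)"
      using f(2) M by (intro exI[of _ M]) (force simp: compactin_subtopology a_def)
  qed (simp add: a_def)
  moreover have "openin X W" using W U openin_trans_full by blast
  moreover have "a x = 1" if "x \<in> W" for x using that WU f(3) L(3) by (force simp: a_def)
  ultimately show ?thesis
    using that[of a W] fr L(2) WU by (simp add: a_def)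
qed

locale locally_compact_action = inverse_semigroup_action X \<theta>
  for X :: "'x topology" and \<theta> :: "'s::inverse_semigroup \<Rightarrow> 'x \<rightharpoonup> 'x" +
  assumes locally_compact: "locally_compact_space X" and Hausdorff: "Hausdorff_space X"
begin

lemma act_compact_image:
  assumes K: "compactin X K" "K \<subseteq> act_dom \<theta> (s\<^sup>\<star> * s)"
  shows "compactin X ((\<lambda>x. the (\<theta> s x)) ` K)"
proof -
  have "compactin (subtopology X (act_dom \<theta> (s * s\<^sup>\<star>))) ((\<lambda>x. the (\<theta> s x)) ` K)"
    by (rule image_compactin[OF _ act_continuous]) (use K in \<open>simp add: compactin_subtopology\<close>)
  then show ?thesis by (simp add: compactin_subtopology)
qed

lemma C0_on_pullback:
  assumes f: "f \<in> C0_on X V" and V: "V \<subseteq> act_dom \<theta> (t * t\<^sup>\<star>)"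
  shows "(\<lambda>x. case \<theta> t x of None \<Rightarrow> 0 | Some y \<Rightarrow> f y) \<in> C0_on X {x. \<exists>y\<in>V. \<theta> t x = Some y}"
    (is "?g \<in> C0_on X ?W")
proof (rule C0_onI)
  have W: "?W \<subseteq> act_dom \<theta> (t\<^sup>\<star> * t)" by (auto simp: mem_act_dom_source)
  have "continuous_map (subtopology X ?W) (subtopology X (act_dom \<theta> (t * t\<^sup>\<star>))) (\<lambda>x. the (\<theta> t x))"
    by (rule continuous_map_from_subtopology_mono[OF act_continuous W])
  then have "continuous_map (subtopology X ?W) (subtopology X V) (\<lambda>x. the (\<theta> t x))"
    using V by (auto simp: continuous_map_in_subtopology)
  then have "continuous_map (subtopology X ?W) euclidean (f \<circ> (\<lambda>x. the (\<theta> t x)))"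
    using C0_on_continuous[OF f] continuous_map_compose by blast
  then show "continuous_map (subtopology X ?W) euclidean ?g"
    by (rule continuous_map_eq) auto
  show "?g x = 0" if "x \<notin> ?W" for x
    using that C0_on_off[OF f] by (auto split: option.split)
  fix \<epsilon> :: real assume "\<epsilon> > 0"
  define K where "K = {y \<in> V. \<epsilon> \<le> cmod (f y)}"
  have "compactin X ((\<lambda>x. the (\<theta> (t\<^sup>\<star>) x)) ` K)"
    by (rule act_compact_image)
      (use C0_on_compact[OF f \<open>\<epsilon> > 0\<close>] V in \<open>auto simp: K_def sinv_sinv\<close>)
  moreover have "(\<lambda>x. the (\<theta> (t\<^sup>\<star>) x)) ` K \<subseteq> ?W"
  proof clarify
    fix y assume y: "y \<in> K"
    then obtain x where "\<theta> t x = Some y" using V by (auto simp: K_def mem_act_dom_range subset_iff)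
    then show "\<exists>z\<in>V. \<theta> t (the (\<theta> (t\<^sup>\<star>) y)) = Some z" using act_sinv y by (auto simp: K_def)
  qed
  moreover have "x \<in> (\<lambda>x. the (\<theta> (t\<^sup>\<star>) x)) ` K" if x: "x \<in> ?W" "\<epsilon> \<le> cmod (?g x)" for x
  proof -
    obtain y where y: "y \<in> V" "\<theta> t x = Some y" using x by auto
    then show ?thesis
      by (intro image_eqI[of _ _ y]) (use x act_sinv[OF y(2)] in \<open>auto simp: K_def\<close>)
  qed
  ultimately show "\<exists>K. compactin X K \<and> K \<subseteq> ?W \<and> (\<forall>x\<in>?W. \<epsilon> \<le> cmod (?g x) \<longrightarrow> x \<in> K)"
    by (intro exI[of _ "(\<lambda>x. the (\<theta> (t\<^sup>\<star>) x)) ` K"] conjI ballI impI) auto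
qed

end

section \<open>Compactness of the space of Khoshkam and Skandalis\<close>

context locally_compact_action
begin

abbreviation KS_product :: "('s \<Rightarrow> 'x option) topology"
  where "KS_product \<equiv>
    product_topology (\<lambda>e. Alexandroff_compactification (subtopology X (act_dom \<theta> e))) idempotents"

lemma topspace_act_dom: "e \<in> idempotents \<Longrightarrow> topspace (subtopology X (act_dom \<theta> e)) = act_dom \<theta> e"
  using act_dom_subset_topspace[of e] by auto

lemma topspace_KS_product:
  "topspace KS_product = (\<Pi>\<^sub>E e\<in>idempotents. insert None (Some ` act_dom \<theta> e))"
  unfolding topspace_product_topology topspace_Alexandroff_compactification
  by (rule PiE_cong) (simp only: topspace_act_dom)

lemma KS_closure_set_subset: "KS_closure_set \<theta> \<subseteq> topspace KS_product"
  unfolding topspace_KS_product KS_closure_set_def by blast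

lemma KS_closure_set_mono:
  assumes "\<tau> \<in> KS_closure_set \<theta>" "e \<in> idempotents" "f \<in> idempotents" "e \<preceq> f" "\<tau> e \<noteq> None"
  shows "\<tau> f = \<tau> e"
  using assms unfolding KS_closure_set_def by blast

lemma KS_closure_set_mult:
  assumes "\<tau> \<in> KS_closure_set \<theta>" "e \<in> idempotents" "f \<in> idempotents" "\<tau> e \<noteq> None" "\<tau> f \<noteq> None"
  shows "\<tau> (e * f) \<noteq> None"
  using assms unfolding KS_closure_set_def by blast

lemma KS_closure_set_value:
  assumes "\<tau> \<in> KS_closure_set \<theta>" "e \<in> idempotents" "\<tau> e = Some x"
  shows "x \<in> act_dom \<theta> e"
proof -
  have "\<tau> e \<in> insert None (Some ` act_dom \<theta> e)"
    using assms(1,2) unfolding KS_closure_set_def by (blast dest: PiE_mem)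
  then show ?thesis using assms(3) by auto
qed

lemma openin_coordinate:
  assumes "e \<in> idempotents" "openin X U" "U \<subseteq> act_dom \<theta> e"
  shows "openin KS_product {\<tau> \<in> topspace KS_product. \<tau> e \<in> Some ` U}"
proof (rule openin_continuous_map_preimage)
  show "continuous_map KS_product (Alexandroff_compactification (subtopology X (act_dom \<theta> e))) (\<lambda>\<tau>. \<tau> e)"
    using assms(1) by (rule continuous_map_product_projection)
  show "openin (Alexandroff_compactification (subtopology X (act_dom \<theta> e))) (Some ` U)"
    using assms by (simp add: openin_open_subtopology act_dom_open)
qed

lemma closedin_coordinate:
  assumes e: "e \<in> idempotents" and K: "compactin X K" "K \<subseteq> act_dom \<theta> e"
  shows "closedin KS_product {\<tau> \<in> topspace KS_product. \<tau> e \<in> Some ` K}"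
proof (rule closedin_continuous_map_preimage)
  show "continuous_map KS_product (Alexandroff_compactification (subtopology X (act_dom \<theta> e))) (\<lambda>\<tau>. \<tau> e)"
    using e by (rule continuous_map_product_projection)
  have "compactin (subtopology X (act_dom \<theta> e)) K" using K by (simp add: compactin_subtopology)
  then show "closedin (Alexandroff_compactification (subtopology X (act_dom \<theta> e))) (Some ` K)"
    using compactin_imp_closedin Hausdorff_space_subtopology[OF Hausdorff] by simp blast
qed

lemma compact_neighbourhood:
  assumes "e \<in> idempotents" "x \<in> act_dom \<theta> e"
  obtains U K where "openin X U" "compactin X K" "x \<in> U" "U \<subseteq> K" "K \<subseteq> act_dom \<theta> e"
proof -
  have "neighbourhood_base_of (compactin X) X"
    using locally_compact_space_neighbourhood_base locally_compact Hausdorff by blast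
  then show ?thesis
    using act_dom_open[OF assms(1)] assms(2) that unfolding neighbourhood_base_of by meson
qed

text \<open>The second condition alone does not define a closed set: it asks for a finite value, and
  finiteness is an open condition. In the presence of the first one, finite values at \<open>e\<close>, \<open>f\<close> and
  \<open>ef\<close> agree, and a family violating either condition is separated from all families satisfying both
  by its values at \<open>e\<close>, \<open>f\<close> and \<open>ef\<close>.\<close>

lemma closedin_KS_closure_set: "closedin KS_product (KS_closure_set \<theta>)"
proof -
  let ?T = "topspace KS_product"
  have val: "\<tau> e = None \<or> (\<exists>x \<in> act_dom \<theta> e. \<tau> e = Some x)"
    if "\<tau> \<in> ?T" "e \<in> idempotents" for \<tau> e
    using PiE_mem[OF that[unfolded topspace_KS_product]] by auto
  have "\<exists>W. openin KS_product W \<and> \<tau> \<in> W \<and> W \<inter> KS_closure_set \<theta> = {}"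
    if \<tau>: "\<tau> \<in> ?T" "\<tau> \<notin> KS_closure_set \<theta>" for \<tau>
  proof -
    have avoid: "\<exists>W. openin KS_product W \<and> \<tau> \<in> W \<and> W \<inter> KS_closure_set \<theta> = {}"
      if "\<exists>W. openin KS_product W \<and> \<tau> \<in> W \<and> (\<forall>\<sigma>\<in>W. Q \<sigma>)"
        and Q: "\<And>\<sigma>. \<sigma> \<in> KS_closure_set \<theta> \<Longrightarrow> Q \<sigma> \<Longrightarrow> False" for Q
      using that(1)
    proof (elim exE conjE)
      fix W assume W: "openin KS_product W" "\<tau> \<in> W" "\<forall>\<sigma>\<in>W. Q \<sigma>"
      then have "W \<inter> KS_closure_set \<theta> = {}" using Q by auto
      with W(1,2) show ?thesis by (intro exI[of _ W] conjI)
    qed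
    have sep: "\<exists>W. openin KS_product W \<and> \<tau> \<in> W \<and>
        (\<forall>\<sigma>\<in>W. \<exists>y z. \<sigma> e = Some y \<and> \<sigma> f = Some z \<and> y \<noteq> z)"
      if e: "e \<in> idempotents" "\<tau> e = Some x" and f: "f \<in> idempotents" "\<tau> f = Some x'" and ne: "x \<noteq> x'"
      for e f x x'
    proof -
      have x: "x \<in> act_dom \<theta> e" "x' \<in> act_dom \<theta> f" using val[OF \<tau>(1)] e f by fastforce+
      then have "x \<in> topspace X" "x' \<in> topspace X" using act_dom_subset_topspace e f by auto
      then obtain U V where UV: "openin X U" "openin X V" "x \<in> U" "x' \<in> V" "disjnt U V"
        using Hausdorff ne unfolding Hausdorff_space_def by meson
      let ?W = "{\<sigma> \<in> ?T. \<sigma> e \<in> Some ` (U \<inter> act_dom \<theta> e)} \<inter> {\<sigma> \<in> ?T. \<sigma> f \<in> Some ` (V \<inter> act_dom \<theta> f)}"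
      have "openin KS_product ?W"
        by (intro openin_Int openin_coordinate act_dom_open e f UV) auto
      moreover have "\<tau> \<in> ?W" using \<tau> x UV e f by auto
      moreover have "\<forall>\<sigma>\<in>?W. \<exists>y z. \<sigma> e = Some y \<and> \<sigma> f = Some z \<and> y \<noteq> z"
        using UV(5) by (auto simp: disjnt_iff)
      ultimately show ?thesis by blast
    qed
    have near: "\<exists>W. openin KS_product W \<and> \<tau> \<in> W \<and>
        (\<forall>\<sigma>\<in>W. (\<exists>y\<in>act_dom \<theta> e. \<sigma> e = Some y \<and> \<sigma> f \<noteq> Some y))"
      if e: "e \<in> idempotents" "\<tau> e = Some x" and f: "f \<in> idempotents" "\<tau> f = None" and xf: "x \<in> act_dom \<theta> f"
      for e f x
    proof -
      have x: "x \<in> act_dom \<theta> e" using val[OF \<tau>(1)] e by fastforce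
      obtain U K where UK: "openin X U" "compactin X K" "x \<in> U" "U \<subseteq> K" "K \<subseteq> act_dom \<theta> f"
        using compact_neighbourhood[OF f(1) xf] by blast
      let ?W = "{\<sigma> \<in> ?T. \<sigma> e \<in> Some ` (U \<inter> act_dom \<theta> e)} - {\<sigma> \<in> ?T. \<sigma> f \<in> Some ` K}"
      have "openin KS_product ?W"
        by (intro openin_diff openin_Int openin_coordinate closedin_coordinate act_dom_open e f UK) auto
      moreover have "\<tau> \<in> ?W" using \<tau> x UK e f by auto
      moreover have "\<forall>\<sigma>\<in>?W. (\<exists>y\<in>act_dom \<theta> e. \<sigma> e = Some y \<and> \<sigma> f \<noteq> Some y)"
        using UK(4) by auto
      ultimately show ?thesis by blast
    qed
    have "(\<exists>e\<in>idempotents. \<exists>f\<in>idempotents. e \<preceq> f \<and> \<tau> e \<noteq> None \<and> \<tau> f \<noteq> \<tau> e) \<or>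
        (\<exists>e\<in>idempotents. \<exists>f\<in>idempotents. \<tau> e \<noteq> None \<and> \<tau> f \<noteq> None \<and> \<tau> (e * f) = None)"
      (is "?A \<or> ?B")
    proof (rule ccontr)
      assume no: "\<not> (?A \<or> ?B)"
      have "\<tau> \<in> KS_closure_set \<theta>"
        unfolding KS_closure_set_def
      proof (intro CollectI conjI ballI impI)
        show "\<tau> \<in> (\<Pi>\<^sub>E e\<in>idempotents. insert None (Some ` act_dom \<theta> e))"
          using \<tau>(1) topspace_KS_product by simp
        show "\<tau> f = \<tau> e" if "e \<in> idempotents" "f \<in> idempotents" "e \<preceq> f \<and> \<tau> e \<noteq> None" for e f
        proof (rule ccontr)
          assume ne: "\<tau> f \<noteq> \<tau> e"
          have ?A by (rule bexI[OF bexI[OF _ that(2)] that(1)]) (simp add: that(3) ne)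
          then show False using no by simp
        qed
        show "\<tau> (e * f) \<noteq> None"
          if "e \<in> idempotents" "f \<in> idempotents" "\<tau> e \<noteq> None \<and> \<tau> f \<noteq> None" for e f
        proof
          assume none: "\<tau> (e * f) = None"
          have ?B by (rule bexI[OF bexI[OF _ that(2)] that(1)]) (simp add: that(3) none)
          then show False using no by simp
        qed
      qed
      then show False using \<tau>(2) by simp
    qed
    then show ?thesis
    proof (elim disjE bexE conjE, goal_cases)
      case mono: (1 e f)
      from val[OF \<tau>(1) mono(1)] mono(4) obtain x where x: "\<tau> e = Some x" "x \<in> act_dom \<theta> e" by auto
      have no: "\<sigma> \<notin> KS_closure_set \<theta>" if "\<sigma> e = Some y" "\<sigma> f \<noteq> Some y" for \<sigma> y
        using KS_closure_set_mono[OF _ mono(1-3), of \<sigma>] that by auto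
      show ?thesis
      proof (cases "\<tau> f")
        case None
        have xf: "x \<in> act_dom \<theta> f" using act_dom_mono[OF mono(1-3)] x by blast
        show ?thesis
          by (rule avoid[OF near[OF mono(1) x(1) mono(2) None xf]]) (use no in auto)
      next
        case (Some x')
        with mono x have ne: "x \<noteq> x'" by auto
        show ?thesis
          by (rule avoid[OF sep[OF mono(1) x(1) mono(2) Some ne]]) (use no in auto)
      qed
    next
      case mult: (2 e f)
      have ef: "e * f \<in> idempotents" using mult by (simp add: idempotent_mult_closed)
      have le: "e * f \<preceq> e" "e * f \<preceq> f"
        using mult ef by (simp_all add: natural_le_idempotent idempotents_iff mult.assoc[symmetric])
           (metis idempotent_commute idempotents_iff mult.assoc)
      have agree: "\<sigma> e = \<sigma> (e * f) \<and> \<sigma> f = \<sigma> (e * f) \<and> \<sigma> (e * f) \<noteq> None"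
        if "\<sigma> \<in> KS_closure_set \<theta>" "\<sigma> e \<noteq> None" "\<sigma> f \<noteq> None" for \<sigma>
      proof -
        have ne: "\<sigma> (e * f) \<noteq> None"
          by (rule KS_closure_set_mult[OF that(1) mult(1,2) that(2,3)])
        show ?thesis
          by (intro conjI ne KS_closure_set_mono[OF that(1) ef mult(1) le(1) ne, symmetric]
              KS_closure_set_mono[OF that(1) ef mult(2) le(2) ne, symmetric]
              KS_closure_set_mono[OF that(1) ef mult(1) le(1) ne]
              KS_closure_set_mono[OF that(1) ef mult(2) le(2) ne])
      qed
      from val[OF \<tau>(1) mult(1)] mult(3) obtain x where x: "\<tau> e = Some x" "x \<in> act_dom \<theta> e" by auto
      from val[OF \<tau>(1) mult(2)] mult(4) obtain x' where x': "\<tau> f = Some x'" "x' \<in> act_dom \<theta> f" by auto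
      show ?thesis
      proof (cases "x = x'")
        case True
        then have "x \<in> act_dom \<theta> (e * f)" using x x' act_dom_mult mult by auto
        from near[OF mult(1) x(1) ef mult(5) this] obtain W where W: "openin KS_product W" "\<tau> \<in> W"
            "\<forall>\<sigma>\<in>W. \<exists>y\<in>act_dom \<theta> e. \<sigma> e = Some y \<and> \<sigma> (e * f) \<noteq> Some y"
          by (elim exE conjE) (rule that; assumption)
        let ?W = "W \<inter> {\<sigma> \<in> ?T. \<sigma> f \<in> Some ` act_dom \<theta> f}"
        have "openin KS_product ?W"
          by (intro openin_Int W openin_coordinate act_dom_open mult) auto
        moreover have "\<tau> \<in> ?W" using W \<tau> x' by auto
        moreover have "?W \<inter> KS_closure_set \<theta> = {}"
        proof (intro equals0I, elim IntE CollectE conjE)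
          fix \<sigma> assume \<sigma>: "\<sigma> \<in> KS_closure_set \<theta>" "\<sigma> \<in> W" "\<sigma> f \<in> Some ` act_dom \<theta> f"
          from bspec[OF W(3) \<sigma>(2)] show False using agree[OF \<sigma>(1)] \<sigma>(3) by auto
        qed
        ultimately show ?thesis by (intro exI[of _ ?W] conjI)
      next
        case False
        show ?thesis
        proof (rule avoid[OF sep[OF mult(1) x(1) mult(2) x'(1) False]], elim exE conjE)
          fix \<sigma> y z assume "\<sigma> \<in> KS_closure_set \<theta>" "\<sigma> e = Some y" "\<sigma> f = Some z" "y \<noteq> z"
          then show False using agree[of \<sigma>] by auto
        qed
      qed
    qed
  qed
  then have "openin KS_product (?T - KS_closure_set \<theta>)"
    by (subst openin_subopen) (use openin_subset in fast)
  then show ?thesis using KS_closure_set_subset by (simp add: closedin_def)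
qed

lemma topspace_KS_space: "topspace (KS_space X \<theta>) = KS_closure_set \<theta> - {\<lambda>e\<in>idempotents. None}"
  using KS_closure_set_subset unfolding KS_space_def by auto

lemma KS_space_finite_value:
  assumes \<tau>: "\<tau> \<in> topspace (KS_space X \<theta>)"
  obtains e x where "e \<in> idempotents" "\<tau> e = Some x" "x \<in> act_dom \<theta> e"
proof -
  have "\<exists>e\<in>idempotents. \<tau> e \<noteq> None"
  proof (rule ccontr)
    assume "\<not> ?thesis"
    then have "\<tau> = (\<lambda>e\<in>idempotents. None)"
      using \<tau> by (fastforce simp: topspace_KS_space KS_closure_set_def PiE_def extensional_def)
    then show False using \<tau> by (simp add: topspace_KS_space)
  qed
  then obtain e x where e: "e \<in> idempotents" "\<tau> e = Some x" by auto
  moreover have "x \<in> act_dom \<theta> e"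
    using \<tau> e KS_closure_set_value by (auto simp: topspace_KS_space)
  ultimately show ?thesis by (rule that)
qed

lemma compactin_KS_space:
  assumes e: "e \<in> idempotents" and K: "compactin X K" "K \<subseteq> act_dom \<theta> e"
  shows "compactin (KS_space X \<theta>) {\<tau> \<in> KS_closure_set \<theta>. \<tau> e \<in> Some ` K}"
proof -
  have "compact_space KS_product"
    by (simp add: compact_space_product_topology)
  moreover have "closedin KS_product (KS_closure_set \<theta> \<inter> {\<tau> \<in> topspace KS_product. \<tau> e \<in> Some ` K})"
    by (intro closedin_Int closedin_KS_closure_set closedin_coordinate e K)
  ultimately have "compactin KS_product (KS_closure_set \<theta> \<inter> {\<tau> \<in> topspace KS_product. \<tau> e \<in> Some ` K})"
    by (rule closedin_compact_space)
  also have "KS_closure_set \<theta> \<inter> {\<tau> \<in> topspace KS_product. \<tau> e \<in> Some ` K} =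
      {\<tau> \<in> KS_closure_set \<theta>. \<tau> e \<in> Some ` K}"
    using KS_closure_set_subset by auto
  finally show ?thesis
    using e by (auto simp: KS_space_def compactin_subtopology)
qed

definition principal_family :: "'s \<Rightarrow> 'x \<Rightarrow> 's \<Rightarrow> 'x option"
  where "principal_family e x = (\<lambda>g\<in>idempotents. if e \<preceq> g then Some x else None)"

lemma principal_family_mem:
  assumes e: "e \<in> idempotents" and x: "x \<in> act_dom \<theta> e"
  shows "principal_family e x \<in> topspace (KS_space X \<theta>)"
proof -
  have trans: "e \<preceq> g2" if "g1 \<in> idempotents" "g2 \<in> idempotents" "g1 \<preceq> g2" "e \<preceq> g1" for g1 g2
    using that e by (simp add: natural_le_idempotent) (metis mult.assoc)
  have meet: "e \<preceq> g1 * g2" if "g1 \<in> idempotents" "g2 \<in> idempotents" "e \<preceq> g1" "e \<preceq> g2" for g1 g2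
    using that e by (simp add: natural_le_idempotent mult.assoc)
  have "principal_family e x \<in> KS_closure_set \<theta>"
    unfolding KS_closure_set_def
  proof (intro CollectI conjI ballI impI)
    show "principal_family e x \<in> (\<Pi>\<^sub>E e\<in>idempotents. insert None (Some ` act_dom \<theta> e))"
    proof -
      have "x \<in> act_dom \<theta> g" if "g \<in> idempotents" "e \<preceq> g" for g
        using act_dom_mono[OF e that] x by blast
      then show ?thesis by (simp add: principal_family_def PiE_iff)
    qed
    show "principal_family e x g2 = principal_family e x g1"
      if "g1 \<in> idempotents" "g2 \<in> idempotents" "g1 \<preceq> g2 \<and> principal_family e x g1 \<noteq> None" for g1 g2
      using that trans[of g1 g2] by (simp add: principal_family_def split: if_splits)
    show "principal_family e x (g1 * g2) \<noteq> None"
      if "g1 \<in> idempotents" "g2 \<in> idempotents"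
        "principal_family e x g1 \<noteq> None \<and> principal_family e x g2 \<noteq> None" for g1 g2
      using that meet[of g1 g2]
      by (simp add: principal_family_def idempotent_mult_closed split: if_splits)
  qed
  moreover have "principal_family e x e \<noteq> (\<lambda>e\<in>idempotents. None) e"
    using e by (simp add: principal_family_def natural_le_idempotent idempotents_iff)
  ultimately show ?thesis by (auto simp: topspace_KS_space)
qed

text \<open>The sets \<open>{\<tau>. \<tau> f \<in> K}\<close> carry the correspondence: they are compact, and a cover by pairs
  \<open>(f, K)\<close> of the kind in question amounts to a cover of the space by them.\<close>

lemma compact_family_cover_imp_compact_cover:
  assumes P: "compact_family_cover X \<theta> P"
  defines "C \<equiv> \<lambda>(f, K). {\<tau> \<in> KS_closure_set \<theta>. \<tau> f \<in> Some ` K}"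
  shows "\<forall>Q\<in>C ` P. compactin (KS_space X \<theta>) Q" "\<Union>(C ` P) = topspace (KS_space X \<theta>)"
proof -
  show comp: "\<forall>Q\<in>C ` P. compactin (KS_space X \<theta>) Q"
    using P by (auto simp: C_def compact_family_cover_def intro!: compactin_KS_space)
  show "\<Union>(C ` P) = topspace (KS_space X \<theta>)"
  proof
    show "\<Union>(C ` P) \<subseteq> topspace (KS_space X \<theta>)"
      using comp compactin_subset_topspace by blast
    show "topspace (KS_space X \<theta>) \<subseteq> \<Union>(C ` P)"
    proof
      fix \<tau> assume \<tau>: "\<tau> \<in> topspace (KS_space X \<theta>)"
      then obtain e x where e: "e \<in> idempotents" "\<tau> e = Some x" and x: "x \<in> act_dom \<theta> e"
        by (rule KS_space_finite_value)
      from P e x obtain f K where fK: "(f, K) \<in> P" "e \<preceq> f" "x \<in> K" "f \<in> idempotents"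
        unfolding compact_family_cover_def by blast
      then have "\<tau> f = \<tau> e" using \<tau> e by (intro KS_closure_set_mono) (auto simp: topspace_KS_space)
      then have "\<tau> \<in> C (f, K)" using \<tau> e fK by (auto simp: C_def topspace_KS_space)
      then show "\<tau> \<in> \<Union>(C ` P)" using fK by blast
    qed
  qed
qed

text \<open>The sets \<open>{\<tau>. \<tau> f \<in> U}\<close> with \<open>U\<close> open and relatively compact in \<open>X\<^sub>f\<close> cover the space.\<close>

lemma compactin_KS_space_imp_finite_pairs:
  assumes Q: "compactin (KS_space X \<theta>) Q"
  obtains P where "finite P" "\<forall>(f, K)\<in>P. f \<in> idempotents \<and> K \<subseteq> act_dom \<theta> f \<and> compactin X K"
    "\<forall>\<tau>\<in>Q. \<exists>(f, K)\<in>P. \<tau> f \<in> Some ` K"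
proof -
  define I where "I = {(f, U, K). f \<in> idempotents \<and> openin X U \<and> U \<subseteq> K \<and> K \<subseteq> act_dom \<theta> f \<and> compactin X K}"
  define B where "B = (\<lambda>(f, U::'x set, K::'x set). {\<tau> \<in> topspace (KS_space X \<theta>). \<tau> f \<in> Some ` U})"
  have "openin (KS_space X \<theta>) (B i)" if "i \<in> I" for i
  proof -
    obtain f U K where i: "i = (f, U, K)" by (cases i)
    have "openin KS_product {\<tau> \<in> topspace KS_product. \<tau> f \<in> Some ` U}"
      by (rule openin_coordinate) (use that i in \<open>auto simp: I_def\<close>)
    then have "openin (KS_space X \<theta>) ({\<tau> \<in> topspace KS_product. \<tau> f \<in> Some ` U} \<inter>
        (KS_closure_set \<theta> - {\<lambda>e\<in>idempotents. None}))"
      unfolding KS_space_def by (auto simp: openin_subtopology)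
    also have "{\<tau> \<in> topspace KS_product. \<tau> f \<in> Some ` U} \<inter>
        (KS_closure_set \<theta> - {\<lambda>e\<in>idempotents. None}) = B i"
      using KS_closure_set_subset unfolding B_def i topspace_KS_space by auto
    finally show ?thesis .
  qed
  moreover have "Q \<subseteq> \<Union>(B ` I)"
  proof
    fix \<tau> assume "\<tau> \<in> Q"
    then have \<tau>: "\<tau> \<in> topspace (KS_space X \<theta>)" using Q compactin_subset_topspace by blast
    then obtain e x where e: "e \<in> idempotents" "\<tau> e = Some x" and x: "x \<in> act_dom \<theta> e"
      by (rule KS_space_finite_value)
    obtain U K where "openin X U" "compactin X K" "x \<in> U" "U \<subseteq> K" "K \<subseteq> act_dom \<theta> e"
      using compact_neighbourhood[OF e(1) x] by blast
    then show "\<tau> \<in> \<Union>(B ` I)" using e \<tau> by (auto simp: B_def I_def intro!: bexI[of _ "(e, U, K)"])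
  qed
  ultimately obtain \<F> where "finite \<F>" "\<F> \<subseteq> B ` I" "Q \<subseteq> \<Union>\<F>"
    using compactinD[OF Q, of "B ` I"] by (metis imageE)
  then obtain J where J: "finite J" "J \<subseteq> I" "Q \<subseteq> \<Union>(B ` J)" by (metis finite_subset_image)
  show ?thesis
  proof (rule that[of "(\<lambda>(f, U, K). (f, K)) ` J"])
    show "finite ((\<lambda>(f, U, K). (f, K)) ` J)" using J by simp
    show "\<forall>(f, K)\<in>(\<lambda>(f, U, K). (f, K)) ` J. f \<in> idempotents \<and> K \<subseteq> act_dom \<theta> f \<and> compactin X K"
      using J by (auto simp: I_def)
    show "\<forall>\<tau>\<in>Q. \<exists>(f, K)\<in>(\<lambda>(f, U, K). (f, K)) ` J. \<tau> f \<in> Some ` K"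
    proof
      fix \<tau> assume "\<tau> \<in> Q"
      then obtain f U K where i: "(f, U, K) \<in> J" "\<tau> \<in> B (f, U, K)" using J(3) by auto
      then have "(f, K) \<in> (\<lambda>(f, U, K). (f, K)) ` J" by force
      moreover have "\<tau> f \<in> Some ` K" using i J(2) by (auto simp: B_def I_def)
      ultimately show "\<exists>(f, K)\<in>(\<lambda>(f, U, K). (f, K)) ` J. \<tau> f \<in> Some ` K" by blast
    qed
  qed
qed

text \<open>A point \<open>x\<close> of \<open>X\<^sub>e\<close> is seen through its principal family, whose only finite value is \<open>x\<close>, taken
  above \<open>e\<close>.\<close>

lemma compact_family_coverI:
  assumes "\<forall>(f, K)\<in>P. f \<in> idempotents \<and> K \<subseteq> act_dom \<theta> f \<and> compactin X K"
    and "\<forall>\<tau>\<in>topspace (KS_space X \<theta>). \<exists>(f, K)\<in>P. \<tau> f \<in> Some ` K"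
  shows "compact_family_cover X \<theta> P"
  unfolding compact_family_cover_def
proof (intro conjI ballI subsetI)
  fix e x assume "e \<in> idempotents" "x \<in> act_dom \<theta> e"
  then obtain f K where "(f, K) \<in> P" "principal_family e x f \<in> Some ` K"
    using assms(2) principal_family_mem by blast
  then show "x \<in> \<Union>{K. \<exists>f. (f, K) \<in> P \<and> e \<preceq> f}"
    using assms(1) by (auto simp: principal_family_def split: if_splits)
qed (use assms in blast)

proposition finite_cover_iff_compact_KS_space:
  "(\<exists>P. finite P \<and> compact_family_cover X \<theta> P) \<longleftrightarrow> compact_space (KS_space X \<theta>)"
proof
  assume "\<exists>P. finite P \<and> compact_family_cover X \<theta> P"
  then obtain P where P: "finite P" "compact_family_cover X \<theta> P" by blast
  note * = compact_family_cover_imp_compact_cover[OF P(2)]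
  show "compact_space (KS_space X \<theta>)"
    unfolding compact_space_def *(2)[symmetric]
    by (rule compactin_Union) (use P *(1) in auto)
next
  assume "compact_space (KS_space X \<theta>)"
  then show "\<exists>P. finite P \<and> compact_family_cover X \<theta> P"
    unfolding compact_space_def by (meson compactin_KS_space_imp_finite_pairs compact_family_coverI)
qed

proposition countable_cover_iff_sigma_compact_KS_space:
  "(\<exists>P. countable P \<and> compact_family_cover X \<theta> P) \<longleftrightarrow> sigma_compact_space (KS_space X \<theta>)"
proof
  assume "\<exists>P. countable P \<and> compact_family_cover X \<theta> P"
  then obtain P where P: "countable P" "compact_family_cover X \<theta> P" by blast
  show "sigma_compact_space (KS_space X \<theta>)"
    unfolding sigma_compact_space_def
    by (rule exI, intro conjI, rule countable_image[OF P(1)])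
      (rule compact_family_cover_imp_compact_cover[OF P(2)])+
next
  assume "sigma_compact_space (KS_space X \<theta>)"
  then obtain \<K> where \<K>: "countable \<K>" "\<forall>Q\<in>\<K>. compactin (KS_space X \<theta>) Q" "\<Union>\<K> = topspace (KS_space X \<theta>)"
    unfolding sigma_compact_space_def by (elim exE conjE) (rule that; assumption)
  have "\<forall>Q\<in>\<K>. \<exists>P. finite P \<and> (\<forall>(f, K)\<in>P. f \<in> idempotents \<and> K \<subseteq> act_dom \<theta> f \<and> compactin X K) \<and>
      (\<forall>\<tau>\<in>Q. \<exists>(f, K)\<in>P. \<tau> f \<in> Some ` K)"
  proof
    fix Q assume "Q \<in> \<K>"
    with \<K>(2) have "compactin (KS_space X \<theta>) Q" by simp
    show "\<exists>P. finite P \<and> (\<forall>(f, K)\<in>P. f \<in> idempotents \<and> K \<subseteq> act_dom \<theta> f \<and> compactin X K) \<and>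
        (\<forall>\<tau>\<in>Q. \<exists>(f, K)\<in>P. \<tau> f \<in> Some ` K)"
      by (rule compactin_KS_space_imp_finite_pairs[OF \<open>compactin (KS_space X \<theta>) Q\<close>]) (intro exI conjI)
  qed
  from bchoice[OF this] obtain P where
    P: "\<forall>Q\<in>\<K>. finite (P Q) \<and>
        (\<forall>(f, K)\<in>P Q. f \<in> idempotents \<and> K \<subseteq> act_dom \<theta> f \<and> compactin X K) \<and>
        (\<forall>\<tau>\<in>Q. \<exists>(f, K)\<in>P Q. \<tau> f \<in> Some ` K)"
    by (rule exE)
  have "countable (\<Union>(P ` \<K>))" using \<K>(1) P by (simp add: countable_finite)
  moreover have "compact_family_cover X \<theta> (\<Union>(P ` \<K>))"
  proof (rule compact_family_coverI)
    show "\<forall>(f, K)\<in>\<Union>(P ` \<K>). f \<in> idempotents \<and> K \<subseteq> act_dom \<theta> f \<and> compactin X K"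
      using P by blast
    show "\<forall>\<tau>\<in>topspace (KS_space X \<theta>). \<exists>(f, K)\<in>\<Union>(P ` \<K>). \<tau> f \<in> Some ` K"
      unfolding \<K>(3)[symmetric] using P by blast
  qed
  ultimately show "\<exists>P. countable P \<and> compact_family_cover X \<theta> P" by blast
qed

end

section \<open>Star-algebras with a C*-seminorm\<close>

text \<open>The operations of the record are named so that they can be written infix. Elements live in an
  ambient additive group, which makes the simplification of sums available without side
  conditions; the laws of the product and of the involution are restricted to the carrier \<open>A\<close>.\<close>

locale star_algebra_laws =
  fixes R :: "('a::ab_group_add) star_algebra"
    and A :: "'a set" and sc :: "complex \<Rightarrow> 'a \<Rightarrow> 'a"
    and mult :: "'a \<Rightarrow> 'a \<Rightarrow> 'a" (infixl \<open>\<otimes>\<close> 70) and star :: "'a \<Rightarrow> 'a"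
  assumes carrier: "alg_carrier R = A" and scale: "alg_scale R = sc"
    and mult: "alg_mult R = mult" and star: "alg_star R = star" and add: "alg_add R = (+)"
    and zero_closed [simp]: "0 \<in> A"
    and add_closed [simp]: "x \<in> A \<Longrightarrow> y \<in> A \<Longrightarrow> x + y \<in> A"
    and scale_closed [simp]: "x \<in> A \<Longrightarrow> sc c x \<in> A"
    and mult_closed [simp]: "x \<in> A \<Longrightarrow> y \<in> A \<Longrightarrow> x \<otimes> y \<in> A"
    and star_closed [simp]: "x \<in> A \<Longrightarrow> star x \<in> A"
    and scale_add_right: "sc c (x + y) = sc c x + sc c y"
    and scale_add_left: "sc (c + d) x = sc c x + sc d x"
    and scale_scale [simp]: "sc c (sc d x) = sc (c * d) x"
    and scale_one [simp]: "sc 1 x = x"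
    and mult_add_left: "x \<in> A \<Longrightarrow> y \<in> A \<Longrightarrow> z \<in> A \<Longrightarrow> (x + y) \<otimes> z = x \<otimes> z + y \<otimes> z"
    and mult_add_right: "x \<in> A \<Longrightarrow> y \<in> A \<Longrightarrow> z \<in> A \<Longrightarrow> x \<otimes> (y + z) = x \<otimes> y + x \<otimes> z"
    and mult_scale_left: "x \<in> A \<Longrightarrow> y \<in> A \<Longrightarrow> sc c x \<otimes> y = sc c (x \<otimes> y)"
    and mult_scale_right: "x \<in> A \<Longrightarrow> y \<in> A \<Longrightarrow> x \<otimes> sc c y = sc c (x \<otimes> y)"
    and mult_assoc: "x \<in> A \<Longrightarrow> y \<in> A \<Longrightarrow> z \<in> A \<Longrightarrow> x \<otimes> y \<otimes> z = x \<otimes> (y \<otimes> z)"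
    and star_add: "x \<in> A \<Longrightarrow> y \<in> A \<Longrightarrow> star (x + y) = star x + star y"
    and star_scale: "x \<in> A \<Longrightarrow> star (sc c x) = sc (cnj c) (star x)"
    and star_star [simp]: "x \<in> A \<Longrightarrow> star (star x) = x"
    and star_mult: "x \<in> A \<Longrightarrow> y \<in> A \<Longrightarrow> star (x \<otimes> y) = star y \<otimes> star x"
begin

lemma scale_zero [simp]: "sc 0 x = 0"
  using scale_add_left[of 0 0 x] by simp

lemma scale_minus_one: "sc (-1) x = - x"
proof -
  have "sc (1 + (-1)) x = x + sc (-1) x" unfolding scale_add_left by simp
  then show ?thesis by (simp add: eq_neg_iff_add_eq_0 add.commute)
qed

lemma alg_diff_eq: "alg_diff R x y = x - y"
  by (simp add: alg_diff_def add scale scale_minus_one)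

lemma minus_closed [simp]: "x \<in> A \<Longrightarrow> - x \<in> A"
  using scale_closed[of x "-1"] by (simp add: scale_minus_one)

lemma diff_closed [simp]: "x \<in> A \<Longrightarrow> y \<in> A \<Longrightarrow> x - y \<in> A"
  using add_closed[of x "- y"] by simp

lemma scale_minus: "sc c (- x) = - sc c x"
  by (simp flip: scale_minus_one)

lemma scale_diff_right: "sc c (x - y) = sc c x - sc c y"
  using scale_add_right[of c x "- y"] by (simp add: scale_minus)

lemma mult_minus_left: "x \<in> A \<Longrightarrow> y \<in> A \<Longrightarrow> (- x) \<otimes> y = - (x \<otimes> y)"
  using mult_scale_left[of x y "-1"] by (simp add: scale_minus_one)

lemma mult_minus_right: "x \<in> A \<Longrightarrow> y \<in> A \<Longrightarrow> x \<otimes> (- y) = - (x \<otimes> y)"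
  using mult_scale_right[of x y "-1"] by (simp add: scale_minus_one)

lemma mult_diff_left: "x \<in> A \<Longrightarrow> y \<in> A \<Longrightarrow> z \<in> A \<Longrightarrow> (x - y) \<otimes> z = x \<otimes> z - y \<otimes> z"
  using mult_add_left[of x "- y" z] by (simp add: mult_minus_left)

lemma mult_diff_right: "x \<in> A \<Longrightarrow> y \<in> A \<Longrightarrow> z \<in> A \<Longrightarrow> x \<otimes> (y - z) = x \<otimes> y - x \<otimes> z"
  using mult_add_right[of x y "- z"] by (simp add: mult_minus_right)

lemma mult_zero_left: "x \<in> A \<Longrightarrow> 0 \<otimes> x = 0"
  using mult_scale_left[of 0 x 0] by simp

lemma mult_zero_right: "x \<in> A \<Longrightarrow> x \<otimes> 0 = 0"
  using mult_scale_right[of x 0 0] by simp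

lemma star_minus: "x \<in> A \<Longrightarrow> star (- x) = - star x"
  using star_scale[of x "-1"] by (simp add: scale_minus_one)

lemma star_diff: "x \<in> A \<Longrightarrow> y \<in> A \<Longrightarrow> star (x - y) = star x - star y"
  using star_add[of x "- y"] by (simp add: star_minus)

lemma star_zero: "star 0 = 0"
  using star_scale[of 0 0] by simp

end

locale cstar_seminormed = star_algebra_laws R A sc mult star
  for R :: "('a::ab_group_add) star_algebra" and A sc mult star +
  fixes p :: "'a \<Rightarrow> real"
  assumes cstar: "cstar_seminorm R p"
begin

notation mult (infixl \<open>\<otimes>\<close> 70)

lemma norm_nonneg [simp]: "x \<in> A \<Longrightarrow> 0 \<le> p x"
  and norm_scale: "x \<in> A \<Longrightarrow> p (sc c x) = cmod c * p x"
  and norm_add: "x \<in> A \<Longrightarrow> y \<in> A \<Longrightarrow> p (x + y) \<le> p x + p y"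
  and norm_mult_le: "x \<in> A \<Longrightarrow> y \<in> A \<Longrightarrow> p (x \<otimes> y) \<le> p x * p y"
  and norm_cstar: "x \<in> A \<Longrightarrow> p (star x \<otimes> x) = (p x)\<^sup>2"
  using cstar by (auto simp: cstar_seminorm_def carrier scale add mult star)

lemma norm_zero [simp]: "p 0 = 0"
  using norm_scale[of 0 0] by simp

lemma norm_minus [simp]: "x \<in> A \<Longrightarrow> p (- x) = p x"
  using norm_scale[of x "-1"] by (simp add: scale_minus_one)

lemma norm_minus_commute: "x \<in> A \<Longrightarrow> y \<in> A \<Longrightarrow> p (x - y) = p (y - x)"
  using norm_minus[of "x - y"] by simp

lemma norm_diff: "x \<in> A \<Longrightarrow> y \<in> A \<Longrightarrow> p (x - y) \<le> p x + p y"
  using norm_add[of x "- y"] by simp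

lemma norm_triangle_between: "x \<in> A \<Longrightarrow> y \<in> A \<Longrightarrow> z \<in> A \<Longrightarrow> p (x - z) \<le> p (x - y) + p (y - z)"
  using norm_add[of "x - y" "y - z"] by simp

lemma norm_diff_ineq: "x \<in> A \<Longrightarrow> y \<in> A \<Longrightarrow> \<bar>p x - p y\<bar> \<le> p (x - y)"
  using norm_add[of "x - y" y] norm_add[of "y - x" x] norm_minus_commute[of x y] by simp

lemma norm_star: 
  assumes x: "x \<in> A" shows "p (star x) = p x"
proof -
  have le: "p y \<le> p (star y)" if y: "y \<in> A" for y
  proof (cases "p y = 0")
    case False
    then have "p y > 0" using norm_nonneg[OF y] by linarith
    moreover have "p y * p y \<le> p (star y) * p y"
      using norm_cstar[OF y] norm_mult_le[of "star y" y] y by (simp add: power2_eq_square)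
    ultimately show ?thesis by (rule mult_right_le_imp_le[rotated])
  qed (use y in simp)
  show ?thesis using le[OF x] le[of "star x"] x by simp
qed

text \<open>The norm of \<open>c\<close> as a left multiplier bounds \<open>p c\<close>: apply it to \<open>c\<^sup>*\<close>.\<close>

lemma norm_le_if_contractive:
  assumes c: "c \<in> A" and contr: "\<And>x. x \<in> A \<Longrightarrow> p (c \<otimes> x) \<le> B * p x" and B: "B \<ge> 0"
  shows "p c \<le> B"
proof (cases "p c = 0")
  case False
  then have "p c > 0" using norm_nonneg[OF c] by linarith
  moreover have "p c * p c \<le> B * p c"
    using norm_cstar[of "star c"] contr[of "star c"] norm_star[OF c] c by (simp add: power2_eq_square)
  ultimately show ?thesis by (rule mult_right_le_imp_le[rotated])
qed (use B in simp)

text \<open>The hypothesis says that \<open>1 + v\<close> is an isometry in the unitization, \<open>(1 + v)\<^sup>* (1 + v) = 1\<close>; by the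
  C*-identity it then preserves the seminorm.\<close>

lemma norm_isometry:
  assumes v: "v \<in> A" "v + star v + star v \<otimes> v = 0" and x: "x \<in> A"
  shows "p (x + v \<otimes> x) = p x"
proof -
  let ?y = "x + v \<otimes> x"
  have "star ?y \<otimes> ?y = star x \<otimes> x + star x \<otimes> ((v + star v + star v \<otimes> v) \<otimes> x)"
    using v(1) x by (simp add: star_add star_mult mult_add_left mult_add_right mult_assoc add_ac)
  also have "\<dots> = star x \<otimes> x"
    unfolding v(2) using x by (simp add: mult_zero_left mult_zero_right)
  finally have "(p ?y)\<^sup>2 = (p x)\<^sup>2"
    using norm_cstar[of ?y] norm_cstar[of x] v(1) x by simp
  then show ?thesis using v(1) x by simp
qed

text \<open>The real part of a unitary is an average of two isometries.\<close>

lemma norm_real_part_unitary: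
  assumes v: "v \<in> A" "v + star v + star v \<otimes> v = 0" "v + star v + v \<otimes> star v = 0" and x: "x \<in> A"
    and y: "y = sc (- (1 / 2)) (v + star v)"
  shows "p (x - y \<otimes> x) \<le> p x"
proof -
  have "x - y \<otimes> x = sc (1 / 2) ((x + v \<otimes> x) + (x + star v \<otimes> x))"
  proof -
    have half: "sc (1 / 2) x + sc (1 / 2) x = x"
      using scale_add_left[of "1 / 2" "1 / 2" x] by simp
    have "y \<otimes> x = sc (- (1 / 2)) (v \<otimes> x + star v \<otimes> x)"
      using v(1) x unfolding y by (simp only: mult_scale_left mult_add_left add_closed star_closed)
    also have "\<dots> = - sc (1 / 2) (v \<otimes> x + star v \<otimes> x)"
      using scale_scale[of "-1" "1 / 2"] unfolding scale_minus_one by simp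
    finally have yx: "y \<otimes> x = - sc (1 / 2) (v \<otimes> x + star v \<otimes> x)" .
    have "sc (1 / 2) ((x + v \<otimes> x) + (x + star v \<otimes> x)) =
        (sc (1 / 2) x + sc (1 / 2) x) + sc (1 / 2) (v \<otimes> x + star v \<otimes> x)"
      by (simp only: scale_add_right add_ac)
    then show ?thesis unfolding half yx by simp
  qed
  then have "p (x - y \<otimes> x) \<le> 1 / 2 * (p (x + v \<otimes> x) + p (x + star v \<otimes> x))"
    using v(1) x norm_add[of "x + v \<otimes> x" "x + star v \<otimes> x"] by (simp add: norm_scale)
  also have "\<dots> = p x"
    using norm_isometry[OF v(1,2) x] norm_isometry[of "star v" x] v x by (simp add: add.commute)
  finally show ?thesis .
qed

subsection \<open>Approximate units of norm one\<close>

text \<open>\<open>exp_part z u n\<close> is \<open>1 - (1 + z u)\<^sup>n\<close>, computed inside the algebra.\<close>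

primrec exp_part :: "complex \<Rightarrow> 'a \<Rightarrow> nat \<Rightarrow> 'a" where
  "exp_part z u 0 = 0"
| "exp_part z u (Suc n) = exp_part z u n - sc z u + sc z (u \<otimes> exp_part z u n)"

lemma exp_part_closed [simp]: "u \<in> A \<Longrightarrow> exp_part z u n \<in> A"
  by (induction n) auto

lemma exp_part_commute: "u \<in> A \<Longrightarrow> u \<otimes> exp_part z u n = exp_part z u n \<otimes> u"
proof (induction n)
  case (Suc n)
  then show ?case
    by (simp add: mult_add_left mult_add_right mult_diff_left mult_diff_right mult_scale_left
        mult_scale_right mult_assoc Suc.IH[OF Suc.prems, symmetric])
qed (simp add: mult_zero_left mult_zero_right)

lemma star_exp_part:
  assumes u: "u \<in> A" "star u = u"
  shows "star (exp_part z u n) = exp_part (cnj z) u n"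
proof (induction n)
  case (Suc n)
  then show ?case
    using u exp_part_commute[OF u(1), of "cnj z" n]
    by (simp add: star_add star_diff star_scale star_mult)
qed (simp add: star_zero)

context
  fixes u z q
  assumes u: "u \<in> A" and sa: "star u = u" and contr: "\<And>x. x \<in> A \<Longrightarrow> p (x - u \<otimes> x) \<le> p x"
    and q: "q = 1 + z" "cmod q = 1"
begin

private definition step where "step x = x + sc z (u \<otimes> x)"

private lemma step_closed [simp]: "x \<in> A \<Longrightarrow> step x \<in> A"
  using u by (simp add: step_def)

private lemma step_power_closed [simp]: "x \<in> A \<Longrightarrow> (step ^^ n) x \<in> A"
  by (induction n) auto

private lemma norm_u: "x \<in> A \<Longrightarrow> p (u \<otimes> x) \<le> 2 * p x"
  using contr[of x] norm_diff[of x "x - u \<otimes> x"] u by simp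

private lemma exp_part_eq: "x \<in> A \<Longrightarrow> x - exp_part z u n \<otimes> x = (step ^^ n) x"
proof (induction n)
  case (Suc n)
  have "x - exp_part z u (Suc n) \<otimes> x = step (x - exp_part z u n \<otimes> x)"
    using u Suc.prems
    by (simp add: step_def mult_add_left mult_diff_left mult_diff_right mult_scale_left mult_assoc
        scale_diff_right algebra_simps)
  then show ?case using Suc by simp
qed (simp add: mult_zero_left)

text \<open>As \<open>\<bar>1 + z\<bar> = 1\<close>, the coefficient \<open>z + cnj z = - \<bar>z\<bar>\<^sup>2\<close> of \<open>u\<close> in \<open>(1 + z u)\<^sup>* (1 + z u)\<close> is of second
  order. Hence about \<open>1 / \<bar>z\<bar>\<close> factors \<open>1 + z u\<close> still have a product of norm close to \<open>1\<close>.\<close>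

private lemma norm_step:
  assumes x: "x \<in> A"
  shows "p (step x) \<le> (1 + 3 * (cmod z)\<^sup>2) * p x"
proof -
  have "(cmod q)\<^sup>2 = (1 + Re z)\<^sup>2 + (Im z)\<^sup>2" using q(1) by (simp add: cmod_power2)
  then have "1 = 1 + 2 * Re z + (Re z)\<^sup>2 + (Im z)\<^sup>2" using q(2) by (simp add: power2_eq_square algebra_simps)
  then have rez: "2 * Re z = - ((cmod z)\<^sup>2)" by (simp add: cmod_power2)
  let ?a = "star x \<otimes> x" and ?b = "star x \<otimes> (u \<otimes> x)" and ?c = "star x \<otimes> (u \<otimes> (u \<otimes> x))"
  have "star (step x) \<otimes> step x = ?a + sc z ?b + sc (cnj z) ?b + sc (cnj z * z) ?c"
    using x u sa
    by (simp add: step_def star_add star_scale star_mult mult_add_left mult_add_right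
        mult_scale_left mult_scale_right mult_assoc scale_add_right algebra_simps)
  also have "\<dots> = ?a + sc (z + cnj z) ?b + sc (cnj z * z) ?c"
    by (simp add: scale_add_left algebra_simps)
  finally have "(p (step x))\<^sup>2 = p (?a + sc (z + cnj z) ?b + sc (cnj z * z) ?c)"
    using norm_cstar[of "step x"] x by simp
  also have "\<dots> \<le> p ?a + p (sc (z + cnj z) ?b) + p (sc (cnj z * z) ?c)"
    using norm_add[of ?a "sc (z + cnj z) ?b"] norm_add[of "?a + sc (z + cnj z) ?b" "sc (cnj z * z) ?c"] x u
    by simp
  also have "\<dots> = (p x)\<^sup>2 + (cmod z)\<^sup>2 * p ?b + (cmod z)\<^sup>2 * p ?c"
    using x u rez by (simp add: norm_scale norm_cstar complex_add_cnj norm_mult power2_eq_square)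
  also have "\<dots> \<le> (p x)\<^sup>2 + (cmod z)\<^sup>2 * (2 * (p x)\<^sup>2) + (cmod z)\<^sup>2 * (4 * (p x)\<^sup>2)"
  proof -
    have "p ?b \<le> p x * p (u \<otimes> x)" using norm_mult_le[of "star x" "u \<otimes> x"] x u by (simp add: norm_star)
    also have "\<dots> \<le> p x * (2 * p x)" using norm_u x by (intro mult_left_mono) auto
    finally have b: "p ?b \<le> 2 * (p x)\<^sup>2" by (simp add: power2_eq_square)
    have "p ?c \<le> p x * p (u \<otimes> (u \<otimes> x))"
      using norm_mult_le[of "star x" "u \<otimes> (u \<otimes> x)"] x u by (simp add: norm_star)
    also have "\<dots> \<le> p x * (4 * p x)"
      using norm_u[of "u \<otimes> x"] norm_u[of x] x u by (intro mult_left_mono) auto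
    finally have "p ?c \<le> 4 * (p x)\<^sup>2" by (simp add: power2_eq_square)
    with b show ?thesis by (intro add_mono mult_left_mono) auto
  qed
  also have "\<dots> \<le> ((1 + 3 * (cmod z)\<^sup>2) * p x)\<^sup>2"
  proof -
    have "(1 + 6 * (cmod z)\<^sup>2) \<le> (1 + 3 * (cmod z)\<^sup>2)\<^sup>2" by (simp add: power2_eq_square algebra_simps)
    then have "(1 + 6 * (cmod z)\<^sup>2) * (p x)\<^sup>2 \<le> (1 + 3 * (cmod z)\<^sup>2)\<^sup>2 * (p x)\<^sup>2"
      by (rule mult_right_mono) simp
    then show ?thesis unfolding power_mult_distrib by (simp add: distrib_right)
  qed
  finally show ?thesis by (rule power2_le_imp_le) (use x in simp)
qed

private lemma norm_step_power:
  "x \<in> A \<Longrightarrow> p ((step ^^ n) x) \<le> (1 + 3 * (cmod z)\<^sup>2) ^ n * p x"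
proof (induction n)
  case (Suc n)
  have "p ((step ^^ Suc n) x) \<le> (1 + 3 * (cmod z)\<^sup>2) * p ((step ^^ n) x)"
    using norm_step Suc.prems by simp
  also have "\<dots> \<le> (1 + 3 * (cmod z)\<^sup>2) * ((1 + 3 * (cmod z)\<^sup>2) ^ n * p x)"
    using Suc by (intro mult_left_mono) auto
  finally show ?case by (simp add: mult.assoc)
qed simp

private lemma norm_step_power_diff:
  assumes x: "x \<in> A"
  shows "p ((step ^^ n) x - sc (q ^ n) x)
    \<le> real n * (1 + 3 * (cmod z)\<^sup>2) ^ n * (cmod z * p (u \<otimes> x - x))"
proof (induction n)
  case (Suc n)
  let ?\<rho> = "1 + 3 * (cmod z)\<^sup>2" and ?d = "cmod z * p (u \<otimes> x - x)"
  have \<rho>: "?\<rho> \<ge> 1" by simp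
  have d: "?d \<ge> 0" using x u by simp
  let ?w = "(step ^^ n) x - sc (q ^ n) x"
  have sd: "step (a - b) = step a - step b" if "a \<in> A" "b \<in> A" for a b
    using that u by (simp add: step_def mult_diff_right scale_diff_right algebra_simps)
  have "step (sc (q ^ n) x) - sc (q ^ Suc n) x = sc (z * q ^ n) (u \<otimes> x - x)"
    using x u q(1)
    by (simp add: step_def mult_scale_right scale_diff_right scale_add_left algebra_simps)
  then have eq: "(step ^^ Suc n) x - sc (q ^ Suc n) x = step ?w + sc (z * q ^ n) (u \<otimes> x - x)"
    using sd[of "(step ^^ n) x" "sc (q ^ n) x"] x by (simp add: algebra_simps)
  have "p ((step ^^ Suc n) x - sc (q ^ Suc n) x) \<le> p (step ?w) + p (sc (z * q ^ n) (u \<otimes> x - x))"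
    unfolding eq by (rule norm_add) (use x u in auto)
  also have "p (sc (z * q ^ n) (u \<otimes> x - x)) = ?d"
    using x u q(2) by (simp add: norm_scale norm_mult norm_power)
  also have "p (step ?w) \<le> ?\<rho> * p ?w" by (rule norm_step) (use x in auto)
  also have "?\<rho> * p ?w \<le> ?\<rho> * (real n * ?\<rho> ^ n * ?d)" using Suc by (rule mult_left_mono) simp
  also have "?\<rho> * (real n * ?\<rho> ^ n * ?d) + ?d \<le> real (Suc n) * ?\<rho> ^ Suc n * ?d"
  proof -
    have "1 * ?d \<le> ?\<rho> ^ Suc n * ?d" using \<rho> d by (intro mult_right_mono one_le_power) auto
    then show ?thesis by (simp add: algebra_simps)
  qed
  finally show ?case by simp
qed simp

lemma exp_part_estimates:
  assumes N: "q ^ N = -1" "real N * cmod z \<le> 4" and \<rho>: "\<rho> = (1 + 3 * (cmod z)\<^sup>2) ^ N"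
    and c: "c = sc (complex_of_real (1 / (1 + \<rho>))) (exp_part z u N)" and x: "x \<in> A"
  shows "p (c \<otimes> x) \<le> p x" and "p (c \<otimes> x - x) \<le> 4 * p (u \<otimes> x - x) + (\<rho> - 1) * p x"
proof -
  have \<rho>1: "\<rho> \<ge> 1" unfolding \<rho> by (intro one_le_power) simp
  let ?k = "exp_part z u N"
  have kx: "?k \<otimes> x = x - (step ^^ N) x" using exp_part_eq[OF x, of N] by (simp add: algebra_simps)
  have cx: "c \<otimes> x = sc (complex_of_real (1 / (1 + \<rho>))) (?k \<otimes> x)"
    using c u x by (simp add: mult_scale_left)
  have "p (?k \<otimes> x) \<le> p x + \<rho> * p x"
    unfolding kx using norm_diff[of x "(step ^^ N) x"] norm_step_power[OF x, of N] x \<rho> by simp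
  then show "p (c \<otimes> x) \<le> p x"
    unfolding cx norm_scale[OF mult_closed[OF exp_part_closed[OF u] x]] norm_of_real
    using \<rho>1 by (simp add: field_simps)
  let ?d = "p (u \<otimes> x - x)"
  have d: "?d \<ge> 0" using x u by simp
  have "?k \<otimes> x - sc 2 x = - ((step ^^ N) x - sc (q ^ N) x)"
    unfolding kx N(1) using scale_add_left[of 1 1 x] by (simp add: scale_minus_one)
  then have "p (?k \<otimes> x - sc 2 x) = p ((step ^^ N) x - sc (q ^ N) x)"
    using norm_minus_commute[of "(step ^^ N) x" "sc (q ^ N) x"] x by simp
  also have "\<dots> \<le> real N * \<rho> * (cmod z * ?d)" using norm_step_power_diff[OF x, of N] \<rho> by simp
  also have "\<dots> = (real N * cmod z) * (\<rho> * ?d)" by simp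
  also have "\<dots> \<le> 4 * (\<rho> * ?d)" using N(2) \<rho>1 d by (intro mult_right_mono) auto
  finally have k2: "p (?k \<otimes> x - sc 2 x) \<le> 4 * (\<rho> * ?d)" .
  have "sc (complex_of_real (1 + \<rho>)) (c \<otimes> x - x) = (?k \<otimes> x - sc 2 x) - sc (complex_of_real (\<rho> - 1)) x"
  proof -
    have one: "complex_of_real (1 + \<rho>) * complex_of_real (1 / (1 + \<rho>)) = 1"
      unfolding of_real_mult[symmetric] using \<rho>1 by simp
    have two: "sc (complex_of_real (1 + \<rho>)) x = sc 2 x + sc (complex_of_real (\<rho> - 1)) x"
      unfolding scale_add_left[symmetric] by simp
    show ?thesis unfolding cx scale_diff_right scale_scale one two scale_one by simp
  qed
  then have "p (sc (complex_of_real (1 + \<rho>)) (c \<otimes> x - x)) \<le>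
      p (?k \<otimes> x - sc 2 x) + p (sc (complex_of_real (\<rho> - 1)) x)"
    using norm_diff x u by simp
  then have "(1 + \<rho>) * p (c \<otimes> x - x) \<le> 4 * (\<rho> * ?d) + (\<rho> - 1) * p x"
    using k2 \<rho>1 x u c by (simp only: norm_scale norm_of_real diff_closed mult_closed scale_closed exp_part_closed)
  also have "\<dots> \<le> (1 + \<rho>) * (4 * ?d + (\<rho> - 1) * p x)"
  proof -
    have "1 * ((\<rho> - 1) * p x) \<le> (1 + \<rho>) * ((\<rho> - 1) * p x)"
      using \<rho>1 x by (intro mult_right_mono) auto
    then show ?thesis using d by (simp add: algebra_simps)
  qed
  finally show "p (c \<otimes> x - x) \<le> 4 * ?d + (\<rho> - 1) * p x"
    using \<rho>1 by (simp add: mult_le_cancel_left)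
qed

end

text \<open>If \<open>1 - u\<close> is contractive, the triangle inequality only bounds \<open>u\<close> by \<open>2\<close>, whereas an approximate
  unit has to have norm at most \<open>1\<close>. For \<open>q = exp (i\<pi> / N)\<close> the element \<open>1 - u + q u\<close> is nearly
  contractive, and its \<open>N\<close>-th power acts as \<open>1\<close> where \<open>u\<close> acts as \<open>0\<close> and as \<open>-1\<close> where \<open>u\<close> acts as \<open>1\<close>.
  Half the difference of \<open>1\<close> and this power therefore has norm close to \<open>1\<close>, and it is an approximate
  unit as good as \<open>u\<close> up to a constant factor.\<close>

lemma norm_correction:
  assumes u: "u \<in> A" "star u = u" and contr: "\<And>x. x \<in> A \<Longrightarrow> p (x - u \<otimes> x) \<le> p x" and \<epsilon>: "\<epsilon> > 0"
  obtains c where "c \<in> A" "p c \<le> 1"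
    "\<And>x. x \<in> A \<Longrightarrow> p (c \<otimes> x - x) \<le> 4 * p (u \<otimes> x - x) + \<epsilon> * p x"
    "\<And>x. x \<in> A \<Longrightarrow> p (star c \<otimes> x - x) \<le> 4 * p (u \<otimes> x - x) + \<epsilon> * p x"
proof -
  obtain N where N: "3 * pi\<^sup>2 / ln (1 + \<epsilon>) < real N" using reals_Archimedean2 by blast
  have ln: "ln (1 + \<epsilon>) > 0" using \<epsilon> by simp
  then have "real N > 0" using N by (smt (verit) divide_pos_pos pi_gt_zero zero_less_power)
  then have N0: "N > 0" by simp
  \<comment> \<open>\<open>N\<close> is so large that \<open>(1 + 3 \<bar>z\<bar>\<^sup>2)\<^sup>N\<close>, with \<open>\<bar>z\<bar> \<le> \<pi> / N\<close>, is at most \<open>1 + \<epsilon>\<close>.\<close>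
  define q z where "q = cis (pi / N)" and "z = q - 1"
  have qz: "q = 1 + z" "cmod q = 1" "q ^ N = -1"
    using N0 by (simp_all add: z_def q_def Complex.DeMoivre)
  have "(cmod z)\<^sup>2 = (cos (pi / N) - 1)\<^sup>2 + (sin (pi / N))\<^sup>2"
    by (simp add: z_def q_def cmod_power2)
  also have "\<dots> = 2 - 2 * cos (2 * (pi / (2 * N)))"
    using sin_cos_squared_add[of "pi / N"] by (simp add: power2_eq_square algebra_simps)
  also have "\<dots> = (2 * sin (pi / (2 * N)))\<^sup>2"
    unfolding cos_double_sin by (simp add: power2_eq_square)
  also have "\<dots> \<le> (2 * (pi / (2 * N)))\<^sup>2"
  proof -
    have "(2 * a)\<^sup>2 \<le> (2 * b)\<^sup>2" if "\<bar>a\<bar> \<le> \<bar>b\<bar>" for a b :: real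
      using that by (simp add: power_mult_distrib abs_le_square_iff)
    then show ?thesis using abs_sin_x_le_abs_x[of "pi / (2 * N)"] by blast
  qed
  finally have z2: "(cmod z)\<^sup>2 \<le> (pi / N)\<^sup>2" by simp
  then have "cmod z \<le> pi / N" by (rule power2_le_imp_le) simp
  then have zN: "real N * cmod z \<le> 4" using N0 pi_less_4 by (simp add: field_simps)
  define \<rho> where "\<rho> = (1 + 3 * (cmod z)\<^sup>2) ^ N"
  have "\<rho> \<le> exp (3 * (cmod z)\<^sup>2) ^ N" unfolding \<rho>_def by (intro power_mono exp_ge_add_one_self) auto
  also have "\<dots> = exp (N * (3 * (cmod z)\<^sup>2))" by (simp add: exp_of_nat_mult)
  also have "\<dots> \<le> exp (ln (1 + \<epsilon>))"
  proof -
    have "N * (3 * (cmod z)\<^sup>2) \<le> N * (3 * (pi / N)\<^sup>2)" using z2 by (intro mult_left_mono) auto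
    also have "\<dots> = 3 * pi\<^sup>2 / N" using N0 by (simp add: power2_eq_square)
    also have "\<dots> \<le> ln (1 + \<epsilon>)" using N ln N0 by (simp add: field_simps)
    finally show ?thesis by simp
  qed
  finally have \<rho>\<epsilon>: "\<rho> - 1 \<le> \<epsilon>" using \<epsilon> by simp
  have cnj: "cnj q = 1 + cnj z" "cmod (cnj q) = 1" "cnj q ^ N = -1"
  proof -
    show "cnj q = 1 + cnj z" unfolding qz(1) by simp
    show "cmod (cnj q) = 1" unfolding complex_mod_cnj by (rule qz(2))
    show "cnj q ^ N = -1" unfolding complex_cnj_power[symmetric] qz(3) by simp
  qed
  define c where "c = sc (complex_of_real (1 / (1 + \<rho>))) (exp_part z u N)"
  have sc: "star c = sc (complex_of_real (1 / (1 + \<rho>))) (exp_part (cnj z) u N)"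
    using u by (simp add: c_def star_scale star_exp_part)
  have est: "p (c \<otimes> x) \<le> p x" "p (c \<otimes> x - x) \<le> 4 * p (u \<otimes> x - x) + (\<rho> - 1) * p x" if "x \<in> A" for x
    using exp_part_estimates[OF u _ qz(1,2) qz(3) zN \<rho>_def c_def that] contr by auto
  have est': "p (star c \<otimes> x - x) \<le> 4 * p (u \<otimes> x - x) + (\<rho> - 1) * p x" if "x \<in> A" for x
    by (rule exp_part_estimates(2)[OF u contr cnj _ _ sc that]) (use zN in \<open>auto simp: \<rho>_def\<close>)
  have up: "4 * p (u \<otimes> x - x) + (\<rho> - 1) * p x \<le> 4 * p (u \<otimes> x - x) + \<epsilon> * p x" if "x \<in> A" for x
    using \<rho>\<epsilon> that by (simp add: mult_right_mono)
  have cA: "c \<in> A" using u by (simp add: c_def)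
  show ?thesis
  proof (rule that[OF cA])
    show "p c \<le> 1" using norm_le_if_contractive[OF cA, of 1] est(1) by simp
    show "p (c \<otimes> x - x) \<le> 4 * p (u \<otimes> x - x) + \<epsilon> * p x" if "x \<in> A" for x
      using est(2)[OF that] up[OF that] by linarith
    show "p (star c \<otimes> x - x) \<le> 4 * p (u \<otimes> x - x) + \<epsilon> * p x" if "x \<in> A" for x
      using est'[OF that] up[OF that] by linarith
  qed
qed


lemma contractive_approximate_unit:
  assumes u: "\<And>n::nat. u n \<in> A" "\<And>n. star (u n) = u n"
    and contr: "\<And>n x. x \<in> A \<Longrightarrow> p (x - u n \<otimes> x) \<le> p x"
    and lim: "\<And>x. x \<in> A \<Longrightarrow> (\<lambda>n. p (u n \<otimes> x - x)) \<longlonglongrightarrow> 0"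
  obtains c where "\<And>n. c n \<in> A" "\<And>n. p (c n) \<le> 1"
    "\<And>x. x \<in> A \<Longrightarrow> (\<lambda>n. p (c n \<otimes> x - x)) \<longlonglongrightarrow> 0"
    "\<And>x. x \<in> A \<Longrightarrow> (\<lambda>n. p (star (c n) \<otimes> x - x)) \<longlonglongrightarrow> 0"
proof -
  have "\<exists>c\<in>A. p c \<le> 1 \<and>
      (\<forall>x\<in>A. p (c \<otimes> x - x) \<le> 4 * p (u n \<otimes> x - x) + 1 / real (Suc n) * p x) \<and>
      (\<forall>x\<in>A. p (star c \<otimes> x - x) \<le> 4 * p (u n \<otimes> x - x) + 1 / real (Suc n) * p x)" for n
    by (rule norm_correction[of "u n" "1 / real (Suc n)"]) (use u contr in auto)
  then obtain c where c: "\<And>n. c n \<in> A" "\<And>n. p (c n) \<le> 1"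
      "\<And>n x. x \<in> A \<Longrightarrow> p (c n \<otimes> x - x) \<le> 4 * p (u n \<otimes> x - x) + 1 / real (Suc n) * p x"
      "\<And>n x. x \<in> A \<Longrightarrow> p (star (c n) \<otimes> x - x) \<le> 4 * p (u n \<otimes> x - x) + 1 / real (Suc n) * p x"
    by metis
  have bound: "(\<lambda>n. 4 * p (u n \<otimes> x - x) + 1 / real (Suc n) * p x) \<longlonglongrightarrow> 0" if "x \<in> A" for x
  proof -
    have "(\<lambda>n. 4 * p (u n \<otimes> x - x) + inverse (real (Suc n)) * p x) \<longlonglongrightarrow> 4 * 0 + 0 * p x"
      by (intro tendsto_intros lim[OF that] LIMSEQ_inverse_real_of_nat)
    then show ?thesis by (simp add: divide_inverse)
  qed
  show ?thesis
  proof (rule that[OF c(1,2)])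
    show "(\<lambda>n. p (c n \<otimes> x - x)) \<longlonglongrightarrow> 0" if "x \<in> A" for x
      by (rule tendsto_sandwich[OF _ _ tendsto_const bound[OF that]]) (use c that in auto)
    show "(\<lambda>n. p (star (c n) \<otimes> x - x)) \<longlonglongrightarrow> 0" if "x \<in> A" for x
      by (rule tendsto_sandwich[OF _ _ tendsto_const bound[OF that]]) (use c that in auto)
  qed
qed

section \<open>Units of the completion\<close>

abbreviation CS :: "(nat \<Rightarrow> 'a) set" where "CS \<equiv> cauchy_seqs R p"
abbreviation cls :: "(nat \<Rightarrow> 'a) \<Rightarrow> (nat \<Rightarrow> 'a) set" where "cls \<equiv> cauchy_class R p"
abbreviation C where "C \<equiv> completion_alg R p"

lemma CS_iff: "u \<in> CS \<longleftrightarrow> (\<forall>n. u n \<in> A) \<and> (\<forall>\<epsilon>>0. \<exists>N. \<forall>m\<ge>N. \<forall>n\<ge>N. p (u m - u n) < \<epsilon>)"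
  by (simp add: cauchy_seqs_def alg_diff_eq carrier)

lemma CS_mem: "u \<in> CS \<Longrightarrow> u n \<in> A"
  by (simp add: CS_iff)

lemma CS_I:
  assumes "\<And>n. u n \<in> A" "\<And>\<epsilon>. \<epsilon> > 0 \<Longrightarrow> \<exists>N. \<forall>m\<ge>N. \<forall>n\<ge>N. p (u m - u n) < \<epsilon>"
  shows "u \<in> CS"
  using assms by (simp add: CS_iff)

lemma CS_D: "u \<in> CS \<Longrightarrow> \<epsilon> > 0 \<Longrightarrow> \<exists>N. \<forall>m\<ge>N. \<forall>n\<ge>N. p (u m - u n) < \<epsilon>"
  by (simp add: CS_iff)

lemma cls_iff: "v \<in> cls u \<longleftrightarrow> v \<in> CS \<and> (\<lambda>n. p (u n - v n)) \<longlonglongrightarrow> 0"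
  by (simp add: cauchy_class_def alg_diff_eq)

lemma null_sym:
  assumes "u \<in> CS" "v \<in> CS" "(\<lambda>n. p (u n - v n)) \<longlonglongrightarrow> 0"
  shows "(\<lambda>n. p (v n - u n)) \<longlonglongrightarrow> 0"
  using assms(3) norm_minus_commute[OF CS_mem[OF assms(1)] CS_mem[OF assms(2)]] by simp

lemma null_trans:
  assumes "u \<in> CS" "v \<in> CS" "w \<in> CS"
    and "(\<lambda>n. p (u n - v n)) \<longlonglongrightarrow> 0" "(\<lambda>n. p (v n - w n)) \<longlonglongrightarrow> 0"
  shows "(\<lambda>n. p (u n - w n)) \<longlonglongrightarrow> 0"
proof (rule tendsto_sandwich[OF _ _ tendsto_const])
  show "(\<lambda>n. p (u n - v n) + p (v n - w n)) \<longlonglongrightarrow> 0"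
    using tendsto_add[OF assms(4,5)] by simp
  show "\<forall>\<^sub>F n in sequentially. p (u n - w n) \<le> p (u n - v n) + p (v n - w n)"
    using norm_triangle_between[OF CS_mem[OF assms(1)] CS_mem[OF assms(2)] CS_mem[OF assms(3)]] by simp
qed (use assms(1-3) in \<open>simp add: CS_mem\<close>)

lemma cls_eq_iff:
  assumes u: "u \<in> CS" and v: "v \<in> CS"
  shows "cls u = cls v \<longleftrightarrow> (\<lambda>n. p (u n - v n)) \<longlonglongrightarrow> 0"
proof
  assume "cls u = cls v"
  moreover have "v \<in> cls v" using v by (simp add: cls_iff)
  ultimately have "v \<in> cls u" by simp
  then show "(\<lambda>n. p (u n - v n)) \<longlonglongrightarrow> 0" by (simp add: cls_iff)
next
  assume uv: "(\<lambda>n. p (u n - v n)) \<longlonglongrightarrow> 0"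
  show "cls u = cls v"
  proof (intro set_eqI iffI)
    fix w assume "w \<in> cls u"
    then show "w \<in> cls v" using null_trans[OF v u _ null_sym[OF u v uv]] by (simp add: cls_iff)
  next
    fix w assume "w \<in> cls v"
    then show "w \<in> cls u" using null_trans[OF u v _ uv] by (simp add: cls_iff)
  qed
qed

lemma seq_rep:
  assumes u: "u \<in> CS"
  shows "seq_rep (cls u) \<in> CS" "(\<lambda>n. p (u n - seq_rep (cls u) n)) \<longlonglongrightarrow> 0"
proof -
  have "u \<in> cls u" using u by (simp add: cls_iff)
  then have "seq_rep (cls u) \<in> cls u" unfolding seq_rep_def by (rule someI[of "\<lambda>v. v \<in> cls u"])
  then show "seq_rep (cls u) \<in> CS" "(\<lambda>n. p (u n - seq_rep (cls u) n)) \<longlonglongrightarrow> 0"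
    by (simp_all add: cls_iff)
qed

lemma CS_const [simp]: "x \<in> A \<Longrightarrow> (\<lambda>_. x) \<in> CS"
  by (rule CS_I) auto

lemma CS_bounded:
  assumes u: "u \<in> CS"
  obtains B where "B > 0" "\<And>n. p (u n) \<le> B"
proof -
  obtain N where N: "\<And>m n. m \<ge> N \<Longrightarrow> n \<ge> N \<Longrightarrow> p (u m - u n) < 1" using CS_D[OF u, of 1] by auto
  let ?B = "1 + p (u N) + (\<Sum>n<N. p (u n))"
  have sum: "(\<Sum>n<N. p (u n)) \<ge> 0" using u by (intro sum_nonneg) (simp add: CS_mem)
  have "p (u n) \<le> ?B" for n
  proof (cases "n < N")
    case True
    then have "p (u n) \<le> (\<Sum>n<N. p (u n))"
      using u by (intro member_le_sum) (auto simp: CS_mem)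
    then show ?thesis using norm_nonneg[OF CS_mem[OF u], of N] by linarith
  next
    case False
    then have "p (u n) \<le> 1 + p (u N)"
      using N[of n N] norm_diff_ineq[of "u n" "u N"] u by (simp add: CS_mem)
    then show ?thesis using sum by simp
  qed
  moreover have "?B > 0" using sum norm_nonneg[OF CS_mem[OF u], of N] by linarith
  ultimately show ?thesis using that by blast
qed

lemma mult_diff_bound:
  assumes "a \<in> A" "b \<in> A" "a' \<in> A" "b' \<in> A"
  shows "p (a \<otimes> b - a' \<otimes> b') \<le> p (a - a') * p b + p a' * p (b - b')"
proof -
  have "a \<otimes> b - a' \<otimes> b' = (a - a') \<otimes> b + a' \<otimes> (b - b')"
    using assms by (simp add: mult_diff_left mult_diff_right)
  then have "p (a \<otimes> b - a' \<otimes> b') \<le> p ((a - a') \<otimes> b) + p (a' \<otimes> (b - b'))"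
    using norm_add assms by simp
  also have "\<dots> \<le> p (a - a') * p b + p a' * p (b - b')"
    using assms by (intro add_mono norm_mult_le) auto
  finally show ?thesis .
qed

lemma CS_mult:
  assumes u: "u \<in> CS" and v: "v \<in> CS"
  shows "(\<lambda>n. u n \<otimes> v n) \<in> CS"
proof (rule CS_I)
  show "u n \<otimes> v n \<in> A" for n using u v by (simp add: CS_mem)
  obtain B B' where B: "B > 0" "\<And>n. p (u n) \<le> B" and B': "B' > 0" "\<And>n. p (v n) \<le> B'"
    using CS_bounded[OF u] CS_bounded[OF v] by metis
  fix \<epsilon> :: real assume \<epsilon>: "\<epsilon> > 0"
  obtain M where M: "\<And>m n. m \<ge> M \<Longrightarrow> n \<ge> M \<Longrightarrow> p (u m - u n) < \<epsilon> / 2 / B'"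
    using CS_D[OF u, of "\<epsilon> / 2 / B'"] \<epsilon> B' by auto
  obtain N where N: "\<And>m n. m \<ge> N \<Longrightarrow> n \<ge> N \<Longrightarrow> p (v m - v n) < \<epsilon> / 2 / B"
    using CS_D[OF v, of "\<epsilon> / 2 / B"] \<epsilon> B by auto
  have "p (u m \<otimes> v m - u n \<otimes> v n) < \<epsilon>" if "m \<ge> max M N" "n \<ge> max M N" for m n
  proof -
    have "p (u m \<otimes> v m - u n \<otimes> v n) \<le> p (u m - u n) * p (v m) + p (u n) * p (v m - v n)"
      using u v by (intro mult_diff_bound) (auto simp: CS_mem)
    also have "\<dots> \<le> p (u m - u n) * B' + B * p (v m - v n)"
      using B B' u v by (intro add_mono mult_left_mono mult_right_mono) (auto simp: CS_mem)
    also have "\<dots> < \<epsilon> / 2 / B' * B' + B * (\<epsilon> / 2 / B)"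
      using B(1) B'(1) M[of m n] N[of m n] that
      by (intro add_strict_mono mult_strict_right_mono mult_strict_left_mono) auto
    also have "\<dots> = \<epsilon>" using B(1) B'(1) by simp
    finally show ?thesis .
  qed
  then show "\<exists>N. \<forall>m\<ge>N. \<forall>n\<ge>N. p (u m \<otimes> v m - u n \<otimes> v n) < \<epsilon>" by blast
qed

lemma null_mult:
  assumes CS: "u \<in> CS" "v \<in> CS" "u' \<in> CS" "v' \<in> CS"
    and lim: "(\<lambda>n. p (u n - u' n)) \<longlonglongrightarrow> 0" "(\<lambda>n. p (v n - v' n)) \<longlonglongrightarrow> 0"
  shows "(\<lambda>n. p (u n \<otimes> v n - u' n \<otimes> v' n)) \<longlonglongrightarrow> 0"
proof -
  obtain B B' where B: "B > 0" "\<And>n. p (v n) \<le> B" and B': "B' > 0" "\<And>n. p (u' n) \<le> B'"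
    using CS_bounded[OF CS(2)] CS_bounded[OF CS(3)] by metis
  have "(\<lambda>n. p (u n - u' n) * B + B' * p (v n - v' n)) \<longlonglongrightarrow> 0 * B + B' * 0"
    by (intro tendsto_intros lim)
  then have lim0: "(\<lambda>n. p (u n - u' n) * B + B' * p (v n - v' n)) \<longlonglongrightarrow> 0" by simp
  have "p (u n \<otimes> v n - u' n \<otimes> v' n) \<le> p (u n - u' n) * B + B' * p (v n - v' n)" for n
  proof -
    have "p (u n \<otimes> v n - u' n \<otimes> v' n) \<le> p (u n - u' n) * p (v n) + p (u' n) * p (v n - v' n)"
      using CS by (intro mult_diff_bound) (auto simp: CS_mem)
    also have "\<dots> \<le> p (u n - u' n) * B + B' * p (v n - v' n)"
      using B B' CS by (intro add_mono mult_left_mono mult_right_mono) (auto simp: CS_mem)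
    finally show ?thesis .
  qed
  then show ?thesis
    by (intro tendsto_sandwich[OF _ _ tendsto_const lim0]) (use CS in \<open>auto simp: CS_mem\<close>)
qed

lemma CS_diff:
  assumes u: "u \<in> CS" and v: "v \<in> CS"
  shows "(\<lambda>n. u n - v n) \<in> CS"
proof (rule CS_I)
  show "u n - v n \<in> A" for n using u v by (simp add: CS_mem)
  fix \<epsilon> :: real assume \<epsilon>: "\<epsilon> > 0"
  obtain M where M: "\<And>m n. m \<ge> M \<Longrightarrow> n \<ge> M \<Longrightarrow> p (u m - u n) < \<epsilon> / 2"
    using CS_D[OF u, of "\<epsilon> / 2"] \<epsilon> by auto
  obtain N where N: "\<And>m n. m \<ge> N \<Longrightarrow> n \<ge> N \<Longrightarrow> p (v m - v n) < \<epsilon> / 2"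
    using CS_D[OF v, of "\<epsilon> / 2"] \<epsilon> by auto
  have "p (u m - v m - (u n - v n)) < \<epsilon>" if "m \<ge> max M N" "n \<ge> max M N" for m n
  proof -
    have eq: "u m - v m - (u n - v n) = (u m - u n) - (v m - v n)" by simp
    have "p (u m - v m - (u n - v n)) \<le> p (u m - u n) + p (v m - v n)"
      unfolding eq by (rule norm_diff) (use u v in \<open>simp_all add: CS_mem\<close>)
    then show ?thesis using M[of m n] N[of m n] that by simp
  qed
  then show "\<exists>N. \<forall>m\<ge>N. \<forall>n\<ge>N. p (u m - v m - (u n - v n)) < \<epsilon>" by blast
qed

lemma CS_star:
  assumes u: "u \<in> CS"
  shows "(\<lambda>n. star (u n)) \<in> CS"
  using u by (intro CS_I) (simp_all add: CS_mem CS_D norm_star flip: star_diff)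

lemma carrier_completion: "\<xi> \<in> alg_carrier C \<longleftrightarrow> (\<exists>u\<in>CS. \<xi> = cls u)"
  by (auto simp: completion_alg_def)

lemma mult_completion:
  assumes u: "u \<in> CS" and v: "v \<in> CS"
  shows "alg_mult C (cls u) (cls v) = cls (\<lambda>n. u n \<otimes> v n)"
proof -
  have "cls (\<lambda>n. u n \<otimes> v n) = cls (\<lambda>n. seq_rep (cls u) n \<otimes> seq_rep (cls v) n)"
    using u v seq_rep[OF u] seq_rep[OF v] by (simp add: cls_eq_iff CS_mult null_mult)
  then show ?thesis by (simp add: completion_alg_def mult)
qed

lemma star_completion:
  assumes u: "u \<in> CS"
  shows "alg_star C (cls u) = cls (\<lambda>n. star (u n))"
proof -
  have "(\<lambda>n. p (star (u n) - star (seq_rep (cls u) n))) = (\<lambda>n. p (u n - seq_rep (cls u) n))"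
    using u seq_rep(1)[OF u] by (simp add: CS_mem norm_star flip: star_diff)
  then have "cls (\<lambda>n. star (u n)) = cls (\<lambda>n. star (seq_rep (cls u) n))"
    using u seq_rep[OF u] by (simp add: cls_eq_iff CS_star)
  then show ?thesis by (simp add: completion_alg_def star)
qed

lemma null_diff:
  assumes CS: "u \<in> CS" "v \<in> CS" "u' \<in> CS" "v' \<in> CS"
    and lim: "(\<lambda>n. p (u n - u' n)) \<longlonglongrightarrow> 0" "(\<lambda>n. p (v n - v' n)) \<longlonglongrightarrow> 0"
  shows "(\<lambda>n. p ((u n - v n) - (u' n - v' n))) \<longlonglongrightarrow> 0"
proof (rule tendsto_sandwich[OF _ _ tendsto_const])
  show "(\<lambda>n. p (u n - u' n) + p (v n - v' n)) \<longlonglongrightarrow> 0"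
    using tendsto_add[OF lim] by simp
  have "p ((u n - v n) - (u' n - v' n)) \<le> p (u n - u' n) + p (v n - v' n)" for n
  proof -
    have eq: "(u n - v n) - (u' n - v' n) = (u n - u' n) - (v n - v' n)" by simp
    show ?thesis unfolding eq by (rule norm_diff) (use CS in \<open>simp_all add: CS_mem\<close>)
  qed
  then show "\<forall>\<^sub>F n in sequentially. p ((u n - v n) - (u' n - v' n)) \<le> p (u n - u' n) + p (v n - v' n)"
    by simp
qed (use CS in \<open>simp add: CS_mem\<close>)

lemma minus_completion:
  assumes u: "u \<in> CS"
  shows "alg_scale C (-1) (cls u) = cls (\<lambda>n. - u n)" "(\<lambda>n. - u n) \<in> CS"
proof -
  have CS_minus: "(\<lambda>n. - v n) \<in> CS" if "v \<in> CS" for v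
    using CS_diff[OF CS_const[OF zero_closed] that] by simp
  show m: "(\<lambda>n. - u n) \<in> CS" by (rule CS_minus[OF u])
  have "cls (\<lambda>n. - u n) = cls (\<lambda>n. - seq_rep (cls u) n)"
    using null_diff[OF CS_const[OF zero_closed] u CS_const[OF zero_closed] seq_rep(1)[OF u]] seq_rep[OF u]
    by (simp add: cls_eq_iff m CS_minus)
  then show "alg_scale C (-1) (cls u) = cls (\<lambda>n. - u n)"
    by (simp add: completion_alg_def scale scale_minus_one)
qed

lemma diff_completion:
  assumes u: "u \<in> CS" and v: "v \<in> CS"
  shows "alg_diff C (cls u) (cls v) = cls (\<lambda>n. u n - v n)"
proof -
  let ?w = "\<lambda>n. - v n"
  have w: "?w \<in> CS" by (rule minus_completion(2)[OF v])
  have mm: "(\<lambda>n. - seq_rep (cls ?w) n) \<in> CS" by (rule minus_completion(2)[OF seq_rep(1)[OF w]])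
  have lim: "(\<lambda>n. p (v n - (- seq_rep (cls ?w) n))) \<longlonglongrightarrow> 0"
  proof -
    have "(\<lambda>n. p (v n - (- seq_rep (cls ?w) n))) = (\<lambda>n. p (?w n - seq_rep (cls ?w) n))"
    proof
      fix n
      have "v n - (- seq_rep (cls ?w) n) = - (?w n - seq_rep (cls ?w) n)" by simp
      then show "p (v n - (- seq_rep (cls ?w) n)) = p (?w n - seq_rep (cls ?w) n)"
        using norm_minus[of "?w n - seq_rep (cls ?w) n"] CS_mem[OF v] CS_mem[OF seq_rep(1)[OF w]]
        by (simp add: add.commute)
    qed
    then show ?thesis using seq_rep(2)[OF w] by simp
  qed
  have "cls (\<lambda>n. u n - v n) = cls (\<lambda>n. seq_rep (cls u) n - (- seq_rep (cls ?w) n))"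
    using cls_eq_iff[OF CS_diff[OF u v] CS_diff[OF seq_rep(1)[OF u] mm]]
      null_diff[OF u v seq_rep(1)[OF u] mm seq_rep(2)[OF u] lim] by blast
  then show ?thesis
    unfolding alg_diff_def minus_completion(1)[OF v] by (simp add: completion_alg_def add)
qed

lemma norm_completion:
  assumes u: "u \<in> CS"
  shows "(\<lambda>n. p (u n)) \<longlonglongrightarrow> alg_norm C (cls u)"
proof -
  let ?r = "seq_rep (cls u)"
  have "Cauchy (\<lambda>n. p (?r n))"
  proof (rule CauchyI)
    fix \<epsilon> :: real assume "\<epsilon> > 0"
    then obtain N where N: "\<forall>m\<ge>N. \<forall>n\<ge>N. p (?r m - ?r n) < \<epsilon>"
      using CS_D[OF seq_rep(1)[OF u]] by blast
    have "norm (p (?r m) - p (?r n)) < \<epsilon>" if "m \<ge> N" "n \<ge> N" for m n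
      using norm_diff_ineq[OF CS_mem CS_mem, OF seq_rep(1)[OF u] seq_rep(1)[OF u], of m n] N that
      by (metis le_less_trans real_norm_def)
    then show "\<exists>N. \<forall>m\<ge>N. \<forall>n\<ge>N. norm (p (?r m) - p (?r n)) < \<epsilon>" by blast
  qed
  then have "(\<lambda>n. p (?r n)) \<longlonglongrightarrow> alg_norm C (cls u)"
    by (simp add: completion_alg_def Cauchy_convergent_iff convergent_LIMSEQ_iff)
  moreover have "(\<lambda>n. p (u n) - p (?r n)) \<longlonglongrightarrow> 0"
  proof (rule Lim_null_comparison[OF _ seq_rep(2)[OF u]])
    show "\<forall>\<^sub>F n in sequentially. norm (p (u n) - p (?r n)) \<le> p (u n - ?r n)"
      using norm_diff_ineq CS_mem[OF u] CS_mem[OF seq_rep(1)[OF u]] by simp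
  qed
  ultimately show ?thesis using tendsto_add by fastforce
qed

text \<open>Elements on which the seminorm vanishes become zero in the completion.\<close>

lemma unital_completionI:
  assumes u: "u \<in> A" and unit: "\<And>x. x \<in> A \<Longrightarrow> p (u \<otimes> x - x) = 0" "\<And>x. x \<in> A \<Longrightarrow> p (x \<otimes> u - x) = 0"
  shows "unital_alg C"
  unfolding unital_alg_def
proof (intro bexI[of _ "cls (\<lambda>_. u)"] ballI)
  show "cls (\<lambda>_. u) \<in> alg_carrier C" using u by (auto simp: carrier_completion)
  fix \<xi> assume "\<xi> \<in> alg_carrier C"
  then obtain w where w: "w \<in> CS" "\<xi> = cls w" by (auto simp: carrier_completion)
  have "cls (\<lambda>n. u \<otimes> w n) = cls w" "cls (\<lambda>n. w n \<otimes> u) = cls w"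
    using u w unit by (simp_all add: cls_eq_iff CS_mult CS_mem)
  then show "alg_mult C (cls (\<lambda>_. u)) \<xi> = \<xi> \<and> alg_mult C \<xi> (cls (\<lambda>_. u)) = \<xi>"
    using u w by (simp add: mult_completion)
qed

text \<open>A late term of a Cauchy sequence that represents the unit is a unit up to \<open>\<epsilon>\<close>, uniformly on the
  unit ball.\<close>

lemma unital_completionD:
  assumes "unital_alg C" and \<epsilon>: "\<epsilon> > 0"
  obtains u where "u \<in> A" "\<And>x. x \<in> A \<Longrightarrow> p (u \<otimes> x - x) \<le> \<epsilon> * p x"
proof -
  from assms(1) obtain \<upsilon> where \<upsilon>: "\<upsilon> \<in> alg_carrier C" "\<forall>\<xi>\<in>alg_carrier C. alg_mult C \<upsilon> \<xi> = \<xi>"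
    unfolding unital_alg_def by blast
  then obtain u where u: "u \<in> CS" "\<upsilon> = cls u" by (auto simp: carrier_completion)
  obtain N where N: "\<And>m n. m \<ge> N \<Longrightarrow> n \<ge> N \<Longrightarrow> p (u m - u n) < \<epsilon>"
    using CS_D[OF u(1) \<epsilon>] by auto
  have "p (u N \<otimes> x - x) \<le> \<epsilon> * p x" if x: "x \<in> A" for x
  proof -
    have cx: "(\<lambda>_. x) \<in> CS" using x by simp
    then have "cls (\<lambda>_. x) \<in> alg_carrier C" unfolding carrier_completion by blast
    then have "alg_mult C \<upsilon> (cls (\<lambda>_. x)) = cls (\<lambda>_. x)" by (rule bspec[OF \<upsilon>(2)])
    then have "cls (\<lambda>n. u n \<otimes> x) = cls (\<lambda>_. x)"
      unfolding u(2) using mult_completion[OF u(1) cx] by simp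
    then have lim: "(\<lambda>n. p (u n \<otimes> x - x)) \<longlonglongrightarrow> 0"
      using cls_eq_iff[OF CS_mult[OF u(1) cx] cx] by simp
    have lim': "(\<lambda>n. \<epsilon> * p x + p (u n \<otimes> x - x)) \<longlonglongrightarrow> \<epsilon> * p x"
      using tendsto_add[OF tendsto_const lim] by simp
    have "p (u N \<otimes> x - x) \<le> \<epsilon> * p x + p (u n \<otimes> x - x)" if "n \<ge> N" for n
    proof -
      have "p (u N \<otimes> x - x) \<le> p (u N \<otimes> x - u n \<otimes> x) + p (u n \<otimes> x - x)"
        by (rule norm_triangle_between) (use u x in \<open>auto simp: CS_mem\<close>)
      moreover have "p (u N \<otimes> x - u n \<otimes> x) \<le> p (u N - u n) * p x"
        using norm_mult_le[of "u N - u n" x] u x by (simp add: CS_mem mult_diff_left)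
      moreover have "p (u N - u n) * p x \<le> \<epsilon> * p x"
        using N[of N n] that x by (intro mult_right_mono) auto
      ultimately show ?thesis by linarith
    qed
    then show ?thesis
      by (intro tendsto_lowerbound[OF lim']) (auto simp: eventually_sequentially)
  qed
  then show ?thesis using that[of "u N"] u by (simp add: CS_mem)
qed

text \<open>The approximate unit of the completion is \<open>c\<^sup>* c\<close>, a positive element by its form. Multiplication by
  it from the right is controlled through the involution.\<close>

lemma sigma_unital_completionI:
  assumes c: "\<And>n. c n \<in> A" "\<And>n. p (c n) \<le> 1"
    and lim: "\<And>x. x \<in> A \<Longrightarrow> (\<lambda>n. p (c n \<otimes> x - x)) \<longlonglongrightarrow> 0"
      "\<And>x. x \<in> A \<Longrightarrow> (\<lambda>n. p (star (c n) \<otimes> x - x)) \<longlonglongrightarrow> 0"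
  shows "sigma_unital_alg C"
proof -
  define v where "v n = star (c n) \<otimes> c n" for n
  have v: "v n \<in> A" "p (v n) \<le> 1" "star (v n) = v n" for n
    using c norm_cstar[OF c(1)] by (simp_all add: v_def star_mult power_le_one)
  have vx: "(\<lambda>n. p (v n \<otimes> x - x)) \<longlonglongrightarrow> 0" if x: "x \<in> A" for x
  proof (rule tendsto_sandwich[OF _ _ tendsto_const])
    show "(\<lambda>n. p (c n \<otimes> x - x) + p (star (c n) \<otimes> x - x)) \<longlonglongrightarrow> 0"
      using tendsto_add[OF lim[OF x]] by simp
    have "p (v n \<otimes> x - x) \<le> p (c n \<otimes> x - x) + p (star (c n) \<otimes> x - x)" for n
    proof -
      have eq: "v n \<otimes> x - x = star (c n) \<otimes> (c n \<otimes> x - x) + (star (c n) \<otimes> x - x)"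
        using c x by (simp add: v_def mult_assoc mult_diff_right)
      have "p (v n \<otimes> x - x) \<le> p (star (c n) \<otimes> (c n \<otimes> x - x)) + p (star (c n) \<otimes> x - x)"
        unfolding eq by (rule norm_add) (use c x in auto)
      moreover have "p (star (c n) \<otimes> (c n \<otimes> x - x)) \<le> p (c n) * p (c n \<otimes> x - x)"
        using norm_mult_le[of "star (c n)" "c n \<otimes> x - x"] c x by (simp add: norm_star)
      moreover have "p (c n) * p (c n \<otimes> x - x) \<le> 1 * p (c n \<otimes> x - x)"
        using c x by (intro mult_right_mono) auto
      ultimately show ?thesis by linarith
    qed
    then show "\<forall>\<^sub>F n in sequentially. p (v n \<otimes> x - x) \<le> p (c n \<otimes> x - x) + p (star (c n) \<otimes> x - x)"
      by simp
  qed (use v x in simp)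
  have xv: "(\<lambda>n. p (x \<otimes> v n - x)) \<longlonglongrightarrow> 0" if x: "x \<in> A" for x
  proof -
    have "p (x \<otimes> v n - x) = p (v n \<otimes> star x - star x)" for n
      using norm_star[of "x \<otimes> v n - x"] v x by (simp add: star_diff star_mult)
    then show ?thesis using vx[of "star x"] x by simp
  qed
  \<comment> \<open>Convergence on \<open>A\<close> passes to Cauchy sequences, the multipliers being uniformly bounded.\<close>
  have dense: "(\<lambda>n. alg_norm C (cls (\<lambda>j. M n (w j) - w j))) \<longlonglongrightarrow> 0"
    if w: "w \<in> CS" and M: "\<And>n. (\<lambda>j. M n (w j)) \<in> CS" "\<And>n x. x \<in> A \<Longrightarrow> M n x \<in> A"
      "\<And>n x y. x \<in> A \<Longrightarrow> y \<in> A \<Longrightarrow> p (M n x - M n y) \<le> p (x - y)"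
      "\<And>x. x \<in> A \<Longrightarrow> (\<lambda>n. p (M n x - x)) \<longlonglongrightarrow> 0" for w M
  proof (rule LIMSEQ_I)
    fix \<epsilon> :: real assume \<epsilon>: "\<epsilon> > 0"
    obtain J where J: "\<And>i j. i \<ge> J \<Longrightarrow> j \<ge> J \<Longrightarrow> p (w i - w j) < \<epsilon> / 4"
      using CS_D[OF w, of "\<epsilon> / 4"] \<epsilon> by auto
    obtain N where N0: "\<forall>n\<ge>N. norm (p (M n (w J) - w J) - 0) < \<epsilon> / 4"
      using LIMSEQ_D[OF M(4)[OF CS_mem[OF w, of J]], of "\<epsilon> / 4"] \<epsilon> by auto
    have N: "p (M n (w J) - w J) < \<epsilon> / 4" if "n \<ge> N" for n
      using N0[rule_format, OF that] by simp
    have "norm (alg_norm C (cls (\<lambda>j. M n (w j) - w j)) - 0) < \<epsilon>" if n: "n \<ge> N" for n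
    proof -
      have CS: "(\<lambda>j. M n (w j) - w j) \<in> CS" by (rule CS_diff[OF M(1) w])
      have "p (M n (w j) - w j) \<le> 3 / 4 * \<epsilon>" if "j \<ge> J" for j
      proof -
        have wA: "w j \<in> A" "w J \<in> A" using w by (auto simp: CS_mem)
        have "p (M n (w j) - w j) \<le> p (M n (w j) - M n (w J)) + p (M n (w J) - w j)"
          using wA M(2) by (intro norm_triangle_between) auto
        moreover have "p (M n (w J) - w j) \<le> p (M n (w J) - w J) + p (w J - w j)"
          using wA M(2) by (intro norm_triangle_between) auto
        moreover have "p (M n (w j) - M n (w J)) \<le> p (w j - w J)" using wA M(3) by auto
        ultimately show ?thesis using J[of j J] J[of J j] N[OF n] that by simp
      qed
      then have "alg_norm C (cls (\<lambda>j. M n (w j) - w j)) \<le> 3 / 4 * \<epsilon>"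
        by (intro tendsto_upperbound[OF norm_completion[OF CS]]) (auto simp: eventually_sequentially)
      moreover have "alg_norm C (cls (\<lambda>j. M n (w j) - w j)) \<ge> 0"
        by (rule tendsto_lowerbound[OF norm_completion[OF CS]])
          (use CS in \<open>auto simp: CS_iff\<close>)
      ultimately show ?thesis using \<epsilon> by simp
    qed
    then show "\<exists>N. \<forall>n\<ge>N. norm (alg_norm C (cls (\<lambda>j. M n (w j) - w j)) - 0) < \<epsilon>" by blast
  qed
  have "countable_approximate_unit C (\<lambda>n. cls (\<lambda>_. v n))"
    unfolding countable_approximate_unit_def
  proof (intro conjI allI ballI)
    fix n
    have cn: "(\<lambda>_. c n) \<in> CS" "(\<lambda>_. v n) \<in> CS" using c v by simp_all
    show "cls (\<lambda>_. v n) \<in> alg_carrier C" using cn by (auto simp: carrier_completion)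
    have "(\<lambda>_. p (v n)) \<longlonglongrightarrow> alg_norm C (cls (\<lambda>_. v n))" by (rule norm_completion[OF cn(2)])
    then have "alg_norm C (cls (\<lambda>_. v n)) = p (v n)" using LIMSEQ_unique tendsto_const by blast
    then show "alg_norm C (cls (\<lambda>_. v n)) \<le> 1" using v by simp
    show "\<exists>d\<in>alg_carrier C. cls (\<lambda>_. v n) = alg_mult C (alg_star C d) d"
    proof
      show "cls (\<lambda>_. c n) \<in> alg_carrier C" using cn by (auto simp: carrier_completion)
      show "cls (\<lambda>_. v n) = alg_mult C (alg_star C (cls (\<lambda>_. c n))) (cls (\<lambda>_. c n))"
        using star_completion[OF cn(1)] mult_completion[OF CS_star[OF cn(1)] cn(1)] by (simp add: v_def)
    qed
  next
    fix \<xi> assume "\<xi> \<in> alg_carrier C"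
    then obtain w where w: "w \<in> CS" "\<xi> = cls w" by (auto simp: carrier_completion)
    have cv: "(\<lambda>_. v n) \<in> CS" for n using v by simp
    have bnd: "p (v n \<otimes> x - v n \<otimes> y) \<le> p (x - y)" "p (x \<otimes> v n - y \<otimes> v n) \<le> p (x - y)"
      if "x \<in> A" "y \<in> A" for n x y
    proof -
      have "p (v n) * p (x - y) \<le> 1 * p (x - y)" using v that by (intro mult_right_mono) auto
      then show "p (v n \<otimes> x - v n \<otimes> y) \<le> p (x - y)" "p (x \<otimes> v n - y \<otimes> v n) \<le> p (x - y)"
        using norm_mult_le[of "v n" "x - y"] norm_mult_le[of "x - y" "v n"] v that
        by (simp_all add: mult_diff_left mult_diff_right mult.commute)
    qed
    have "(\<lambda>n. alg_norm C (cls (\<lambda>j. v n \<otimes> w j - w j))) \<longlonglongrightarrow> 0"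
      by (rule dense[OF w(1), of "\<lambda>n x. v n \<otimes> x"]) (use v vx bnd w CS_mult[OF cv w(1)] in auto)
    then show "(\<lambda>n. alg_norm C (alg_diff C (alg_mult C (cls (\<lambda>_. v n)) \<xi>) \<xi>)) \<longlonglongrightarrow> 0"
      unfolding w(2) mult_completion[OF cv w(1)] diff_completion[OF CS_mult[OF cv w(1)] w(1)] .
    have "(\<lambda>n. alg_norm C (cls (\<lambda>j. w j \<otimes> v n - w j))) \<longlonglongrightarrow> 0"
      by (rule dense[OF w(1), of "\<lambda>n x. x \<otimes> v n"]) (use v xv bnd w CS_mult[OF w(1) cv] in auto)
    then show "(\<lambda>n. alg_norm C (alg_diff C (alg_mult C \<xi> (cls (\<lambda>_. v n))) \<xi>)) \<longlonglongrightarrow> 0"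
      unfolding w(2) mult_completion[OF w(1) cv] diff_completion[OF CS_mult[OF w(1) cv] w(1)] .
  qed
  then show ?thesis unfolding sigma_unital_alg_def by blast
qed

text \<open>The \<open>n\<close>-th member of the approximate unit is replaced by an element of \<open>A\<close> at distance \<open>1 / (n + 1)\<close>.\<close>

lemma sigma_unital_completionD:
  assumes "sigma_unital_alg C"
  obtains v where "\<And>n::nat. v n \<in> A" "\<And>x. x \<in> A \<Longrightarrow> (\<lambda>n. p (v n \<otimes> x - x)) \<longlonglongrightarrow> 0"
proof -
  from assms obtain \<upsilon> where \<upsilon>: "countable_approximate_unit C \<upsilon>" unfolding sigma_unital_alg_def by blast
  have "\<exists>u. u \<in> CS \<and> \<upsilon> n = cls u" for n
  proof -
    have "\<upsilon> n \<in> alg_carrier C" using \<upsilon> unfolding countable_approximate_unit_def by simp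
    then show ?thesis unfolding carrier_completion by blast
  qed
  then obtain s where s: "\<And>n. s n \<in> CS" "\<And>n. \<upsilon> n = cls (s n)" by metis
  have "\<exists>k. \<forall>j\<ge>k. p (s n j - s n k) < 1 / real (Suc n)" for n
    using CS_D[OF s(1), of "1 / real (Suc n)" n] by auto
  then obtain k where k: "\<And>n j. j \<ge> k n \<Longrightarrow> p (s n j - s n (k n)) < 1 / real (Suc n)" by metis
  define v where "v n = s n (k n)" for n
  have v: "v n \<in> A" for n using s by (simp add: v_def CS_mem)
  have "(\<lambda>n. p (v n \<otimes> x - x)) \<longlonglongrightarrow> 0" if x: "x \<in> A" for x
  proof -
    let ?D = "\<lambda>n. alg_norm C (alg_diff C (alg_mult C (\<upsilon> n) (cls (\<lambda>_. x))) (cls (\<lambda>_. x)))"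
    have cx: "(\<lambda>_. x) \<in> CS" using x by simp
    have "cls (\<lambda>_. x) \<in> alg_carrier C" using cx unfolding carrier_completion by blast
    then have lim: "?D \<longlonglongrightarrow> 0"
      using \<upsilon> unfolding countable_approximate_unit_def by simp
    have D: "?D n = alg_norm C (cls (\<lambda>j. s n j \<otimes> x - x))" for n
      unfolding s(2) mult_completion[OF s(1) cx] diff_completion[OF CS_mult[OF s(1) cx] cx] ..
    have le: "p (v n \<otimes> x - x) \<le> ?D n + 1 / real (Suc n) * p x" for n
    proof -
      have "(\<lambda>j. p (s n j \<otimes> x - x)) \<longlonglongrightarrow> ?D n"
        unfolding D by (rule norm_completion[OF CS_diff[OF CS_mult[OF s(1) cx] cx]])
      then have lim': "(\<lambda>j. p (s n j \<otimes> x - x) + 1 / real (Suc n) * p x) \<longlonglongrightarrow> ?D n + 1 / real (Suc n) * p x"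
        by (intro tendsto_intros)
      have "p (v n \<otimes> x - x) \<le> p (s n j \<otimes> x - x) + 1 / real (Suc n) * p x" if "j \<ge> k n" for j
      proof -
        have sA: "s n j \<in> A" using s by (simp add: CS_mem)
        have "p (v n \<otimes> x - x) \<le> p (v n \<otimes> x - s n j \<otimes> x) + p (s n j \<otimes> x - x)"
          by (rule norm_triangle_between) (use v sA x in auto)
        moreover have "p (v n \<otimes> x - s n j \<otimes> x) \<le> p (v n - s n j) * p x"
          using norm_mult_le[of "v n - s n j" x] v sA x by (simp add: mult_diff_left)
        moreover have "p (v n - s n j) * p x \<le> 1 / real (Suc n) * p x"
          using k[OF that] norm_minus_commute[OF v sA, of n] x
          by (intro mult_right_mono) (auto simp: v_def)
        ultimately show ?thesis by linarith
      qed
      then show ?thesis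
        by (intro tendsto_lowerbound[OF lim']) (auto simp: eventually_sequentially)
    qed
    have "(\<lambda>n. ?D n + inverse (real (Suc n)) * p x) \<longlonglongrightarrow> 0 + 0 * p x"
      by (intro tendsto_intros lim LIMSEQ_inverse_real_of_nat)
    then have "(\<lambda>n. ?D n + 1 / real (Suc n) * p x) \<longlonglongrightarrow> 0" by (simp add: divide_inverse)
    then show ?thesis
      by (rule tendsto_sandwich[OF _ _ tendsto_const, rotated 2]) (use le v x in auto)
  qed
  then show ?thesis using that v by blast
qed

end

section \<open>The crossed product is a star-algebra\<close>

lemma C0_on_sum:
  assumes "finite I" "\<And>i. i \<in> I \<Longrightarrow> f i \<in> C0_on X U"
  shows "(\<lambda>x. \<Sum>i\<in>I. f i x) \<in> C0_on X U"
  using assms by (induction I rule: finite_induct) (auto intro: C0_on_add)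

lemma not_supp: "s \<notin> supp T \<Longrightarrow> T s x = 0"
  by (simp add: supp_def)

context locally_compact_action
begin

abbreviation KA :: "('s \<Rightarrow> 'x \<Rightarrow> complex) set" where "KA \<equiv> alg_carrier (KS_alg X \<theta>)"
abbreviation KS_scale :: "complex \<Rightarrow> ('s \<Rightarrow> 'x \<Rightarrow> complex) \<Rightarrow> ('s \<Rightarrow> 'x \<Rightarrow> complex)"
  where "KS_scale \<equiv> alg_scale (KS_alg X \<theta>)"
abbreviation KS_mult :: "('s \<Rightarrow> 'x \<Rightarrow> complex) \<Rightarrow> ('s \<Rightarrow> 'x \<Rightarrow> complex) \<Rightarrow> ('s \<Rightarrow> 'x \<Rightarrow> complex)"
    (infixl \<open>\<odot>\<close> 70)
  where "KS_mult \<equiv> alg_mult (KS_alg X \<theta>)"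
abbreviation KS_star :: "('s \<Rightarrow> 'x \<Rightarrow> complex) \<Rightarrow> ('s \<Rightarrow> 'x \<Rightarrow> complex)"
  where "KS_star \<equiv> alg_star (KS_alg X \<theta>)"

text \<open>\<open>f \<circ> \<theta>\<^sub>t\<close>, extended by zero.\<close>

definition pull :: "'s \<Rightarrow> ('x \<Rightarrow> complex) \<Rightarrow> 'x \<Rightarrow> complex"
  where "pull t f x = (case \<theta> t x of None \<Rightarrow> 0 | Some y \<Rightarrow> f y)"

lemma pull_eq: "pull t f = (\<lambda>x. case \<theta> t x of None \<Rightarrow> 0 | Some y \<Rightarrow> f y)"
  by (simp add: pull_def fun_eq_iff)

lemma act_fun_eq_pull: "act_fun \<theta> (t\<^sup>\<star>) f = pull t f"
  by (simp add: act_fun_def pull_def sinv_sinv fun_eq_iff)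

lemma act_fun_eq_pull': "act_fun \<theta> t f = pull (t\<^sup>\<star>) f"
  by (simp add: act_fun_def pull_def fun_eq_iff)

text \<open>In the notation of the actions on functions: \<open>\<alpha>\<^bsub>t*\<^esub>(f \<alpha>\<^sub>t(g)) = \<alpha>\<^bsub>t*\<^esub>(f) g\<close>. The product thus takes the
  form of a convolution, \<open>(T U)(r, x) = \<Sum>\<^bsub>st=r\<^esub> T(s, \<theta>\<^sub>t x) U(t, x)\<close>.\<close>

lemma pull_mult_pull: "pull t (\<lambda>y. f y * pull (t\<^sup>\<star>) g y) x = pull t f x * g x"
  by (auto simp: pull_def act_sinv split: option.split)

lemma pull_pull: "pull v (pull t f) x = pull (t * v) f x"
  by (simp add: pull_def act_mult map_comp_def split: option.split)

lemma KA_iff: "T \<in> KA \<longleftrightarrow> finite (supp T) \<and> (\<forall>s. T s \<in> C0_on X (act_dom \<theta> (s\<^sup>\<star> * s)))"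
  by (simp add: KS_alg_def)

lemma KA_supp: "T \<in> KA \<Longrightarrow> finite (supp T)"
  and KA_C0: "T \<in> KA \<Longrightarrow> T s \<in> C0_on X (act_dom \<theta> (s\<^sup>\<star> * s))"
  by (simp_all add: KA_iff)

lemma KA_off: "T \<in> KA \<Longrightarrow> \<theta> s x = None \<Longrightarrow> T s x = 0"
  by (rule C0_on_off[OF KA_C0]) (auto simp: mem_act_dom_source)

lemma KS_add: "alg_add (KS_alg X \<theta>) = (+)"
  by (simp add: KS_alg_def fun_eq_iff)

lemma KS_scale_apply: "KS_scale c T s x = c * T s x"
  by (simp add: KS_alg_def)

lemma KS_star_apply: "KS_star T r x = pull r (\<lambda>y. cnj (T (r\<^sup>\<star>) y)) x"
  by (simp add: KS_alg_def act_fun_eq_pull)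

lemma KS_mult_apply:
  assumes F: "finite F" "supp T \<subseteq> F" and G: "finite G" "supp U \<subseteq> G"
  shows "(T \<odot> U) r x = (\<Sum>s\<in>F. \<Sum>t\<in>G. if s * t = r then pull t (T s) x * U t x else 0)"
proof -
  let ?g = "\<lambda>(s, t). if s * t = r then pull t (T s) x * U t x else 0"
  let ?I = "{(s, t). s \<in> supp T \<and> t \<in> supp U \<and> s * t = r}"
  have "(T \<odot> U) r x = (\<Sum>(s, t)\<in>?I. pull t (T s) x * U t x)"
    by (simp add: KS_alg_def act_fun_eq_pull' sinv_sinv pull_mult_pull)
  also have "\<dots> = sum ?g ?I" by (rule sum.cong) auto
  also have "\<dots> = sum ?g (F \<times> G)"
  proof (rule sum.mono_neutral_left)
    show "finite (F \<times> G)" using F G by simp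
    show "?I \<subseteq> F \<times> G" using F G by auto
    have z: "pull t (T s) x * U t x = 0" if "s \<notin> supp T \<or> t \<notin> supp U" for s t
      using that by (auto simp: supp_def pull_def split: option.split)
    show "\<forall>i\<in>F \<times> G - ?I. ?g i = 0"
    proof
      fix i assume i: "i \<in> F \<times> G - ?I"
      obtain s t where st: "i = (s, t)" by (cases i)
      show "?g i = 0"
      proof (cases "s * t = r")
        case True
        then have "s \<notin> supp T \<or> t \<notin> supp U" using i st by auto
        then show ?thesis using z st by simp
      qed (simp add: st)
    qed
  qed
  also have "\<dots> = (\<Sum>s\<in>F. \<Sum>t\<in>G. if s * t = r then pull t (T s) x * U t x else 0)"
    by (simp add: sum.cartesian_product)
  finally show ?thesis .
qed

text \<open>Pairing an element with an arbitrary function on \<open>S\<close> at a point turns the convolution sums over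
  factorizations \<open>s t = r\<close> into iterated sums, on which associativity is visible.\<close>

definition pairing :: "('s \<Rightarrow> 'x \<Rightarrow> complex) \<Rightarrow> ('s \<Rightarrow> complex) \<Rightarrow> 'x \<Rightarrow> complex"
  where "pairing T \<phi> x = (\<Sum>s\<in>supp T. T s x * \<phi> s)"

lemma pairing_superset:
  assumes "finite F" "supp T \<subseteq> F"
  shows "pairing T \<phi> x = (\<Sum>s\<in>F. T s x * \<phi> s)"
  unfolding pairing_def by (rule sum.mono_neutral_left) (use assms not_supp in auto)

lemma pairing_indicator:
  assumes "finite (supp T)"
  shows "pairing T (\<lambda>s. if s = r then 1 else 0) x = T r x"
proof -
  have fin: "finite (insert r (supp T))" using assms by simp
  have "pairing T (\<lambda>s. if s = r then 1 else 0) x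
      = (\<Sum>s\<in>insert r (supp T). T s x * (if s = r then 1 else 0))"
    by (rule pairing_superset[OF fin]) auto
  also have "\<dots> = (\<Sum>s\<in>insert r (supp T). if s = r then T s x else 0)"
    by (rule sum.cong) auto
  also have "\<dots> = T r x" unfolding sum.delta[OF fin] by simp
  finally show ?thesis .
qed

lemma pairing_eqI:
  assumes "finite (supp T)" "finite (supp U)" "\<And>\<phi> x. pairing T \<phi> x = pairing U \<phi> x"
  shows "T = U"
  using pairing_indicator[OF assms(1)] pairing_indicator[OF assms(2)] assms(3)
  by (intro ext) metis

lemma supp_mult_subset:
  assumes "T \<in> KA" "U \<in> KA"
  shows "supp (T \<odot> U) \<subseteq> (\<lambda>(s, t). s * t) ` (supp T \<times> supp U)"
proof
  fix r assume "r \<in> supp (T \<odot> U)"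
  then obtain x where "(T \<odot> U) r x \<noteq> 0" by (auto simp: supp_def)
  then have "\<exists>s\<in>supp T. \<exists>t\<in>supp U. s * t = r"
    unfolding KS_mult_apply[OF KA_supp[OF assms(1)] order_refl KA_supp[OF assms(2)] order_refl]
    by (fastforce elim!: sum.not_neutral_contains_not_neutral split: if_splits)
  then show "r \<in> (\<lambda>(s, t). s * t) ` (supp T \<times> supp U)" by auto
qed

lemma finite_supp_mult: "T \<in> KA \<Longrightarrow> U \<in> KA \<Longrightarrow> finite (supp (T \<odot> U))"
  by (rule finite_subset[OF supp_mult_subset]) (auto simp: KA_supp)

lemma pairing_mult:
  assumes T: "T \<in> KA" and U: "U \<in> KA"
  shows "pairing (T \<odot> U) \<phi> x = (\<Sum>t\<in>supp U. U t x * pull t (pairing T (\<lambda>s. \<phi> (s * t))) x)"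
proof -
  let ?F = "(\<lambda>(s, t). s * t) ` (supp T \<times> supp U)"
  have fin: "finite ?F" using T U by (simp add: KA_supp)
  have "pairing (T \<odot> U) \<phi> x =
      (\<Sum>r\<in>?F. \<Sum>s\<in>supp T. \<Sum>t\<in>supp U. if s * t = r then pull t (T s) x * U t x * \<phi> r else 0)"
    unfolding pairing_superset[OF fin supp_mult_subset[OF T U]]
      KS_mult_apply[OF KA_supp[OF T] order_refl KA_supp[OF U] order_refl] sum_distrib_right
    by (intro sum.cong refl) auto
  also have "\<dots> = (\<Sum>s\<in>supp T. \<Sum>t\<in>supp U. \<Sum>r\<in>?F. if s * t = r then pull t (T s) x * U t x * \<phi> r else 0)"
    by (subst sum.swap, rule sum.cong[OF refl], rule sum.swap)
  also have "\<dots> = (\<Sum>s\<in>supp T. \<Sum>t\<in>supp U. pull t (T s) x * U t x * \<phi> (s * t))"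
  proof (intro sum.cong refl)
    fix s t assume "s \<in> supp T" "t \<in> supp U"
    then have "s * t \<in> ?F" by auto
    then show "(\<Sum>r\<in>?F. if s * t = r then pull t (T s) x * U t x * \<phi> r else 0)
        = pull t (T s) x * U t x * \<phi> (s * t)"
      using fin by (simp only: sum.delta') simp
  qed
  also have "\<dots> = (\<Sum>t\<in>supp U. \<Sum>s\<in>supp T. pull t (T s) x * U t x * \<phi> (s * t))"
    by (rule sum.swap)
  also have "\<dots> = (\<Sum>t\<in>supp U. U t x * pull t (pairing T (\<lambda>s. \<phi> (s * t))) x)"
  proof (intro sum.cong refl)
    fix t
    show "(\<Sum>s\<in>supp T. pull t (T s) x * U t x * \<phi> (s * t)) = U t x * pull t (pairing T (\<lambda>s. \<phi> (s * t))) x"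
      by (cases "\<theta> t x") (simp_all add: pull_def pairing_def sum_distrib_left mult_ac)
  qed
  finally show ?thesis .
qed

lemma KS_mult_closed:
  assumes T: "T \<in> KA" and U: "U \<in> KA"
  shows "T \<odot> U \<in> KA"
  unfolding KA_iff
proof (intro conjI allI finite_supp_mult T U)
  fix r
  have summand: "(\<lambda>x. pull t (T s) x * U t x) \<in> C0_on X (act_dom \<theta> ((s * t)\<^sup>\<star> * (s * t)))" for s t
  proof -
    have "pull (t\<^sup>\<star>) (U t) \<in> C0_on X {y. \<exists>x\<in>act_dom \<theta> (t\<^sup>\<star> * t). \<theta> (t\<^sup>\<star>) y = Some x}"
      using C0_on_pullback[OF KA_C0[OF U, of t], of "t\<^sup>\<star>"] by (simp add: pull_eq sinv_sinv)
    also have "{y. \<exists>x\<in>act_dom \<theta> (t\<^sup>\<star> * t). \<theta> (t\<^sup>\<star>) y = Some x} = act_dom \<theta> (t * t\<^sup>\<star>)"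
      unfolding set_eq_iff mem_Collect_eq act_sinv_iff mem_act_dom_range Bex_def mem_act_dom_source
      by blast
    finally have "(\<lambda>y. T s y * pull (t\<^sup>\<star>) (U t) y) \<in> C0_on X (act_dom \<theta> (s\<^sup>\<star> * s) \<inter> act_dom \<theta> (t * t\<^sup>\<star>))"
      by (rule C0_on_mult[OF Hausdorff KA_C0[OF T]])
    then have "pull t (\<lambda>y. T s y * pull (t\<^sup>\<star>) (U t) y) \<in>
        C0_on X {x. \<exists>y\<in>act_dom \<theta> (s\<^sup>\<star> * s) \<inter> act_dom \<theta> (t * t\<^sup>\<star>). \<theta> t x = Some y}"
      unfolding pull_eq[of t] by (rule C0_on_pullback) auto
    also have "{x. \<exists>y\<in>act_dom \<theta> (s\<^sup>\<star> * s) \<inter> act_dom \<theta> (t * t\<^sup>\<star>). \<theta> t x = Some y}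
        = act_dom \<theta> ((s * t)\<^sup>\<star> * (s * t))"
      by (auto simp: mem_act_dom_source mem_act_dom_range act_mult[of s t] map_comp_def split: option.splits)
    finally show ?thesis by (simp add: pull_mult_pull[abs_def])
  qed
  have "(\<lambda>x. \<Sum>s\<in>supp T. \<Sum>t\<in>supp U. if s * t = r then pull t (T s) x * U t x else 0)
      \<in> C0_on X (act_dom \<theta> (r\<^sup>\<star> * r))"
  proof (intro C0_on_sum KA_supp T U)
    fix s t
    show "(\<lambda>x. if s * t = r then pull t (T s) x * U t x else 0) \<in> C0_on X (act_dom \<theta> (r\<^sup>\<star> * r))"
      using summand[where s = s and t = t] by (cases "s * t = r") simp_all
  qed
  then show "(T \<odot> U) r \<in> C0_on X (act_dom \<theta> (r\<^sup>\<star> * r))"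
    by (simp add: KS_mult_apply[OF KA_supp[OF T] order_refl KA_supp[OF U] order_refl, abs_def])
qed

lemma KS_mult_assoc:
  assumes T: "T \<in> KA" and U: "U \<in> KA" and V: "V \<in> KA"
  shows "T \<odot> U \<odot> V = T \<odot> (U \<odot> V)"
proof (rule pairing_eqI)
  have TU: "T \<odot> U \<in> KA" and UV: "U \<odot> V \<in> KA" using T U V by (auto intro: KS_mult_closed)
  show "finite (supp (T \<odot> U \<odot> V))" "finite (supp (T \<odot> (U \<odot> V)))"
    using TU UV T V by (auto intro: finite_supp_mult)
  fix \<phi> x
  let ?\<psi> = "\<lambda>w. pull w (pairing T (\<lambda>s. \<phi> (s * w))) x"
  have "pairing (T \<odot> (U \<odot> V)) \<phi> x = pairing (U \<odot> V) ?\<psi> x"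
    unfolding pairing_mult[OF T UV] by (simp add: pairing_def)
  also have "\<dots> = (\<Sum>v\<in>supp V. V v x * pull v (pairing U (\<lambda>t. ?\<psi> (t * v))) x)"
    by (rule pairing_mult[OF U V])
  also have "\<dots> = (\<Sum>v\<in>supp V. V v x * pull v (pairing (T \<odot> U) (\<lambda>q. \<phi> (q * v))) x)"
  proof (intro sum.cong refl)
    fix v
    show "V v x * pull v (pairing U (\<lambda>t. ?\<psi> (t * v))) x =
        V v x * pull v (pairing (T \<odot> U) (\<lambda>q. \<phi> (q * v))) x"
    proof (cases "\<theta> v x")
      case (Some y)
      have "pull (t * v) f x = pull t f y" for t f
        using Some by (simp flip: pull_pull) (simp add: pull_def)
      then show ?thesis
        using Some by (simp add: pull_def[of v] pairing_mult[OF T U] pairing_def[of U] mult.assoc)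
    qed (simp add: pull_def)
  qed
  also have "\<dots> = pairing (T \<odot> U \<odot> V) \<phi> x" by (rule pairing_mult[OF TU V, symmetric])
  finally show "pairing (T \<odot> U \<odot> V) \<phi> x = pairing (T \<odot> (U \<odot> V)) \<phi> x" by simp
qed

lemma supp_star: "supp (KS_star T) \<subseteq> sinv ` supp T"
proof
  fix r assume "r \<in> supp (KS_star T)"
  then have "r\<^sup>\<star> \<in> supp T"
    by (auto simp: supp_def KS_star_apply[abs_def] pull_def fun_eq_iff split: option.splits)
  then show "r \<in> sinv ` supp T" by (rule image_eqI[rotated]) (simp add: sinv_sinv)
qed

lemma KS_star_closed:
  assumes T: "T \<in> KA"
  shows "KS_star T \<in> KA"
  unfolding KA_iff
proof (intro conjI allI)
  show "finite (supp (KS_star T))"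
    using supp_star[of T] KA_supp[OF T] by (meson finite_imageI finite_subset)
  fix r
  have "(\<lambda>y. cnj (T (r\<^sup>\<star>) y)) \<in> C0_on X (act_dom \<theta> (r * r\<^sup>\<star>))"
    using C0_on_cnj[OF KA_C0[OF T, of "r\<^sup>\<star>"]] by (simp add: sinv_sinv)
  then have "pull r (\<lambda>y. cnj (T (r\<^sup>\<star>) y)) \<in> C0_on X {x. \<exists>y\<in>act_dom \<theta> (r * r\<^sup>\<star>). \<theta> r x = Some y}"
    unfolding pull_eq[of r] by (rule C0_on_pullback) auto
  also have "{x. \<exists>y\<in>act_dom \<theta> (r * r\<^sup>\<star>). \<theta> r x = Some y} = act_dom \<theta> (r\<^sup>\<star> * r)"
    unfolding set_eq_iff mem_Collect_eq mem_act_dom_range Bex_def mem_act_dom_source by blast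
  finally show "KS_star T r \<in> C0_on X (act_dom \<theta> (r\<^sup>\<star> * r))"
    by (simp add: KS_star_apply[abs_def])
qed

lemma KS_star_star:
  assumes T: "T \<in> KA"
  shows "KS_star (KS_star T) = T"
proof (intro ext)
  fix r x
  show "KS_star (KS_star T) r x = T r x"
    by (cases "\<theta> r x") (simp_all add: KS_star_apply pull_def act_sinv sinv_sinv KA_off[OF T])
qed

lemma KS_star_mult:
  assumes T: "T \<in> KA" and U: "U \<in> KA"
  shows "KS_star (T \<odot> U) = KS_star U \<odot> KS_star T"
proof (intro ext)
  fix r x
  have inj: "inj_on (sinv :: 's \<Rightarrow> 's) B" for B
    by (rule inj_on_inverseI[where g = sinv]) (simp add: sinv_sinv)
  have "(KS_star U \<odot> KS_star T) r x =
      (\<Sum>u'\<in>sinv ` supp U. \<Sum>s'\<in>sinv ` supp T.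
        if u' * s' = r then pull s' (KS_star U u') x * KS_star T s' x else 0)"
    by (rule KS_mult_apply) (use KA_supp[OF T] KA_supp[OF U] supp_star in auto)
  also have "\<dots> = (\<Sum>u\<in>supp U. \<Sum>s\<in>supp T.
      if u\<^sup>\<star> * s\<^sup>\<star> = r then pull (s\<^sup>\<star>) (KS_star U (u\<^sup>\<star>)) x * KS_star T (s\<^sup>\<star>) x else 0)"
    by (simp add: sum.reindex[OF inj])
  also have "\<dots> = (\<Sum>u\<in>supp U. \<Sum>s\<in>supp T.
      if s * u = r\<^sup>\<star> then pull r (\<lambda>z. cnj (pull u (T s) z * U u z)) x else 0)"
  proof (intro sum.cong refl if_cong)
    fix u s
    show eq: "u\<^sup>\<star> * s\<^sup>\<star> = r \<longleftrightarrow> s * u = r\<^sup>\<star>"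
      by (metis sinv_mult sinv_sinv)
    assume "s * u = r\<^sup>\<star>"
    then have r: "r = u\<^sup>\<star> * s\<^sup>\<star>" using eq by simp
    show "pull (s\<^sup>\<star>) (KS_star U (u\<^sup>\<star>)) x * KS_star T (s\<^sup>\<star>) x =
        pull r (\<lambda>z. cnj (pull u (T s) z * U u z)) x"
    proof (cases "\<theta> (s\<^sup>\<star>) x")
      case None
      then show ?thesis by (simp add: r act_mult map_comp_def pull_def)
    next
      case (Some y)
      then have rx: "\<theta> r x = \<theta> (u\<^sup>\<star>) y" by (simp add: r act_mult map_comp_def)
      show ?thesis
      proof (cases "\<theta> (u\<^sup>\<star>) y")
        case None
        then show ?thesis using Some rx by (simp add: KS_star_apply pull_def)
      next
        case z: (Some z)
        then have "\<theta> u z = Some y" by (simp add: act_sinv_iff)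
        then show ?thesis using Some rx z by (simp add: KS_star_apply pull_def sinv_sinv)
      qed
    qed
  qed
  also have "\<dots> = pull r (\<lambda>z. cnj (\<Sum>u\<in>supp U. \<Sum>s\<in>supp T.
      if s * u = r\<^sup>\<star> then pull u (T s) z * U u z else 0)) x"
    by (cases "\<theta> r x") (simp_all add: pull_def[of r] if_distrib[of cnj] cong: if_cong)
  also have "\<dots> = KS_star (T \<odot> U) r x"
    unfolding KS_star_apply KS_mult_apply[OF KA_supp[OF T] order_refl KA_supp[OF U] order_refl]
    by (subst sum.swap) (rule refl)
  finally show "KS_star (T \<odot> U) r x = (KS_star U \<odot> KS_star T) r x" by simp
qed

lemma supp_add: "supp (T + U) \<subseteq> supp T \<union> supp (U :: 's \<Rightarrow> 'x \<Rightarrow> complex)"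
  by (auto simp: supp_def fun_eq_iff)

lemma supp_scale: "supp (KS_scale c T) \<subseteq> supp T"
  by (auto simp: supp_def KS_scale_apply[abs_def] fun_eq_iff)

lemma KS_add_closed: "T \<in> KA \<Longrightarrow> U \<in> KA \<Longrightarrow> T + U \<in> KA"
  using finite_subset[OF supp_add[of T U]] by (simp add: KA_iff C0_on_add plus_fun_def)

lemma KS_scale_closed: "T \<in> KA \<Longrightarrow> KS_scale c T \<in> KA"
  using finite_subset[OF supp_scale[of c T]] by (simp add: KA_iff C0_on_cmult KS_scale_apply[abs_def])

sublocale KS: star_algebra_laws "KS_alg X \<theta>" KA KS_scale KS_mult KS_star
proof
  show "alg_add (KS_alg X \<theta>) = (+)" by (rule KS_add)
  show "0 \<in> KA" by (simp add: KA_iff supp_def zero_fun_def)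
  fix T U V :: "'s \<Rightarrow> 'x \<Rightarrow> complex" and c d :: complex
  show "KS_scale c (T + U) = KS_scale c T + KS_scale c U" "KS_scale (c + d) T = KS_scale c T + KS_scale d T"
    "KS_scale c (KS_scale d T) = KS_scale (c * d) T" "KS_scale 1 T = T"
    by (simp_all add: fun_eq_iff KS_scale_apply algebra_simps)
  assume T: "T \<in> KA"
  show "KS_scale c T \<in> KA" "KS_star T \<in> KA" "KS_star (KS_star T) = T"
    using T by (simp_all add: KS_scale_closed KS_star_closed KS_star_star)
  show "KS_star (KS_scale c T) = KS_scale (cnj c) (KS_star T)"
    by (simp add: fun_eq_iff KS_star_apply KS_scale_apply pull_def split: option.split)
  assume U: "U \<in> KA"
  show "T + U \<in> KA" "T \<odot> U \<in> KA" using T U by (simp_all add: KS_add_closed KS_mult_closed)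
  show "KS_star (T + U) = KS_star T + KS_star U"
    by (simp add: fun_eq_iff KS_star_apply pull_def split: option.split)
  show "KS_star (T \<odot> U) = KS_star U \<odot> KS_star T" by (rule KS_star_mult[OF T U])
  note T' = KA_supp[OF T] and U' = KA_supp[OF U]
  note sc = order_trans[OF supp_scale]
  show "KS_scale c T \<odot> U = KS_scale c (T \<odot> U)"
  proof (intro ext)
    fix r x
    show "(KS_scale c T \<odot> U) r x = KS_scale c (T \<odot> U) r x"
      unfolding KS_scale_apply KS_mult_apply[OF T' order_refl U' order_refl]
        KS_mult_apply[OF T' supp_scale U' order_refl]
      by (auto simp: sum_distrib_left KS_scale_apply[abs_def] pull_def intro!: sum.cong split: option.split)
  qed
  show "T \<odot> KS_scale c U = KS_scale c (T \<odot> U)"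
  proof (intro ext)
    fix r x
    show "(T \<odot> KS_scale c U) r x = KS_scale c (T \<odot> U) r x"
      unfolding KS_scale_apply KS_mult_apply[OF T' order_refl U' order_refl]
        KS_mult_apply[OF T' order_refl U' supp_scale]
      by (auto simp: sum_distrib_left KS_scale_apply[abs_def] intro!: sum.cong)
  qed
  assume V: "V \<in> KA"
  note V' = KA_supp[OF V]
  show "T \<odot> U \<odot> V = T \<odot> (U \<odot> V)" by (rule KS_mult_assoc[OF T U V])
  have fin: "finite (supp T \<union> supp U)" "finite (supp U \<union> supp V)" using T' U' V' by simp_all
  show "(T + U) \<odot> V = T \<odot> V + U \<odot> V"
  proof (intro ext)
    fix r x
    have eq: "(W \<odot> V) r x = (\<Sum>s\<in>supp T \<union> supp U. \<Sum>t\<in>supp V.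
        if s * t = r then pull t (W s) x * V t x else 0)" if "supp W \<subseteq> supp T \<union> supp U" for W
      by (rule KS_mult_apply[OF fin(1) that V' order_refl])
    show "((T + U) \<odot> V) r x = (T \<odot> V + U \<odot> V) r x"
      unfolding plus_fun_apply eq[OF supp_add] eq[OF Un_upper1] eq[OF Un_upper2] sum.distrib[symmetric]
      by (intro sum.cong refl) (auto simp: pull_def algebra_simps split: option.split)
  qed
  show "T \<odot> (U + V) = T \<odot> U + T \<odot> V"
  proof (intro ext)
    fix r x
    have eq: "(T \<odot> W) r x = (\<Sum>s\<in>supp T. \<Sum>t\<in>supp U \<union> supp V.
        if s * t = r then pull t (T s) x * W t x else 0)" if "supp W \<subseteq> supp U \<union> supp V" for W
      by (rule KS_mult_apply[OF T' order_refl fin(2) that])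
    show "(T \<odot> (U + V)) r x = (T \<odot> U + T \<odot> V) r x"
      unfolding plus_fun_apply eq[OF supp_add] eq[OF Un_upper1] eq[OF Un_upper2] sum.distrib[symmetric]
      by (intro sum.cong refl) (auto simp: algebra_simps)
  qed
qed simp_all

end

section \<open>C*-seminorms on the crossed product\<close>

context star_algebra_laws
begin

text \<open>Squaring is monotone and continuous on nonnegative numbers, so that a pointwise supremum of
  C*-seminorms inherits the C*-identity.\<close>

lemma cstar_seminorm_max:
  assumes bound: "\<And>x. x \<in> A \<Longrightarrow> \<exists>B. \<forall>p. cstar_seminorm R p \<longrightarrow> p x \<le> B"
  shows "cstar_seminorm R (max_cstar_seminorm R)"
    and "cstar_seminorm R p \<Longrightarrow> x \<in> A \<Longrightarrow> p x \<le> max_cstar_seminorm R x"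
proof -
  let ?M = "max_cstar_seminorm R" and ?Q = "{p. cstar_seminorm R p}"
  have "cstar_seminorm R (\<lambda>_. 0)" by (simp add: cstar_seminorm_def)
  then have ne: "?Q \<noteq> {}" by blast
  have upper: "p x \<le> ?M x" if p: "cstar_seminorm R p" and x: "x \<in> A" for p x
  proof -
    have "bdd_above ((\<lambda>p. p x) ` ?Q)" using bound[OF x] by (auto simp: bdd_above_def)
    then show ?thesis unfolding max_cstar_seminorm_def by (rule cSUP_upper[rotated]) (use p in simp)
  qed
  show "cstar_seminorm R p \<Longrightarrow> x \<in> A \<Longrightarrow> p x \<le> ?M x" by (rule upper)
  have least: "?M x \<le> B" if "\<And>p. cstar_seminorm R p \<Longrightarrow> p x \<le> B" for x B
    unfolding max_cstar_seminorm_def by (rule cSUP_least[OF ne]) (use that in simp)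
  have nonneg: "0 \<le> ?M x" if "x \<in> A" for x
    using upper[OF \<open>cstar_seminorm R (\<lambda>_. 0)\<close> that] .
  have S: "cstar_seminormed R A sc (\<otimes>) star p" if "cstar_seminorm R p" for p
    by (intro cstar_seminormed.intro cstar_seminormed_axioms.intro that) unfold_locales
  have scale_le: "?M (sc c x) \<le> cmod c * ?M x" if x: "x \<in> A" for c x
  proof (rule least)
    fix p assume p: "cstar_seminorm R p"
    show "p (sc c x) \<le> cmod c * ?M x"
      using cstar_seminormed.norm_scale[OF S[OF p] x, of c] upper[OF p x] by (simp add: mult_left_mono)
  qed
  show "cstar_seminorm R ?M"
    unfolding cstar_seminorm_def carrier scale add mult star
  proof (intro conjI ballI allI)
    fix x c assume x: "x \<in> A"
    show "0 \<le> ?M x" by (rule nonneg[OF x])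
    show "?M (sc c x) = cmod c * ?M x"
    proof (cases "c = 0")
      case True
      then show ?thesis using scale_le[OF x, of 0] nonneg[of "sc c x"] x by simp
    next
      case False
      have "?M x \<le> cmod (inverse c) * ?M (sc c x)"
        using scale_le[of "sc c x" "inverse c"] x False by simp
      then have "cmod c * ?M x \<le> ?M (sc c x)"
        using False by (simp add: norm_inverse norm_divide field_simps)
      with scale_le[OF x, of c] show ?thesis by simp
    qed
    show "?M (star x \<otimes> x) = (?M x)\<^sup>2"
    proof (rule antisym)
      show "?M (star x \<otimes> x) \<le> (?M x)\<^sup>2"
      proof (rule least)
        fix p assume p: "cstar_seminorm R p"
        show "p (star x \<otimes> x) \<le> (?M x)\<^sup>2"
          unfolding cstar_seminormed.norm_cstar[OF S[OF p] x]
          by (rule power_mono[OF upper[OF p x] cstar_seminormed.norm_nonneg[OF S[OF p] x]])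
      qed
      have "?M x \<le> sqrt (?M (star x \<otimes> x))"
      proof (rule least)
        fix p assume p: "cstar_seminorm R p"
        have "(p x)\<^sup>2 \<le> ?M (star x \<otimes> x)"
          using upper[OF p, of "star x \<otimes> x"] cstar_seminormed.norm_cstar[OF S[OF p] x] x by simp
        then show "p x \<le> sqrt (?M (star x \<otimes> x))" by (rule real_le_rsqrt)
      qed
      then have "(?M x)\<^sup>2 \<le> (sqrt (?M (star x \<otimes> x)))\<^sup>2" by (rule power_mono) (rule nonneg[OF x])
      then show "(?M x)\<^sup>2 \<le> ?M (star x \<otimes> x)" using nonneg[of "star x \<otimes> x"] x by simp
    qed
  next
    fix x y assume x: "x \<in> A" and y: "y \<in> A"
    show "?M (x + y) \<le> ?M x + ?M y"
    proof (rule least)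
      fix p assume p: "cstar_seminorm R p"
      show "p (x + y) \<le> ?M x + ?M y"
        using cstar_seminormed.norm_add[OF S[OF p] x y] upper[OF p x] upper[OF p y] by linarith
    qed
    show "?M (x \<otimes> y) \<le> ?M x * ?M y"
    proof (rule least)
      fix p assume p: "cstar_seminorm R p"
      have "p x * p y \<le> ?M x * ?M y"
        by (rule mult_mono[OF upper[OF p x] upper[OF p y] nonneg[OF x]])
          (rule cstar_seminormed.norm_nonneg[OF S[OF p] y])
      then show "p (x \<otimes> y) \<le> ?M x * ?M y"
        using cstar_seminormed.norm_mult_le[OF S[OF p] x y] by linarith
    qed
  qed
qed

end

lemma supp_delta: "supp (delta s a) \<subseteq> {s}"
  by (auto simp: supp_def delta_def)

context locally_compact_action
begin

lemma delta_closed: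
  assumes "a \<in> C0_on X (act_dom \<theta> (s\<^sup>\<star> * s))"
  shows "delta s a \<in> KA"
  using assms finite_subset[OF supp_delta] by (auto simp: KA_iff delta_def)

lemma delta_idempotent_closed:
  "e \<in> idempotents \<Longrightarrow> a \<in> C0_on X (act_dom \<theta> e) \<Longrightarrow> delta e a \<in> KA"
  by (rule delta_closed) (simp add: sinv_idempotent idempotents_iff)

lemma delta_add: "delta s a + delta s b = delta s (\<lambda>x. a x + b x)"
  and delta_scale: "KS_scale c (delta s a) = delta s (\<lambda>x. c * a x)"
  and delta_zero: "delta s (\<lambda>_. 0) = 0"
  by (auto simp: delta_def fun_eq_iff KS_scale_apply)

lemma pull_idempotent: "e \<in> idempotents \<Longrightarrow> pull e f x = (if x \<in> act_dom \<theta> e then f x else 0)"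
  by (auto simp: pull_def act_dom_def dest: act_idempotent split: option.split)

lemma delta_mult_idempotent:
  assumes f: "f \<in> idempotents" and b: "b \<in> C0_on X (act_dom \<theta> f)"
  shows "delta e a \<odot> delta f b = delta (e * f) (\<lambda>x. a x * b x)"
proof -
  have "pull f (\<lambda>y. a y * pull (f\<^sup>\<star>) b y) = (\<lambda>x. a x * b x)"
    unfolding pull_mult_pull[abs_def] using C0_on_off[OF b] by (auto simp: pull_idempotent[OF f])
  then show ?thesis unfolding KS_mult_delta act_fun_eq_pull' sinv_sinv by simp
qed

lemma delta_star_idempotent:
  assumes e: "e \<in> idempotents" and a: "a \<in> C0_on X (act_dom \<theta> e)"
  shows "KS_star (delta e a) = delta e (\<lambda>x. cnj (a x))"
proof -
  have "pull e (\<lambda>y. cnj (a y)) = (\<lambda>x. cnj (a x))"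
    using C0_on_off[OF a] by (auto simp: pull_idempotent[OF e])
  then show ?thesis
    unfolding KS_star_delta act_fun_eq_pull' by (simp add: sinv_idempotent[OF e])
qed

lemma delta_star_mult_self:
  assumes a: "a \<in> C0_on X (act_dom \<theta> (s\<^sup>\<star> * s))"
  shows "KS_star (delta s a) \<odot> delta s a = delta (s\<^sup>\<star> * s) (\<lambda>x. complex_of_real ((cmod (a x))\<^sup>2))"
proof -
  have "pull s (\<lambda>y. pull (s\<^sup>\<star>) (\<lambda>y. cnj (a y)) y * pull (s\<^sup>\<star>) a y) = (\<lambda>x. complex_of_real ((cmod (a x))\<^sup>2))"
  proof
    fix x
    show "pull s (\<lambda>y. pull (s\<^sup>\<star>) (\<lambda>y. cnj (a y)) y * pull (s\<^sup>\<star>) a y) x = complex_of_real ((cmod (a x))\<^sup>2)"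
    proof (cases "\<theta> s x")
      case None
      then have "a x = 0" by (intro C0_on_off[OF a]) (simp add: mem_act_dom_source)
      then show ?thesis using None by (simp add: pull_def)
    next
      case (Some y)
      then show ?thesis by (simp add: pull_def act_sinv complex_norm_square[symmetric] mult.commute)
    qed
  qed
  then show ?thesis unfolding KS_star_delta KS_mult_delta act_fun_eq_pull' sinv_sinv by simp
qed

lemma delta_decomposition:
  assumes "finite F" "\<And>s. s \<in> F \<Longrightarrow> T s \<in> C0_on X (act_dom \<theta> (s\<^sup>\<star> * s))"
  shows "(\<Sum>s\<in>F. delta s (T s)) \<in> KA"
    and "(\<Sum>s\<in>F. delta s (T s)) r x = (if r \<in> F then T r x else 0)"
proof -
  show "(\<Sum>s\<in>F. delta s (T s)) \<in> KA"
    using assms by (induction F rule: finite_induct) (simp_all add: delta_closed)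
  show "(\<Sum>s\<in>F. delta s (T s)) r x = (if r \<in> F then T r x else 0)"
    using assms(1) by (induction F rule: finite_induct) (auto simp: delta_def)
qed

lemma KA_decomposition:
  assumes T: "T \<in> KA"
  shows "T = (\<Sum>s\<in>supp T. delta s (T s))"
  using delta_decomposition(2)[OF KA_supp[OF T] KA_C0[OF T]] not_supp by (intro ext) auto

end

locale KS_seminorm = locally_compact_action X \<theta> + KS: cstar_seminormed "KS_alg X \<theta>" KA KS_scale KS_mult KS_star p
  for X :: "'x topology" and \<theta> :: "'s::inverse_semigroup \<Rightarrow> 'x \<rightharpoonup> 'x" and p
begin

text \<open>By the C*-identity, \<open>p (\<delta>\<^sub>e d)\<close> depends only on the modulus of \<open>d\<close>. Hence multiplication by a
  unimodular function is isometric, and multiplication by its real part \<open>b\<close> is contractive. For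
  \<open>d = b\<close> this says \<open>p (\<delta>\<^sub>e b)\<^sup>2 \<le> p (\<delta>\<^sub>e b)\<close>, which is how the supremum norm comes to bound \<open>p\<close>.\<close>

lemma norm_delta_modulus:
  assumes e: "e \<in> idempotents" and d: "d \<in> C0_on X (act_dom \<theta> e)" "d' \<in> C0_on X (act_dom \<theta> e)"
    and eq: "\<And>x. cmod (d x) = cmod (d' x)"
  shows "p (delta e d) = p (delta e d')"
proof -
  have ee: "e\<^sup>\<star> * e = e" using e by (simp add: sinv_idempotent idempotents_iff)
  have "(p (delta e d))\<^sup>2 = (p (delta e d'))\<^sup>2"
    using d eq KS.norm_cstar[OF delta_idempotent_closed[OF e d(1)]]
      KS.norm_cstar[OF delta_idempotent_closed[OF e d(2)]]
    by (simp add: delta_star_mult_self ee)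
  then show ?thesis using delta_idempotent_closed[OF e] d by simp
qed

lemma norm_delta_real_mult:
  assumes e: "e \<in> idempotents" and d: "d \<in> C0_on X (act_dom \<theta> e)"
    and b: "(\<lambda>x. complex_of_real (b x)) \<in> C0_on X (act_dom \<theta> e)" and b1: "\<And>x. \<bar>b x\<bar> \<le> 1"
  shows "p (delta e (\<lambda>x. complex_of_real (b x) * d x)) \<le> p (delta e d)"
proof -
  \<comment> \<open>\<open>b\<close> is the real part of \<open>w = b + i \<surd>(1 - b\<^sup>2)\<close>. As \<open>h\<close> vanishes at \<open>0\<close>, the function \<open>h \<circ> b\<close> vanishes
    at infinity, and with it \<open>w d\<close>.\<close>
  define h where "h z = complex_of_real (1 - sqrt \<bar>1 - (cmod z)\<^sup>2\<bar>)" for z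
  have h: "(\<lambda>x. h (complex_of_real (b x))) \<in> C0_on X (act_dom \<theta> e)"
    by (rule C0_on_comp[OF b]) (auto simp: h_def intro!: continuous_intros)
  have hb: "h (complex_of_real (b x)) = 1 - complex_of_real (sqrt (1 - (b x)\<^sup>2))" for x
    using b1[of x] by (simp add: h_def abs_square_le_1)
  define w where "w x = Complex (b x) (sqrt (1 - (b x)\<^sup>2))" for x
  have w1: "cmod (w x) = 1" for x using b1[of x] by (simp add: w_def cmod_def abs_square_le_1)
  have w_eq: "w x = complex_of_real (b x) + \<i> * (1 - h (complex_of_real (b x)))" for x
    unfolding hb by (simp add: w_def complex_eq_iff)
  have bd: "(\<lambda>x. complex_of_real (b x) * d x) \<in> C0_on X (act_dom \<theta> e)"
    and hd: "(\<lambda>x. h (complex_of_real (b x)) * d x) \<in> C0_on X (act_dom \<theta> e)"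
    using C0_on_mult[OF Hausdorff b d] C0_on_mult[OF Hausdorff h d] by auto
  have wd: "(\<lambda>x. w x * d x) \<in> C0_on X (act_dom \<theta> e)"
  proof -
    have "(\<lambda>x. complex_of_real (b x) * d x + \<i> * (d x + (-1) * (h (complex_of_real (b x)) * d x)))
        \<in> C0_on X (act_dom \<theta> e)"
      by (intro C0_on_add C0_on_cmult bd hd d)
    then show ?thesis unfolding w_eq by (simp add: algebra_simps)
  qed
  have wd': "(\<lambda>x. cnj (w x) * d x) \<in> C0_on X (act_dom \<theta> e)"
  proof -
    have "(\<lambda>x. 2 * (complex_of_real (b x) * d x) + (-1) * (w x * d x)) \<in> C0_on X (act_dom \<theta> e)"
      by (intro C0_on_add C0_on_cmult bd wd)
    moreover have "(\<lambda>x. 2 * (complex_of_real (b x) * d x) + (-1) * (w x * d x)) = (\<lambda>x. cnj (w x) * d x)"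
      by (intro ext) (simp add: w_def complex_eq_iff)
    ultimately show ?thesis by simp
  qed
  have eq: "delta e (\<lambda>x. complex_of_real (b x) * d x) =
      KS_scale (1 / 2) (delta e (\<lambda>x. w x * d x) + delta e (\<lambda>x. cnj (w x) * d x))"
  proof -
    have "(\<lambda>x. complex_of_real (b x) * d x) = (\<lambda>x. 1 / 2 * (w x * d x + cnj (w x) * d x))"
      by (intro ext) (simp add: w_def complex_eq_iff)
    then show ?thesis unfolding delta_add delta_scale by (rule arg_cong)
  qed
  note cl = delta_idempotent_closed[OF e wd] delta_idempotent_closed[OF e wd']
  have "p (delta e (\<lambda>x. complex_of_real (b x) * d x))
      \<le> 1 / 2 * (p (delta e (\<lambda>x. w x * d x)) + p (delta e (\<lambda>x. cnj (w x) * d x)))"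
    unfolding eq using KS.norm_add[OF cl] cl by (simp add: KS.norm_scale)
  also have "p (delta e (\<lambda>x. w x * d x)) = p (delta e d)"
    by (rule norm_delta_modulus[OF e wd d]) (simp add: norm_mult w1)
  also have "p (delta e (\<lambda>x. cnj (w x) * d x)) = p (delta e d)"
    by (rule norm_delta_modulus[OF e wd' d]) (simp add: norm_mult w1)
  finally show ?thesis by simp
qed

lemma norm_delta_real_le_one:
  assumes e: "e \<in> idempotents"
    and b: "(\<lambda>x. complex_of_real (b x)) \<in> C0_on X (act_dom \<theta> e)" and b1: "\<And>x. \<bar>b x\<bar> \<le> 1"
  shows "p (delta e (\<lambda>x. complex_of_real (b x))) \<le> 1"
proof -
  let ?y = "delta e (\<lambda>x. complex_of_real (b x))"
  have y: "?y \<in> KA" by (rule delta_idempotent_closed[OF e b])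
  have ee: "e\<^sup>\<star> * e = e" using e by (simp add: sinv_idempotent idempotents_iff)
  have "(p ?y)\<^sup>2 = p (delta e (\<lambda>x. complex_of_real (b x) * complex_of_real (b x)))"
    unfolding KS.norm_cstar[OF y, symmetric]
    using delta_star_mult_self[of "\<lambda>x. complex_of_real (b x)" e] b ee by (simp add: power2_eq_square)
  also have "\<dots> \<le> p ?y" by (rule norm_delta_real_mult[OF e b b b1])
  finally have "p ?y * p ?y \<le> 1 * p ?y" by (simp add: power2_eq_square)
  then show ?thesis
    using KS.norm_nonneg[OF y] by (cases "p ?y = 0") (auto dest: mult_right_le_imp_le)
qed

text \<open>By the C*-identity, the bound for \<open>\<delta>\<^sub>s a\<close> follows from the one for the real function \<open>\<bar>a\<bar>\<^sup>2 / B\<^sup>2\<close> at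
  the idempotent \<open>s\<^sup>* s\<close>.\<close>

lemma norm_delta_le:
  assumes a: "a \<in> C0_on X (act_dom \<theta> (s\<^sup>\<star> * s))" and B: "B \<ge> 0" "\<And>x. cmod (a x) \<le> B"
  shows "p (delta s a) \<le> B"
proof -
  have *: "p (delta s a) \<le> B" if "B > 0" "\<And>x. cmod (a x) \<le> B" for B
  proof -
    let ?e = "s\<^sup>\<star> * s"
    define b where "b x = (cmod (a x) / B)\<^sup>2" for x
    have "(\<lambda>x. complex_of_real (b x)) \<in> C0_on X (act_dom \<theta> ?e)"
      unfolding b_def by (rule C0_on_comp[OF a]) (auto intro!: continuous_intros simp: \<open>B > 0\<close>[THEN less_imp_neq, symmetric])
    moreover have "\<bar>b x\<bar> \<le> 1" for x
      using that by (simp add: b_def power_le_one)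
    ultimately have b1: "p (delta ?e (\<lambda>x. complex_of_real (b x))) \<le> 1" and
        bA: "delta ?e (\<lambda>x. complex_of_real (b x)) \<in> KA"
      by (auto intro: norm_delta_real_le_one delta_idempotent_closed)
    have "KS_star (delta s a) \<odot> delta s a = KS_scale (complex_of_real (B\<^sup>2)) (delta ?e (\<lambda>x. complex_of_real (b x)))"
      unfolding delta_star_mult_self[OF a] delta_scale b_def using that(1)
      by (simp add: power_divide)
    then have "(p (delta s a))\<^sup>2 = B\<^sup>2 * p (delta ?e (\<lambda>x. complex_of_real (b x)))"
      using KS.norm_cstar[OF delta_closed[OF a]] KS.norm_scale[OF bA, of "complex_of_real (B\<^sup>2)"]
      unfolding norm_of_real by simp
    also have "\<dots> \<le> B\<^sup>2 * 1" by (rule mult_left_mono[OF b1]) simp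
    finally have "(p (delta s a))\<^sup>2 \<le> B\<^sup>2" by simp
    then show ?thesis by (rule power2_le_imp_le) (use that(1) in simp)
  qed
  show ?thesis
  proof (rule field_le_epsilon)
    fix \<epsilon> :: real assume "\<epsilon> > 0"
    then show "p (delta s a) \<le> B + \<epsilon>"
      by (intro *) (use B(1) order_trans[OF B(2)] in auto)
  qed
qed

text \<open>\<open>1 - a\<close> is the real part of the unitary \<open>1 - a + i \<surd>(1 - (1 - a)\<^sup>2)\<close> over the unitization.\<close>

lemma norm_one_minus_delta:
  assumes f: "f \<in> idempotents" and a: "(\<lambda>x. complex_of_real (a x)) \<in> C0_on X (act_dom \<theta> f)"
    and a01: "\<And>x. 0 \<le> a x" "\<And>x. a x \<le> 1" and T: "T \<in> KA"
  shows "p (T - delta f (\<lambda>x. complex_of_real (a x)) \<odot> T) \<le> p T"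
proof -
  define h where "h z = \<i> * complex_of_real (sqrt \<bar>1 - (1 - cmod z)\<^sup>2\<bar>)" for z
  have h: "(\<lambda>x. h (complex_of_real (a x))) \<in> C0_on X (act_dom \<theta> f)"
    by (rule C0_on_comp[OF a]) (auto simp: h_def intro!: continuous_intros)
  have pos: "1 - (1 - a x)\<^sup>2 \<ge> 0" for x
    using a01[of x] by (simp add: abs_square_le_1)
  have ha: "h (complex_of_real (a x)) = \<i> * complex_of_real (sqrt (1 - (1 - a x)\<^sup>2))" for x
    using a01[of x] pos[of x] by (simp add: h_def)
  define c where "c x = (-1) * complex_of_real (a x) + h (complex_of_real (a x))" for x
  have c: "c \<in> C0_on X (act_dom \<theta> f)" unfolding c_def by (intro C0_on_add C0_on_cmult a h)
  have c': "(\<lambda>x. cnj (c x)) \<in> C0_on X (act_dom \<theta> f)" by (rule C0_on_cnj[OF c])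
  have c1: "c x + cnj (c x) = (-2) * complex_of_real (a x)" for x
    unfolding c_def ha by (simp add: complex_eq_iff)
  have c2: "c x + cnj (c x) + cnj (c x) * c x = 0" for x
    using pos[of x] unfolding c_def ha
    by (simp add: complex_eq_iff power2_eq_square algebra_simps)
  have ff: "f * f = f" using f by (simp add: idempotents_iff)
  let ?v = "delta f c"
  have v: "?v \<in> KA" by (rule delta_idempotent_closed[OF f c])
  have sv: "KS_star ?v = delta f (\<lambda>x. cnj (c x))" by (rule delta_star_idempotent[OF f c])
  have u1: "?v + KS_star ?v + KS_star ?v \<odot> ?v = 0"
    unfolding sv delta_mult_idempotent[OF f c] ff delta_add by (simp add: c2 delta_zero)
  have u2: "?v + KS_star ?v + ?v \<odot> KS_star ?v = 0"
    unfolding sv delta_mult_idempotent[OF f c'] ff delta_add using c2 by (simp add: mult.commute delta_zero)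
  have y: "delta f (\<lambda>x. complex_of_real (a x)) = KS_scale (- (1 / 2)) (?v + KS_star ?v)"
    unfolding sv delta_add delta_scale c1 by simp
  show ?thesis by (rule KS.norm_real_part_unitary[OF v u1 u2 T y])
qed

end

context locally_compact_action
begin

lemma KS_seminormI: "cstar_seminorm (KS_alg X \<theta>) p \<Longrightarrow> KS_seminorm X \<theta> p"
  by (rule KS_seminorm.intro[OF locally_compact_action_axioms
        cstar_seminormed.intro[OF KS.star_algebra_laws_axioms cstar_seminormed_axioms.intro]])

text \<open>The bound is the sum of the supremum norms of the components; it makes the supremum of all
  C*-seminorms finite.\<close>

lemma cstar_seminorm_bounded:
  assumes T: "T \<in> KA"
  shows "\<exists>B. \<forall>p. cstar_seminorm (KS_alg X \<theta>) p \<longrightarrow> p T \<le> B"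
proof -
  have "\<forall>s. \<exists>B\<ge>0. \<forall>x. cmod (T s x) \<le> B" using C0_on_bounded[OF KA_C0[OF T]] by (metis less_imp_le)
  then obtain B where B: "\<And>s. B s \<ge> 0" "\<And>s x. cmod (T s x) \<le> B s" by metis
  have "p T \<le> (\<Sum>s\<in>supp T. B s)" if p: "cstar_seminorm (KS_alg X \<theta>) p" for p
  proof -
    interpret KS_seminorm X \<theta> p by (rule KS_seminormI[OF p])
    have "p (\<Sum>s\<in>F. delta s (T s)) \<le> (\<Sum>s\<in>F. B s)" if "finite F" for F
      using that
    proof (induction F rule: finite_induct)
      case (insert s F)
      have "p (\<Sum>s\<in>insert s F. delta s (T s)) \<le> p (delta s (T s)) + p (\<Sum>s\<in>F. delta s (T s))"
        unfolding sum.insert[OF insert.hyps]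
        by (rule KS.norm_add[OF delta_closed[OF KA_C0[OF T]]
              delta_decomposition(1)[OF insert.hyps(1) KA_C0[OF T]]])
      also have "\<dots> \<le> B s + (\<Sum>s\<in>F. B s)"
        by (intro add_mono insert.IH norm_delta_le[OF KA_C0[OF T]] B)
      finally show ?case unfolding sum.insert[OF insert.hyps] .
    next
      case empty
      show ?case unfolding sum.empty KS.norm_zero by simp
    qed
    from this[OF KA_supp[OF T]] show ?thesis unfolding KA_decomposition[OF T, symmetric] .
  qed
  then show ?thesis by blast
qed

lemmas cstar_seminorm_max_KS = KS.cstar_seminorm_max(1)[OF cstar_seminorm_bounded]
  and cstar_seminorm_le_max = KS.cstar_seminorm_max(2)[OF cstar_seminorm_bounded]

end

section \<open>The reduced norm\<close>

subsection \<open>Hilbert modules over commutative algebras, fibrewise\<close>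

text \<open>All norms are read off from the partial sums \<open>\<Sum>\<^bsub>t \<in> F\<^esub> \<bar>\<eta>\<^sub>t(x)\<bar>\<^sup>2\<close> over finite sets \<open>F\<close> at single points \<open>x\<close>.\<close>

lemma l2_inner_self:
  assumes "\<And>F. finite F \<Longrightarrow> F \<subseteq> source_fibre e \<Longrightarrow> (\<Sum>t\<in>F. (cmod (\<eta> t x))\<^sup>2) \<le> M"
  shows "cmod (l2_inner e \<eta> \<eta> x) \<le> M"
    and "finite F \<Longrightarrow> F \<subseteq> source_fibre e \<Longrightarrow> (\<Sum>t\<in>F. (cmod (\<eta> t x))\<^sup>2) \<le> cmod (l2_inner e \<eta> \<eta> x)"
proof -
  let ?f = "\<lambda>t. (cmod (\<eta> t x))\<^sup>2"
  have "bdd_above (sum ?f ` {F. F \<subseteq> source_fibre e \<and> finite F})"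
    using assms by (intro bdd_aboveI[of _ M]) auto
  then have summ: "?f summable_on source_fibre e"
    by (intro nonneg_bdd_above_summable_on) auto
  then have "((\<lambda>t. complex_of_real (?f t)) has_sum complex_of_real (infsum ?f (source_fibre e))) (source_fibre e)"
    by (intro has_sum_of_real has_sum_infsum)
  then have "l2_inner e \<eta> \<eta> x = complex_of_real (infsum ?f (source_fibre e))"
    unfolding l2_inner_def complex_norm_square by (simp add: mult.commute infsumI)
  then have eq: "cmod (l2_inner e \<eta> \<eta> x) = infsum ?f (source_fibre e)"
    by (simp add: infsum_nonneg)
  show "cmod (l2_inner e \<eta> \<eta> x) \<le> M"
    unfolding eq by (rule infsum_le_finite_sums[OF summ]) (use assms in auto)
  show "finite F \<Longrightarrow> F \<subseteq> source_fibre e \<Longrightarrow> (\<Sum>t\<in>F. ?f t) \<le> cmod (l2_inner e \<eta> \<eta> x)"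
    unfolding eq by (rule finite_sum_le_infsum[OF summ]) auto
qed

lemma l2_norm_le:
  assumes "\<And>F x. finite F \<Longrightarrow> F \<subseteq> source_fibre e \<Longrightarrow> (\<Sum>t\<in>F. (cmod (\<eta> t x))\<^sup>2) \<le> C\<^sup>2" and C: "C \<ge> 0"
  shows "l2_norm e \<eta> \<le> C"
proof -
  have "sup_norm (l2_inner e \<eta> \<eta>) \<le> C\<^sup>2"
    unfolding sup_norm_def by (rule cSUP_least[OF UNIV_not_empty l2_inner_self(1)[OF assms(1)]])
  then show ?thesis unfolding l2_norm_def using C by (simp add: real_le_lsqrt)
qed

lemma partial_sum_le_l2_norm:
  assumes bound: "\<And>F x. finite F \<Longrightarrow> F \<subseteq> source_fibre e \<Longrightarrow> (\<Sum>t\<in>F. (cmod (\<eta> t x))\<^sup>2) \<le> M"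
    and norm: "l2_norm e \<eta> \<le> C" and F: "finite F" "F \<subseteq> source_fibre e"
  shows "(\<Sum>t\<in>F. (cmod (\<eta> t x))\<^sup>2) \<le> C\<^sup>2"
proof -
  have "bdd_above (range (\<lambda>x. cmod (l2_inner e \<eta> \<eta> x)))"
    using l2_inner_self(1)[OF bound] by (intro bdd_aboveI[of _ M]) auto
  then have le: "cmod (l2_inner e \<eta> \<eta> x) \<le> sup_norm (l2_inner e \<eta> \<eta>)"
    unfolding sup_norm_def by (rule cSUP_upper[rotated]) simp
  then have nn: "0 \<le> sup_norm (l2_inner e \<eta> \<eta>)" using norm_ge_zero order_trans by blast
  have "sup_norm (l2_inner e \<eta> \<eta>) = (l2_norm e \<eta>)\<^sup>2" unfolding l2_norm_def using nn by simp
  also have "\<dots> \<le> C\<^sup>2" by (rule power_mono[OF norm]) (simp add: l2_norm_def nn)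
  finally show ?thesis using l2_inner_self(2)[where \<eta> = \<eta> and x = x, OF bound F] le by linarith
qed

lemma l2_module_bounded:
  assumes \<xi>: "\<xi> \<in> l2_module X \<theta> e"
  obtains M where "\<And>F x. finite F \<Longrightarrow> F \<subseteq> source_fibre e \<Longrightarrow> (\<Sum>t\<in>F. (cmod (\<xi> t x))\<^sup>2) \<le> M"
proof -
  obtain h where h: "h \<in> C0_on X (act_dom \<theta> e)"
      "uniform_limit UNIV (\<lambda>F x. \<Sum>t\<in>F. cnj (\<xi> t x) * \<xi> t x) h (finite_subsets_at_top (source_fibre e))"
    using \<xi> unfolding l2_module_def by blast
  obtain B where B: "\<And>x. cmod (h x) \<le> B" using C0_on_bounded[OF h(1)] by metis
  have "(\<Sum>t\<in>F. (cmod (\<xi> t x))\<^sup>2) \<le> B" if F: "finite F" "F \<subseteq> source_fibre e" for F x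
  proof -
    have "((\<lambda>F. \<Sum>t\<in>F. cnj (\<xi> t x) * \<xi> t x) \<longlongrightarrow> h x) (finite_subsets_at_top (source_fibre e))"
      by (rule tendsto_uniform_limitI[OF h(2)]) simp
    then have "((\<lambda>F. Re (\<Sum>t\<in>F. cnj (\<xi> t x) * \<xi> t x)) \<longlongrightarrow> Re (h x)) (finite_subsets_at_top (source_fibre e))"
      by (rule tendsto_Re)
    moreover have "Re (\<Sum>t\<in>F. cnj (\<xi> t x) * \<xi> t x) = (\<Sum>t\<in>F. (cmod (\<xi> t x))\<^sup>2)" for F
      unfolding Re_sum cmod_power2 by (simp add: power2_eq_square)
    ultimately have "((\<lambda>t. (cmod (\<xi> t x))\<^sup>2) has_sum Re (h x)) (source_fibre e)"
      by (simp add: has_sum_def)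
    then have "(\<Sum>t\<in>F. (cmod (\<xi> t x))\<^sup>2) \<le> Re (h x)"
      by (rule finite_sum_le_has_sum) (use F in auto)
    also have "\<dots> \<le> B" using complex_Re_le_cmod[of "h x"] B[of x] by linarith
    finally show ?thesis .
  qed
  then show ?thesis by (rule that)
qed

context locally_compact_action
begin

text \<open>The operator that \<open>\<ell>\<^sub>e(T)\<close> induces on the fibre \<open>l\<^sup>2(S\<^sub>e)\<close> over a point \<open>x\<close> of \<open>X\<^sub>e\<close>. As the
  coefficient algebra is commutative, the norm on the Hilbert module is the supremum of the fibre
  norms, so that the operator norm can be computed on finitely supported vectors of the fibres.\<close>

definition fibre_op :: "('s \<Rightarrow> 'x \<Rightarrow> complex) \<Rightarrow> 'x \<Rightarrow> ('s \<Rightarrow> complex) \<Rightarrow> 's \<Rightarrow> complex"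
  where "fibre_op T x \<zeta> r = (\<Sum>s\<in>supp T. if s * s\<^sup>\<star> * r = r then pull (s\<^sup>\<star> * r) (T s) x * \<zeta> (s\<^sup>\<star> * r) else 0)"

definition vsupp :: "('s \<Rightarrow> complex) \<Rightarrow> 's set"
  where "vsupp \<zeta> = {t. \<zeta> t \<noteq> 0}"

definition vectors :: "'s \<Rightarrow> ('s \<Rightarrow> complex) set"
  where "vectors e = {\<zeta>. finite (vsupp \<zeta>) \<and> vsupp \<zeta> \<subseteq> source_fibre e}"

definition vnorm :: "('s \<Rightarrow> complex) \<Rightarrow> real"
  where "vnorm \<zeta> = L2_set (\<lambda>t. cmod (\<zeta> t)) (vsupp \<zeta>)"

definition vdot :: "('s \<Rightarrow> complex) \<Rightarrow> ('s \<Rightarrow> complex) \<Rightarrow> complex"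
  where "vdot \<zeta> \<eta> = (\<Sum>t\<in>vsupp \<zeta> \<union> vsupp \<eta>. cnj (\<zeta> t) * \<eta> t)"

lemma vnorm_superset:
  assumes "finite F" "vsupp \<zeta> \<subseteq> F"
  shows "vnorm \<zeta> = L2_set (\<lambda>t. cmod (\<zeta> t)) F"
  unfolding vnorm_def L2_set_def
  by (rule arg_cong[of _ _ sqrt], rule sum.mono_neutral_left) (use assms in \<open>auto simp: vsupp_def\<close>)

lemma vnorm_nonneg: "0 \<le> vnorm \<zeta>"
  by (simp add: vnorm_def)

lemma vnorm_power2: "finite F \<Longrightarrow> vsupp \<zeta> \<subseteq> F \<Longrightarrow> (vnorm \<zeta>)\<^sup>2 = (\<Sum>t\<in>F. (cmod (\<zeta> t))\<^sup>2)"
  by (simp add: vnorm_superset L2_set_def sum_nonneg)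

lemma vdot_superset:
  assumes "finite F" "vsupp \<zeta> \<subseteq> F \<or> vsupp \<eta> \<subseteq> F" "finite (vsupp \<zeta>)" "finite (vsupp \<eta>)"
  shows "vdot \<zeta> \<eta> = (\<Sum>t\<in>F. cnj (\<zeta> t) * \<eta> t)"
  unfolding vdot_def by (rule sum.mono_neutral_cong) (use assms in \<open>auto simp: vsupp_def\<close>)

lemma vdot_Cauchy_Schwarz:
  assumes "finite (vsupp \<zeta>)" "finite (vsupp \<eta>)"
  shows "cmod (vdot \<zeta> \<eta>) \<le> vnorm \<zeta> * vnorm \<eta>"
proof -
  let ?F = "vsupp \<zeta> \<union> vsupp \<eta>"
  have "cmod (vdot \<zeta> \<eta>) \<le> (\<Sum>t\<in>?F. \<bar>cmod (\<zeta> t)\<bar> * \<bar>cmod (\<eta> t)\<bar>)"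
    unfolding vdot_def by (rule order_trans[OF norm_sum]) (simp add: norm_mult)
  also have "\<dots> \<le> L2_set (\<lambda>t. cmod (\<zeta> t)) ?F * L2_set (\<lambda>t. cmod (\<eta> t)) ?F"
    by (rule L2_set_mult_ineq)
  also have "\<dots> = vnorm \<zeta> * vnorm \<eta>"
    using assms vnorm_superset[of ?F \<zeta>] vnorm_superset[of ?F \<eta>] by simp
  finally show ?thesis .
qed

lemma vdot_self:
  assumes "finite (vsupp \<zeta>)"
  shows "cmod (vdot \<zeta> \<zeta>) = (vnorm \<zeta>)\<^sup>2"
proof -
  have "vdot \<zeta> \<zeta> = complex_of_real (\<Sum>t\<in>vsupp \<zeta>. (cmod (\<zeta> t))\<^sup>2)"
    unfolding vdot_def Un_absorb of_real_sum complex_norm_square by (simp add: mult.commute)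
  then show ?thesis using vnorm_power2[OF assms order_refl] by (simp add: sum_nonneg del: of_real_sum)
qed

lemma fibre_op_superset:
  assumes "finite F" "supp T \<subseteq> F"
  shows "fibre_op T x \<zeta> r = (\<Sum>s\<in>F. if s * s\<^sup>\<star> * r = r then pull (s\<^sup>\<star> * r) (T s) x * \<zeta> (s\<^sup>\<star> * r) else 0)"
  unfolding fibre_op_def
  by (rule sum.mono_neutral_left) (use assms in \<open>auto simp: supp_def pull_def split: option.split\<close>)

lemma source_mult_source: "s * s\<^sup>\<star> * r = r \<Longrightarrow> (s\<^sup>\<star> * r)\<^sup>\<star> * (s\<^sup>\<star> * r) = r\<^sup>\<star> * (r::'s)"
  by (simp add: sinv_mult sinv_sinv mult.assoc)

lemma vsupp_fibre_op: "vsupp (fibre_op T x \<zeta>) \<subseteq> {r. \<exists>s\<in>supp T. s * s\<^sup>\<star> * r = r \<and> s\<^sup>\<star> * r \<in> vsupp \<zeta>}"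
  unfolding vsupp_def fibre_op_def by (fastforce elim!: sum.not_neutral_contains_not_neutral split: if_splits)

lemma vsupp_fibre_op_image: "vsupp (fibre_op T x \<zeta>) \<subseteq> (\<lambda>(s, t). s * t) ` (supp T \<times> vsupp \<zeta>)"
proof
  fix r assume "r \<in> vsupp (fibre_op T x \<zeta>)"
  then obtain s where s: "s \<in> supp T" "s * s\<^sup>\<star> * r = r" "s\<^sup>\<star> * r \<in> vsupp \<zeta>" using vsupp_fibre_op by blast
  then have "r = (\<lambda>(s, t). s * t) (s, s\<^sup>\<star> * r)" by (simp add: mult.assoc)
  then show "r \<in> (\<lambda>(s, t). s * t) ` (supp T \<times> vsupp \<zeta>)" using s by blast
qed

lemma finite_vsupp_fibre_op: "T \<in> KA \<Longrightarrow> finite (vsupp \<zeta>) \<Longrightarrow> finite (vsupp (fibre_op T x \<zeta>))"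
  by (rule finite_subset[OF vsupp_fibre_op_image]) (simp add: KA_supp)

lemma fibre_op_vectors:
  assumes T: "T \<in> KA" and \<zeta>: "\<zeta> \<in> vectors e"
  shows "fibre_op T x \<zeta> \<in> vectors e"
proof -
  have "vsupp (fibre_op T x \<zeta>) \<subseteq> source_fibre e"
  proof
    fix r assume "r \<in> vsupp (fibre_op T x \<zeta>)"
    then obtain s where s: "s * s\<^sup>\<star> * r = r" "s\<^sup>\<star> * r \<in> vsupp \<zeta>" using vsupp_fibre_op by blast
    then have "s\<^sup>\<star> * r \<in> source_fibre e" using \<zeta> by (auto simp: vectors_def)
    then show "r \<in> source_fibre e" using source_mult_source[OF s(1)] by (simp add: source_fibre_def)
  qed
  then show ?thesis using finite_vsupp_fibre_op[OF T] \<zeta> by (simp add: vectors_def)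
qed

lemma factor_iff: "s * t = r \<and> s\<^sup>\<star> * s * t = t \<longleftrightarrow> t = s\<^sup>\<star> * r \<and> s * s\<^sup>\<star> * r = (r::'s)"
  by (auto simp: mult.assoc)

lemma pull_pairing: "pull t (pairing T \<phi>) x = (\<Sum>s\<in>supp T. pull t (T s) x * \<phi> s)"
  by (cases "\<theta> t x") (simp_all add: pull_def pairing_def)

lemma fibre_op_pairing:
  assumes T: "T \<in> KA" and G: "finite G" "vsupp \<zeta> \<subseteq> G" and F: "finite F" "vsupp (fibre_op T x \<zeta>) \<subseteq> F"
  shows "(\<Sum>r\<in>F. fibre_op T x \<zeta> r * \<phi> r) =
    (\<Sum>t\<in>G. \<zeta> t * pull t (pairing T (\<lambda>s. if s\<^sup>\<star> * s * t = t then \<phi> (s * t) else 0)) x)"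
proof -
  let ?H = "F \<union> (\<lambda>(s, t). s * t) ` (supp T \<times> G)"
  have H: "finite ?H" using F G KA_supp[OF T] by simp
  have expand: "fibre_op T x \<zeta> r = (\<Sum>s\<in>supp T. \<Sum>t\<in>G.
      if s * t = r \<and> s\<^sup>\<star> * s * t = t then pull t (T s) x * \<zeta> t else 0)" for r
    unfolding fibre_op_def
  proof (intro sum.cong refl)
    fix s
    have "(\<Sum>t\<in>G. if s * t = r \<and> s\<^sup>\<star> * s * t = t then pull t (T s) x * \<zeta> t else 0)
        = (\<Sum>t\<in>G. if t = s\<^sup>\<star> * r then (if s * s\<^sup>\<star> * r = r then pull t (T s) x * \<zeta> t else 0) else 0)"
      unfolding factor_iff by (intro sum.cong) auto
    also have "\<dots> = (if s * s\<^sup>\<star> * r = r then pull (s\<^sup>\<star> * r) (T s) x * \<zeta> (s\<^sup>\<star> * r) else 0)"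
      unfolding sum.delta[OF G(1)] using G(2) by (auto simp: vsupp_def)
    finally show "(if s * s\<^sup>\<star> * r = r then pull (s\<^sup>\<star> * r) (T s) x * \<zeta> (s\<^sup>\<star> * r) else 0) =
        (\<Sum>t\<in>G. if s * t = r \<and> s\<^sup>\<star> * s * t = t then pull t (T s) x * \<zeta> t else 0)" by simp
  qed
  have "(\<Sum>r\<in>F. fibre_op T x \<zeta> r * \<phi> r) = (\<Sum>r\<in>?H. fibre_op T x \<zeta> r * \<phi> r)"
    by (rule sum.mono_neutral_left[OF H]) (use F in \<open>auto simp: vsupp_def\<close>)
  also have "\<dots> = (\<Sum>r\<in>?H. \<Sum>s\<in>supp T. \<Sum>t\<in>G.
      if s * t = r then (if s\<^sup>\<star> * s * t = t then pull t (T s) x * \<zeta> t * \<phi> r else 0) else 0)"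
    unfolding expand sum_distrib_right by (intro sum.cong refl) auto
  also have "\<dots> = (\<Sum>s\<in>supp T. \<Sum>t\<in>G. \<Sum>r\<in>?H.
      if s * t = r then (if s\<^sup>\<star> * s * t = t then pull t (T s) x * \<zeta> t * \<phi> r else 0) else 0)"
    by (subst sum.swap, rule sum.cong[OF refl], rule sum.swap)
  also have "\<dots> = (\<Sum>s\<in>supp T. \<Sum>t\<in>G. if s\<^sup>\<star> * s * t = t then pull t (T s) x * \<zeta> t * \<phi> (s * t) else 0)"
  proof (intro sum.cong refl)
    fix s t assume "s \<in> supp T" "t \<in> G"
    then have "s * t \<in> ?H" by auto
    then show "(\<Sum>r\<in>?H. if s * t = r then (if s\<^sup>\<star> * s * t = t then pull t (T s) x * \<zeta> t * \<phi> r else 0) else 0)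
        = (if s\<^sup>\<star> * s * t = t then pull t (T s) x * \<zeta> t * \<phi> (s * t) else 0)"
      unfolding sum.delta'[OF H] by simp
  qed
  also have "\<dots> = (\<Sum>t\<in>G. \<Sum>s\<in>supp T. if s\<^sup>\<star> * s * t = t then pull t (T s) x * \<zeta> t * \<phi> (s * t) else 0)"
    by (rule sum.swap)
  also have "\<dots> = (\<Sum>t\<in>G. \<zeta> t * pull t (pairing T (\<lambda>s. if s\<^sup>\<star> * s * t = t then \<phi> (s * t) else 0)) x)"
  proof (intro sum.cong refl)
    fix t
    show "(\<Sum>s\<in>supp T. if s\<^sup>\<star> * s * t = t then pull t (T s) x * \<zeta> t * \<phi> (s * t) else 0) =
        \<zeta> t * pull t (pairing T (\<lambda>s. if s\<^sup>\<star> * s * t = t then \<phi> (s * t) else 0)) x"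
      unfolding pull_pairing sum_distrib_left by (intro sum.cong refl) auto
  qed
  finally show ?thesis .
qed

text \<open>Both sides are iterated sums over the components of \<open>T\<close>, of \<open>U\<close> and of the vector; they agree by
  the multiplicativity of the condition \<open>s\<^sup>\<star> s t = t\<close>.\<close>

lemma fibre_op_mult:
  assumes T: "T \<in> KA" and U: "U \<in> KA" and \<zeta>: "finite (vsupp \<zeta>)"
  shows "fibre_op (T \<odot> U) x \<zeta> = fibre_op T x (fibre_op U x \<zeta>)"
proof
  fix r
  let ?\<eta> = "fibre_op U x \<zeta>"
  have TU: "T \<odot> U \<in> KA" using T U by simp
  have \<eta>: "finite (vsupp ?\<eta>)" by (rule finite_vsupp_fibre_op[OF U \<zeta>])
  let ?F = "insert r (vsupp (fibre_op (T \<odot> U) x \<zeta>) \<union> vsupp (fibre_op T x ?\<eta>))"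
  have F: "finite ?F" using finite_vsupp_fibre_op[OF TU \<zeta>] finite_vsupp_fibre_op[OF T \<eta>] by simp
  let ?\<phi> = "\<lambda>q. if q = r then 1 else (0::complex)"
  let ?\<chi> = "\<lambda>w. pull w (pairing T (\<lambda>s. if s\<^sup>\<star> * s * w = w then ?\<phi> (s * w) else 0)) x"
  have ind: "(\<Sum>q\<in>?F. \<eta> q * ?\<phi> q) = \<eta> r" for \<eta>
  proof -
    have "(\<Sum>q\<in>?F. \<eta> q * ?\<phi> q) = (\<Sum>q\<in>?F. if q = r then \<eta> q else 0)" by (rule sum.cong) auto
    then show ?thesis unfolding sum.delta[OF F] by simp
  qed
  have "fibre_op T x ?\<eta> r = (\<Sum>w\<in>vsupp ?\<eta>. ?\<eta> w * ?\<chi> w)"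
    unfolding ind[symmetric] by (rule fibre_op_pairing[OF T \<eta> order_refl F]) auto
  also have "\<dots> = (\<Sum>t\<in>vsupp \<zeta>. \<zeta> t * pull t (pairing U (\<lambda>u. if u\<^sup>\<star> * u * t = t then ?\<chi> (u * t) else 0)) x)"
    by (rule fibre_op_pairing[OF U \<zeta> order_refl \<eta> order_refl])
  also have "\<dots> = (\<Sum>t\<in>vsupp \<zeta>. \<zeta> t * pull t (pairing (T \<odot> U)
      (\<lambda>q. if q\<^sup>\<star> * q * t = t then ?\<phi> (q * t) else 0)) x)"
  proof (intro sum.cong refl arg_cong2[of _ _ _ _ "(*)"])
    fix t
    show "pull t (pairing U (\<lambda>u. if u\<^sup>\<star> * u * t = t then ?\<chi> (u * t) else 0)) x =
        pull t (pairing (T \<odot> U) (\<lambda>q. if q\<^sup>\<star> * q * t = t then ?\<phi> (q * t) else 0)) x"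
    proof (cases "\<theta> t x")
      case (Some y)
      have p: "pull (u * t) f x = pull u f y" for u f
        using Some by (simp flip: pull_pull) (simp add: pull_def)
      have "(if u\<^sup>\<star> * u * t = t then ?\<chi> (u * t) else 0) =
          pull u (pairing T (\<lambda>s. if (s * u)\<^sup>\<star> * (s * u) * t = t then ?\<phi> (s * u * t) else 0)) y" for u
        unfolding p source_mult_fixes_iff
        by (cases "u\<^sup>\<star> * u * t = t") (simp_all add: pull_pairing mult.assoc cong: if_cong)
      then show ?thesis
        using Some by (simp add: pull_def[of t] pairing_mult[OF T U] pairing_def[of U])
    qed (simp add: pull_def)
  qed
  also have "\<dots> = fibre_op (T \<odot> U) x \<zeta> r"
    unfolding ind[of "fibre_op (T \<odot> U) x \<zeta>", symmetric]
    by (rule fibre_op_pairing[OF TU \<zeta> order_refl F, symmetric]) auto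
  finally show "fibre_op (T \<odot> U) x \<zeta> r = fibre_op T x ?\<eta> r" by simp
qed

text \<open>For \<open>s\<^sup>\<star> s t = t\<close>, passing from \<open>t\<close> to \<open>s t\<close> is undone by \<open>s\<^sup>\<star>\<close>, and \<open>\<theta>\<^bsub>s*\<^esub>\<close> takes \<open>\<theta>\<^bsub>st\<^esub> x\<close> back to \<open>\<theta>\<^sub>t x\<close>.\<close>

lemma fibre_op_adjoint:
  assumes T: "T \<in> KA" and \<zeta>: "finite (vsupp \<zeta>)" and \<eta>: "finite (vsupp \<eta>)"
  shows "vdot (fibre_op T x \<zeta>) \<eta> = vdot \<zeta> (fibre_op (KS_star T) x \<eta>)"
proof -
  have S: "KS_star T \<in> KA" using T by simp
  have inj: "inj_on (sinv :: 's \<Rightarrow> 's) B" for B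
    by (rule inj_on_inverseI[where g = sinv]) (simp add: sinv_sinv)
  let ?F = "vsupp (fibre_op T x \<zeta>)"
  have F: "finite ?F" by (rule finite_vsupp_fibre_op[OF T \<zeta>])
  have "vdot (fibre_op T x \<zeta>) \<eta> = cnj (\<Sum>r\<in>?F. fibre_op T x \<zeta> r * cnj (\<eta> r))"
    using vdot_superset[of ?F "fibre_op T x \<zeta>" \<eta>] F \<eta> by simp
  also have "\<dots> = cnj (\<Sum>t\<in>vsupp \<zeta>. \<zeta> t * pull t (pairing T (\<lambda>s. if s\<^sup>\<star> * s * t = t then cnj (\<eta> (s * t)) else 0)) x)"
    by (subst fibre_op_pairing[OF T \<zeta> order_refl F order_refl]) (rule refl)
  also have "\<dots> = (\<Sum>t\<in>vsupp \<zeta>. cnj (\<zeta> t) * fibre_op (KS_star T) x \<eta> t)"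
    unfolding cnj_sum complex_cnj_mult
  proof (intro sum.cong refl arg_cong2[of _ _ _ _ "(*)"])
    fix t
    have "fibre_op (KS_star T) x \<eta> t = (\<Sum>s'\<in>sinv ` supp T.
        if s' * s'\<^sup>\<star> * t = t then pull (s'\<^sup>\<star> * t) (KS_star T s') x * \<eta> (s'\<^sup>\<star> * t) else 0)"
      by (rule fibre_op_superset) (use KA_supp[OF T] supp_star in auto)
    also have "\<dots> = (\<Sum>s\<in>supp T.
        if s\<^sup>\<star> * s * t = t then pull (s * t) (KS_star T (s\<^sup>\<star>)) x * \<eta> (s * t) else 0)"
      by (simp add: sum.reindex[OF inj] sinv_sinv cong: if_cong)
    also have "\<dots> = (\<Sum>s\<in>supp T.
        if s\<^sup>\<star> * s * t = t then pull t (\<lambda>y. cnj (T s y)) x * \<eta> (s * t) else 0)"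
    proof (intro sum.cong refl if_cong arg_cong2[of _ _ _ _ "(*)"])
      fix s assume st: "s\<^sup>\<star> * s * t = t"
      have "KS_star T (s\<^sup>\<star>) = pull (s\<^sup>\<star>) (\<lambda>y. cnj (T s y))"
        by (simp add: fun_eq_iff KS_star_apply sinv_sinv)
      then show "pull (s * t) (KS_star T (s\<^sup>\<star>)) x = pull t (\<lambda>y. cnj (T s y)) x"
        using st by (simp add: pull_pull mult.assoc)
    qed
    also have "\<dots> = cnj (pull t (pairing T (\<lambda>s. if s\<^sup>\<star> * s * t = t then cnj (\<eta> (s * t)) else 0)) x)"
    proof -
      have "pull t (\<lambda>y. cnj (T s y)) x = cnj (pull t (T s) x)" for s
        by (simp add: pull_def split: option.split)
      then show ?thesis
        unfolding pull_pairing cnj_sum complex_cnj_mult by (intro sum.cong refl) auto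
    qed
    finally show "cnj (pull t (pairing T (\<lambda>s. if s\<^sup>\<star> * s * t = t then cnj (\<eta> (s * t)) else 0)) x)
        = fibre_op (KS_star T) x \<eta> t" by simp
  qed
  also have "\<dots> = vdot \<zeta> (fibre_op (KS_star T) x \<eta>)"
    using vdot_superset[of "vsupp \<zeta>" \<zeta> "fibre_op (KS_star T) x \<eta>"] \<zeta> finite_vsupp_fibre_op[OF S \<eta>] by simp
  finally show ?thesis .
qed

lemma fibre_op_add:
  assumes T: "T \<in> KA" and U: "U \<in> KA"
  shows "fibre_op (T + U) x \<zeta> r = fibre_op T x \<zeta> r + fibre_op U x \<zeta> r"
proof -
  have fin: "finite (supp T \<union> supp U)" using KA_supp[OF T] KA_supp[OF U] by simp
  show ?thesis
    unfolding fibre_op_superset[OF fin supp_add] fibre_op_superset[OF fin Un_upper1] fibre_op_superset[OF fin Un_upper2]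
      sum.distrib[symmetric]
    by (intro sum.cong refl) (auto simp: pull_def algebra_simps split: option.split)
qed

lemma fibre_op_scale:
  assumes T: "T \<in> KA"
  shows "fibre_op (KS_scale c T) x \<zeta> r = c * fibre_op T x \<zeta> r"
  unfolding fibre_op_superset[OF KA_supp[OF T] supp_scale] fibre_op_superset[OF KA_supp[OF T] order_refl]
    sum_distrib_left
  by (intro sum.cong refl) (auto simp: pull_def KS_scale_apply split: option.split)

lemma fibre_op_scale_vector: "fibre_op T x (\<lambda>t. c * \<zeta> t) r = c * fibre_op T x \<zeta> r"
  unfolding fibre_op_def sum_distrib_left by (intro sum.cong refl) auto

lemma vnorm_scale: "vnorm (\<lambda>t. c * \<zeta> t) = cmod c * vnorm \<zeta>"
proof (cases "c = 0")
  case False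
  then have "vsupp (\<lambda>t. c * \<zeta> t) = vsupp \<zeta>" by (auto simp: vsupp_def)
  then show ?thesis by (simp add: vnorm_def norm_mult L2_set_right_distrib)
qed (simp add: vnorm_def vsupp_def)

lemma vnorm_add:
  assumes "finite (vsupp \<zeta>)" "finite (vsupp \<eta>)"
  shows "vnorm (\<lambda>t. \<zeta> t + \<eta> t) \<le> vnorm \<zeta> + vnorm \<eta>"
proof -
  let ?F = "vsupp \<zeta> \<union> vsupp \<eta>"
  have F: "finite ?F" using assms by simp
  have "vnorm (\<lambda>t. \<zeta> t + \<eta> t) = L2_set (\<lambda>t. cmod (\<zeta> t + \<eta> t)) ?F"
    by (rule vnorm_superset[OF F]) (auto simp: vsupp_def)
  also have "\<dots> \<le> L2_set (\<lambda>t. cmod (\<zeta> t) + cmod (\<eta> t)) ?F"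
    by (rule L2_set_mono) (auto intro: norm_triangle_ineq)
  also have "\<dots> \<le> L2_set (\<lambda>t. cmod (\<zeta> t)) ?F + L2_set (\<lambda>t. cmod (\<eta> t)) ?F"
    by (rule L2_set_triangle_ineq)
  also have "\<dots> = vnorm \<zeta> + vnorm \<eta>"
    using vnorm_superset[OF F, of \<zeta>] vnorm_superset[OF F, of \<eta>] by simp
  finally show ?thesis .
qed

lemma vnorm_zero_iff: "finite (vsupp \<zeta>) \<Longrightarrow> vnorm \<zeta> = 0 \<longleftrightarrow> (\<forall>t. \<zeta> t = 0)"
  unfolding vnorm_def by (subst L2_set_eq_0_iff) (auto simp: vsupp_def)

text \<open>The reduced norm turns out to be the least nonnegative such \<open>C\<close>, see \<open>reduced_norm_le\<close> and
  \<open>fibre_bounded_reduced_norm\<close> below.\<close>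

definition fibre_bounded :: "('s \<Rightarrow> 'x \<Rightarrow> complex) \<Rightarrow> real \<Rightarrow> bool"
  where "fibre_bounded T C \<longleftrightarrow>
    (\<forall>e\<in>idempotents. \<forall>x\<in>act_dom \<theta> e. \<forall>\<zeta>\<in>vectors e. vnorm (fibre_op T x \<zeta>) \<le> C * vnorm \<zeta>)"

lemma fibre_boundedD:
  "fibre_bounded T C \<Longrightarrow> e \<in> idempotents \<Longrightarrow> x \<in> act_dom \<theta> e \<Longrightarrow> \<zeta> \<in> vectors e
    \<Longrightarrow> vnorm (fibre_op T x \<zeta>) \<le> C * vnorm \<zeta>"
  by (simp add: fibre_bounded_def)

lemma fibre_boundedI:
  "(\<And>e x \<zeta>. e \<in> idempotents \<Longrightarrow> x \<in> act_dom \<theta> e \<Longrightarrow> \<zeta> \<in> vectors e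
    \<Longrightarrow> vnorm (fibre_op T x \<zeta>) \<le> C * vnorm \<zeta>) \<Longrightarrow> fibre_bounded T C"
  by (simp add: fibre_bounded_def)

lemma vectors_finite: "\<zeta> \<in> vectors e \<Longrightarrow> finite (vsupp \<zeta>)"
  by (simp add: vectors_def)

text \<open>The operator multiplies coordinates by values of \<open>a\<close> and moves them injectively.\<close>

lemma fibre_bounded_delta:
  assumes a: "a \<in> C0_on X (act_dom \<theta> (s\<^sup>\<star> * s))" and B: "B \<ge> 0" "\<And>x. cmod (a x) \<le> B"
  shows "fibre_bounded (delta s a) B"
proof (rule fibre_boundedI)
  fix e x \<zeta> assume \<zeta>: "\<zeta> \<in> vectors e"
  let ?T = "delta s a"
  let ?F = "vsupp (fibre_op ?T x \<zeta>)"
  have fr: "fibre_op ?T x \<zeta> r = (if s * s\<^sup>\<star> * r = r then pull (s\<^sup>\<star> * r) a x * \<zeta> (s\<^sup>\<star> * r) else 0)" for r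
    using fibre_op_superset[of "{s}" ?T, OF _ supp_delta] by (simp add: delta_def)
  have F: "finite ?F" by (rule finite_vsupp_fibre_op[OF delta_closed[OF a] vectors_finite[OF \<zeta>]])
  have sub: "s * s\<^sup>\<star> * r = r" "s\<^sup>\<star> * r \<in> vsupp \<zeta>" if "r \<in> ?F" for r
    using that by (auto simp: vsupp_def fr split: if_splits)
  have inj: "inj_on (\<lambda>r. s\<^sup>\<star> * r) ?F"
    by (rule inj_on_inverseI[where g = "\<lambda>t. s * t"]) (use sub(1) in \<open>simp add: mult.assoc\<close>)
  have "(vnorm (fibre_op ?T x \<zeta>))\<^sup>2 = (\<Sum>r\<in>?F. (cmod (fibre_op ?T x \<zeta> r))\<^sup>2)"
    by (rule vnorm_power2[OF F order_refl])
  also have "\<dots> \<le> (\<Sum>r\<in>?F. (B * cmod (\<zeta> (s\<^sup>\<star> * r)))\<^sup>2)"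
  proof (intro sum_mono power_mono)
    fix r
    have "cmod (pull (s\<^sup>\<star> * r) a x) \<le> B" using B by (auto simp: pull_def split: option.split)
    then show "cmod (fibre_op ?T x \<zeta> r) \<le> B * cmod (\<zeta> (s\<^sup>\<star> * r))"
      using B(1) by (auto simp: fr norm_mult mult_right_mono)
  qed simp
  also have "\<dots> = B\<^sup>2 * (\<Sum>t\<in>(\<lambda>r. s\<^sup>\<star> * r) ` ?F. (cmod (\<zeta> t))\<^sup>2)"
    by (simp add: sum.reindex[OF inj] power_mult_distrib sum_distrib_left)
  also have "\<dots> \<le> B\<^sup>2 * (\<Sum>t\<in>vsupp \<zeta>. (cmod (\<zeta> t))\<^sup>2)"
    by (intro mult_left_mono sum_mono2) (use vectors_finite[OF \<zeta>] sub in auto)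
  also have "\<dots> = (B * vnorm \<zeta>)\<^sup>2"
    using vnorm_power2[OF vectors_finite[OF \<zeta>] order_refl] by (simp add: power_mult_distrib)
  finally show "vnorm (fibre_op ?T x \<zeta>) \<le> B * vnorm \<zeta>"
    by (rule power2_le_imp_le) (simp add: B vnorm_nonneg)
qed

lemma fibre_bounded_add:
  assumes T: "T \<in> KA" and U: "U \<in> KA" and "fibre_bounded T C" "fibre_bounded U D"
  shows "fibre_bounded (T + U) (C + D)"
proof (rule fibre_boundedI)
  fix e x \<zeta> assume e: "e \<in> idempotents" "x \<in> act_dom \<theta> e" "\<zeta> \<in> vectors e"
  have "vnorm (fibre_op (T + U) x \<zeta>) \<le> vnorm (fibre_op T x \<zeta>) + vnorm (fibre_op U x \<zeta>)"
    using vnorm_add[OF finite_vsupp_fibre_op[OF T vectors_finite[OF e(3)]] finite_vsupp_fibre_op[OF U vectors_finite[OF e(3)]]]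
    by (simp add: fibre_op_add[OF T U, abs_def])
  also have "\<dots> \<le> C * vnorm \<zeta> + D * vnorm \<zeta>"
    by (intro add_mono fibre_boundedD[OF assms(3) e] fibre_boundedD[OF assms(4) e])
  finally show "vnorm (fibre_op (T + U) x \<zeta>) \<le> (C + D) * vnorm \<zeta>" by (simp add: distrib_right)
qed

lemma fibre_bounded_exists:
  assumes T: "T \<in> KA"
  obtains C where "C \<ge> 0" "fibre_bounded T C"
proof -
  have "\<forall>s. \<exists>B\<ge>0. \<forall>x. cmod (T s x) \<le> B" using C0_on_bounded[OF KA_C0[OF T]] by (metis less_imp_le)
  then obtain B where B: "\<And>s. B s \<ge> 0" "\<And>s x. cmod (T s x) \<le> B s" by metis
  have "fibre_bounded (\<Sum>s\<in>F. delta s (T s)) (\<Sum>s\<in>F. B s)" if "finite F" for F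
    using that
  proof (induction F rule: finite_induct)
    case (insert s F)
    show ?case unfolding sum.insert[OF insert.hyps]
      by (rule fibre_bounded_add[OF delta_closed[OF KA_C0[OF T]]
            delta_decomposition(1)[OF insert.hyps(1) KA_C0[OF T]]
            fibre_bounded_delta[OF KA_C0[OF T] B] insert.IH])
  next
    case empty
    have "fibre_op 0 x \<zeta> = (\<lambda>_. 0)" for x \<zeta> by (simp add: fibre_op_def supp_def fun_eq_iff zero_fun_def)
    then have v: "vnorm (fibre_op 0 x \<zeta>) = 0" for x \<zeta> by (simp only: vnorm_def vsupp_def) simp
    show ?case unfolding sum.empty
      by (rule fibre_boundedI) (simp only: v mult_zero_left order_refl)
  qed
  from this[OF KA_supp[OF T]] have "fibre_bounded T (\<Sum>s\<in>supp T. B s)"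
    unfolding KA_decomposition[OF T, symmetric] .
  then show ?thesis using that B(1) by (meson sum_nonneg)
qed

text \<open>For given \<open>r\<close> and \<open>s\<close>, only \<open>t = s\<^sup>\<star> r\<close> can satisfy \<open>s t = r\<close> and \<open>s\<^sup>\<star> s t = t\<close>.\<close>

lemma KS_ell_eq_fibre_op:
  assumes T: "finite (supp T)"
  shows "KS_ell \<theta> e T \<xi> r x = (if r \<in> source_fibre e then fibre_op T x (\<lambda>t. if t \<in> source_fibre e then \<xi> t x else 0) r else 0)"
proof -
  let ?I = "{(s, t). s \<in> supp T \<and> t \<in> source_fibre e \<and> s\<^sup>\<star> * s * t = t \<and> s * t = r}"
  let ?J = "{s \<in> supp T. s * s\<^sup>\<star> * r = r \<and> s\<^sup>\<star> * r \<in> source_fibre e}"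
  have I: "?I = (\<lambda>s. (s, s\<^sup>\<star> * r)) ` ?J"
  proof (intro set_eqI, clarify)
    fix s t
    show "(s, t) \<in> ?I \<longleftrightarrow> (s, t) \<in> (\<lambda>s. (s, s\<^sup>\<star> * r)) ` ?J"
      using factor_iff[of s t r] by auto
  qed
  have "KS_ell \<theta> e T \<xi> r x = (\<Sum>(s, t)\<in>?I. pull t (T s) x * \<xi> t x)"
    by (simp add: KS_ell_def act_fun_eq_pull' sinv_sinv pull_mult_pull)
  also have "\<dots> = (\<Sum>s\<in>?J. pull (s\<^sup>\<star> * r) (T s) x * \<xi> (s\<^sup>\<star> * r) x)"
    unfolding I by (subst sum.reindex) (auto intro: inj_onI)
  finally have eq: "KS_ell \<theta> e T \<xi> r x = (\<Sum>s\<in>?J. pull (s\<^sup>\<star> * r) (T s) x * \<xi> (s\<^sup>\<star> * r) x)" .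
  have src: "s\<^sup>\<star> * r \<in> source_fibre e \<longleftrightarrow> r \<in> source_fibre e" if "s * s\<^sup>\<star> * r = r" for s
    using source_mult_source[OF that] by (simp add: source_fibre_def)
  show ?thesis
  proof (cases "r \<in> source_fibre e")
    case False
    then have J: "?J = {}" using src by auto
    show ?thesis unfolding eq J using False by simp
  next
    case True
    have "(\<Sum>s\<in>?J. pull (s\<^sup>\<star> * r) (T s) x * \<xi> (s\<^sup>\<star> * r) x) =
        (\<Sum>s | s \<in> supp T \<and> s * s\<^sup>\<star> * r = r. pull (s\<^sup>\<star> * r) (T s) x *
          (if s\<^sup>\<star> * r \<in> source_fibre e then \<xi> (s\<^sup>\<star> * r) x else 0))"
      by (rule sum.cong) (use src True in auto)
    also have "\<dots> = fibre_op T x (\<lambda>t. if t \<in> source_fibre e then \<xi> t x else 0) r"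
      unfolding fibre_op_def by (rule sum.inter_filter[OF T])
    finally show ?thesis unfolding eq using True by simp
  qed
qed


lemma l2_module_partial_sums:
  assumes \<xi>: "\<xi> \<in> l2_module X \<theta> e" and norm: "l2_norm e \<xi> \<le> 1"
    and F: "finite F" "F \<subseteq> source_fibre e"
  shows "(\<Sum>t\<in>F. (cmod (\<xi> t x))\<^sup>2) \<le> 1"
proof -
  obtain M where M: "\<And>F x. finite F \<Longrightarrow> F \<subseteq> source_fibre e \<Longrightarrow> (\<Sum>t\<in>F. (cmod (\<xi> t x))\<^sup>2) \<le> M"
    using l2_module_bounded[OF \<xi>] by metis
  show ?thesis using partial_sum_le_l2_norm[OF M norm F] by simp
qed

text \<open>Finitely many coordinates of \<open>\<ell>\<^sub>e(T) \<xi>\<close> depend on finitely many coordinates of \<open>\<xi>\<close>, so that \<open>\<xi>\<close> may be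
  truncated to a finitely supported vector.\<close>

lemma KS_ell_partial_sums:
  assumes T: "T \<in> KA" and C: "fibre_bounded T C" "C \<ge> 0" and e: "e \<in> idempotents"
    and \<xi>: "\<xi> \<in> l2_module X \<theta> e" "l2_norm e \<xi> \<le> 1"
    and F: "finite F" "F \<subseteq> source_fibre e"
  shows "(\<Sum>r\<in>F. (cmod (KS_ell \<theta> e T \<xi> r x))\<^sup>2) \<le> C\<^sup>2"
proof (cases "x \<in> act_dom \<theta> e")
  case False
  have "\<xi> t x = 0" if "t \<in> source_fibre e" for t
    using \<xi>(1) that False by (auto simp: l2_module_def intro: C0_on_off)
  then have "fibre_op T x (\<lambda>t. if t \<in> source_fibre e then \<xi> t x else 0) r = 0" for r
    by (simp add: fibre_op_def cong: if_cong)
  then have "KS_ell \<theta> e T \<xi> r x = 0" for r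
    unfolding KS_ell_eq_fibre_op[OF KA_supp[OF T]] by simp
  then show ?thesis by simp
next
  case True
  define G where "G = {t \<in> (\<lambda>(s, r). s\<^sup>\<star> * r) ` (supp T \<times> F). t \<in> source_fibre e}"
  define \<zeta> where "\<zeta> t = (if t \<in> G then \<xi> t x else 0)" for t
  have G: "finite G" "G \<subseteq> source_fibre e" using F KA_supp[OF T] by (auto simp: G_def)
  have vsupp: "vsupp \<zeta> \<subseteq> G" by (auto simp: vsupp_def \<zeta>_def)
  have \<zeta>: "\<zeta> \<in> vectors e" using vsupp G by (auto simp: vectors_def intro: finite_subset)
  have eq: "KS_ell \<theta> e T \<xi> r x = fibre_op T x \<zeta> r" if r: "r \<in> F" for r
  proof -
    have "s\<^sup>\<star> * r \<in> G \<longleftrightarrow> s\<^sup>\<star> * r \<in> source_fibre e" if "s \<in> supp T" for s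
      using that r by (auto simp: G_def)
    then have "fibre_op T x (\<lambda>t. if t \<in> source_fibre e then \<xi> t x else 0) r = fibre_op T x \<zeta> r"
      unfolding fibre_op_def \<zeta>_def by (intro sum.cong refl) simp
    then show ?thesis
      using r F unfolding KS_ell_eq_fibre_op[OF KA_supp[OF T]] by auto
  qed
  have fin: "finite (F \<union> vsupp (fibre_op T x \<zeta>))"
    using F finite_vsupp_fibre_op[OF T vectors_finite[OF \<zeta>]] by simp
  have "(\<Sum>r\<in>F. (cmod (KS_ell \<theta> e T \<xi> r x))\<^sup>2) = (\<Sum>r\<in>F. (cmod (fibre_op T x \<zeta> r))\<^sup>2)"
    by (intro sum.cong refl) (simp add: eq)
  also have "\<dots> \<le> (\<Sum>r\<in>F \<union> vsupp (fibre_op T x \<zeta>). (cmod (fibre_op T x \<zeta> r))\<^sup>2)"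
    by (rule sum_mono2[OF fin]) auto
  also have "\<dots> = (vnorm (fibre_op T x \<zeta>))\<^sup>2" by (rule vnorm_power2[OF fin, symmetric]) auto
  also have "\<dots> \<le> (C * vnorm \<zeta>)\<^sup>2"
    by (rule power_mono[OF fibre_boundedD[OF C(1) e True \<zeta>] vnorm_nonneg])
  also have "\<dots> = C\<^sup>2 * (\<Sum>t\<in>G. (cmod (\<zeta> t))\<^sup>2)"
    using vnorm_power2[OF G(1) vsupp] by (simp add: power_mult_distrib)
  also have "(\<Sum>t\<in>G. (cmod (\<zeta> t))\<^sup>2) = (\<Sum>t\<in>G. (cmod (\<xi> t x))\<^sup>2)"
    by (intro sum.cong refl) (simp add: \<zeta>_def)
  also have "C\<^sup>2 * \<dots> \<le> C\<^sup>2 * 1"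
    by (intro mult_left_mono l2_module_partial_sums[OF \<xi> G]) simp
  finally show ?thesis by simp
qed

lemma zero_l2_module: "(\<lambda>_ _. 0) \<in> l2_module X \<theta> e"
  unfolding l2_module_def
  by (auto intro!: bexI[of _ "\<lambda>_. 0"] C0_on_zero uniform_limitI always_eventually)

lemma zero_l2_norm: "l2_norm e (\<lambda>_ _. 0) = 0"
  by (simp add: l2_norm_def l2_inner_def sup_norm_def)

lemma l2_ball_nonempty: "{\<xi> \<in> l2_module X \<theta> e. l2_norm e \<xi> \<le> 1} \<noteq> {}"
  using zero_l2_module zero_l2_norm by (metis (mono_tags, lifting) empty_iff mem_Collect_eq zero_le_one)

lemma KS_ell_norm_le:
  assumes "T \<in> KA" "fibre_bounded T C" "C \<ge> 0" "e \<in> idempotents" "\<xi> \<in> l2_module X \<theta> e" "l2_norm e \<xi> \<le> 1"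
  shows "l2_norm e (KS_ell \<theta> e T \<xi>) \<le> C"
  by (rule l2_norm_le[OF KS_ell_partial_sums[OF assms]]) (use assms in auto)

lemma idempotents_nonempty: "(idempotents :: 's set) \<noteq> {}"
  using source_idempotent by blast

lemma l2_operator_norm_le:
  assumes "T \<in> KA" "fibre_bounded T C" "C \<ge> 0" "e \<in> idempotents"
  shows "l2_operator_norm X \<theta> e (KS_ell \<theta> e T) \<le> C"
  unfolding l2_operator_norm_def
  by (rule cSUP_least[OF l2_ball_nonempty]) (use KS_ell_norm_le[OF assms] in auto)

lemma reduced_norm_le:
  assumes "T \<in> KA" "fibre_bounded T C" "C \<ge> 0"
  shows "KS_reduced_norm X \<theta> T \<le> C"
  unfolding KS_reduced_norm_def
  by (rule cSUP_least[OF idempotents_nonempty l2_operator_norm_le[OF assms]])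

lemma KS_ell_norm_le_reduced_norm:
  assumes T: "T \<in> KA" and e: "e \<in> idempotents" and \<xi>: "\<xi> \<in> l2_module X \<theta> e" "l2_norm e \<xi> \<le> 1"
  shows "l2_norm e (KS_ell \<theta> e T \<xi>) \<le> KS_reduced_norm X \<theta> T"
proof -
  obtain C where C: "C \<ge> 0" "fibre_bounded T C" using fibre_bounded_exists[OF T] .
  have "l2_norm e (KS_ell \<theta> e T \<xi>) \<le> l2_operator_norm X \<theta> e (KS_ell \<theta> e T)"
    unfolding l2_operator_norm_def
  proof (rule cSUP_upper)
    show "bdd_above ((\<lambda>\<xi>. l2_norm e (KS_ell \<theta> e T \<xi>)) ` {\<xi> \<in> l2_module X \<theta> e. l2_norm e \<xi> \<le> 1})"
      using KS_ell_norm_le[OF T C(2,1) e] by (intro bdd_aboveI[of _ C]) auto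
  qed (use \<xi> in simp)
  also have "\<dots> \<le> KS_reduced_norm X \<theta> T"
    unfolding KS_reduced_norm_def
  proof (rule cSUP_upper)
    show "bdd_above ((\<lambda>e. l2_operator_norm X \<theta> e (KS_ell \<theta> e T)) ` idempotents)"
      using l2_operator_norm_le[OF T C(2,1)] by (intro bdd_aboveI[of _ C]) auto
  qed (use e in simp)
  finally show ?thesis .
qed

lemma reduced_norm_nonneg:
  assumes T: "T \<in> KA"
  shows "0 \<le> KS_reduced_norm X \<theta> T"
proof -
  obtain e :: 's where e: "e \<in> idempotents" using idempotents_nonempty by blast
  have "KS_ell \<theta> e T (\<lambda>_ _. 0) = (\<lambda>_ _. 0)"
    by (intro ext) (simp add: KS_ell_eq_fibre_op[OF KA_supp[OF T]] fibre_op_def cong: if_cong)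
  then show ?thesis
    using KS_ell_norm_le_reduced_norm[OF T e zero_l2_module] by (simp add: zero_l2_norm)
qed

text \<open>A vector of the fibre over \<open>x\<close> extends to a module element of the same norm by means of a bump
  function at \<open>x\<close>.\<close>

lemma fibre_bounded_reduced_norm:
  assumes T: "T \<in> KA"
  shows "fibre_bounded T (KS_reduced_norm X \<theta> T)"
proof (rule fibre_boundedI)
  fix e x \<zeta> assume e: "e \<in> idempotents" and x: "x \<in> act_dom \<theta> e" and \<zeta>: "\<zeta> \<in> vectors e"
  let ?N = "KS_reduced_norm X \<theta> T"
  have unit: "vnorm (fibre_op T x \<zeta>) \<le> ?N" if \<zeta>: "\<zeta> \<in> vectors e" and one: "vnorm \<zeta> = 1" for \<zeta>
  proof -
    have "x \<in> topspace X" using act_dom_subset_topspace[OF e] x by blast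
    then obtain b W where b: "\<And>y. 0 \<le> b y" "\<And>y. b y \<le> 1"
        "(\<lambda>y. complex_of_real (b y)) \<in> C0_on X (act_dom \<theta> e)" "{x} \<subseteq> W" "\<And>y. y \<in> W \<Longrightarrow> b y = 1"
      using C0_on_bump[OF locally_compact Hausdorff act_dom_open[OF e], of "{x}"] x
      by (metis compactin_sing empty_subsetI insert_subset)
    have bx: "b x = 1" using b by simp
    define \<xi> where "\<xi> t y = \<zeta> t * complex_of_real (b y)" for t y
    define h where "h y = complex_of_real ((b y)\<^sup>2)" for y
    have h: "h \<in> C0_on X (act_dom \<theta> e)"
      using C0_on_mult[OF Hausdorff b(3) b(3)] by (simp add: h_def[abs_def] power2_eq_square)
    have sum: "(\<Sum>t\<in>F. cnj (\<xi> t y) * \<xi> t y) = h y" if "finite F" "vsupp \<zeta> \<subseteq> F" for F y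
    proof -
      have "(\<Sum>t\<in>F. cnj (\<xi> t y) * \<xi> t y) = complex_of_real ((\<Sum>t\<in>F. (cmod (\<zeta> t))\<^sup>2) * (b y)\<^sup>2)"
        unfolding of_real_mult of_real_sum complex_norm_square sum_distrib_right
        by (intro sum.cong refl) (simp add: \<xi>_def power2_eq_square)
      also have "\<dots> = h y" using vnorm_power2[OF that] one by (simp add: h_def)
      finally show ?thesis .
    qed
    have off: "\<zeta> t = 0" if "t \<notin> source_fibre e" for t
      using \<zeta> that by (auto simp: vectors_def vsupp_def)
    have \<xi>: "\<xi> \<in> l2_module X \<theta> e"
      unfolding l2_module_def
    proof (intro CollectI conjI ballI allI impI bexI[OF _ h])
      show "\<xi> t \<in> C0_on X (act_dom \<theta> e)" for t
        unfolding \<xi>_def[abs_def] by (rule C0_on_cmult[OF b(3)])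
      show "\<xi> t = (\<lambda>_. 0)" if "t \<notin> source_fibre e" for t using off[OF that] by (simp add: \<xi>_def[abs_def])
      show "uniform_limit UNIV (\<lambda>F x. \<Sum>t\<in>F. cnj (\<xi> t x) * \<xi> t x) h (finite_subsets_at_top (source_fibre e))"
      proof (rule uniform_limitI)
        fix \<epsilon> :: real assume "\<epsilon> > 0"
        then show "\<forall>\<^sub>F F in finite_subsets_at_top (source_fibre e).
            \<forall>x\<in>UNIV. dist (\<Sum>t\<in>F. cnj (\<xi> t x) * \<xi> t x) (h x) < \<epsilon>"
          unfolding eventually_finite_subsets_at_top
          using \<zeta> sum by (intro exI[of _ "vsupp \<zeta>"]) (auto simp: vectors_def)
      qed
    qed
    have "l2_norm e \<xi> \<le> 1"
    proof (rule l2_norm_le)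
      fix F y assume F: "finite F" "F \<subseteq> source_fibre e"
      have "(\<Sum>t\<in>F. (cmod (\<xi> t y))\<^sup>2) \<le> (\<Sum>t\<in>F. (cmod (\<zeta> t))\<^sup>2)"
        using b(1,2)[of y]
        by (intro sum_mono power_mono) (auto simp: \<xi>_def norm_mult mult_left_le)
      also have "\<dots> \<le> (\<Sum>t\<in>F \<union> vsupp \<zeta>. (cmod (\<zeta> t))\<^sup>2)"
        using F vectors_finite[OF \<zeta>] by (intro sum_mono2) auto
      also have "\<dots> = 1\<^sup>2"
        using vnorm_power2[of "F \<union> vsupp \<zeta>" \<zeta>] F vectors_finite[OF \<zeta>] one by simp
      finally show "(\<Sum>t\<in>F. (cmod (\<xi> t y))\<^sup>2) \<le> 1\<^sup>2" .
    qed simp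
    note norm = KS_ell_norm_le_reduced_norm[OF T e \<xi> this]
    obtain C where C: "C \<ge> 0" "fibre_bounded T C" using fibre_bounded_exists[OF T] .
    let ?F = "vsupp (fibre_op T x \<zeta>)"
    have F: "finite ?F" "?F \<subseteq> source_fibre e"
      using fibre_op_vectors[OF T \<zeta>] by (auto simp: vectors_def)
    have eq: "KS_ell \<theta> e T \<xi> r x = fibre_op T x \<zeta> r" if "r \<in> source_fibre e" for r
    proof -
      have "(\<lambda>t. if t \<in> source_fibre e then \<xi> t x else 0) = \<zeta>"
        using off by (auto simp: \<xi>_def bx)
      then show ?thesis using that by (simp add: KS_ell_eq_fibre_op[OF KA_supp[OF T]])
    qed
    have "(vnorm (fibre_op T x \<zeta>))\<^sup>2 = (\<Sum>r\<in>?F. (cmod (fibre_op T x \<zeta> r))\<^sup>2)"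
      by (rule vnorm_power2[OF F(1) order_refl])
    also have "\<dots> = (\<Sum>r\<in>?F. (cmod (KS_ell \<theta> e T \<xi> r x))\<^sup>2)"
      by (intro sum.cong refl) (use F(2) eq in auto)
    also have "\<dots> \<le> ?N\<^sup>2"
      by (rule partial_sum_le_l2_norm[OF KS_ell_partial_sums[OF T C(2,1) e \<xi> \<open>l2_norm e \<xi> \<le> 1\<close>] norm F])
    finally show ?thesis by (rule power2_le_imp_le) (rule reduced_norm_nonneg[OF T])
  qed
  show "vnorm (fibre_op T x \<zeta>) \<le> ?N * vnorm \<zeta>"
  proof (cases "vnorm \<zeta> = 0")
    case True
    then have "\<zeta> = (\<lambda>_. 0)" using vnorm_zero_iff[OF vectors_finite[OF \<zeta>]] by auto
    then have "fibre_op T x \<zeta> = (\<lambda>_. 0)" by (simp add: fibre_op_def fun_eq_iff cong: if_cong)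
    then show ?thesis using True by (simp add: vnorm_def vsupp_def)
  next
    case False
    define c where "c = complex_of_real (inverse (vnorm \<zeta>))"
    have c: "c \<noteq> 0" "cmod c = inverse (vnorm \<zeta>)"
      unfolding c_def norm_of_real using False vnorm_nonneg[of \<zeta>] by simp_all
    have "vsupp (\<lambda>t. c * \<zeta> t) = vsupp \<zeta>" using c by (auto simp: vsupp_def)
    then have "(\<lambda>t. c * \<zeta> t) \<in> vectors e" using \<zeta> by (simp add: vectors_def)
    moreover have "vnorm (\<lambda>t. c * \<zeta> t) = 1" using c False by (simp add: vnorm_scale)
    ultimately have "vnorm (fibre_op T x (\<lambda>t. c * \<zeta> t)) \<le> ?N" by (rule unit)
    then have "inverse (vnorm \<zeta>) * vnorm (fibre_op T x \<zeta>) \<le> ?N"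
      using c by (simp add: fibre_op_scale_vector[abs_def] vnorm_scale)
    moreover have "vnorm \<zeta> > 0" using False vnorm_nonneg[of \<zeta>] by simp
    ultimately show ?thesis by (simp add: field_simps)
  qed
qed

lemma fibre_bounded_scale:
  assumes T: "T \<in> KA" and "fibre_bounded T C"
  shows "fibre_bounded (KS_scale c T) (cmod c * C)"
proof (rule fibre_boundedI)
  fix e x \<zeta> assume e: "e \<in> idempotents" "x \<in> act_dom \<theta> e" "\<zeta> \<in> vectors e"
  have "vnorm (fibre_op (KS_scale c T) x \<zeta>) = cmod c * vnorm (fibre_op T x \<zeta>)"
    by (simp add: fibre_op_scale[OF T, abs_def] vnorm_scale)
  also have "\<dots> \<le> cmod c * (C * vnorm \<zeta>)"
    by (intro mult_left_mono fibre_boundedD[OF assms(2) e]) simp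
  finally show "vnorm (fibre_op (KS_scale c T) x \<zeta>) \<le> cmod c * C * vnorm \<zeta>" by simp
qed

lemma fibre_bounded_mult:
  assumes T: "T \<in> KA" and U: "U \<in> KA" and C: "fibre_bounded T C" "C \<ge> 0" and D: "fibre_bounded U D"
  shows "fibre_bounded (T \<odot> U) (C * D)"
proof (rule fibre_boundedI)
  fix e x \<zeta> assume e: "e \<in> idempotents" "x \<in> act_dom \<theta> e" "\<zeta> \<in> vectors e"
  have "vnorm (fibre_op (T \<odot> U) x \<zeta>) \<le> C * vnorm (fibre_op U x \<zeta>)"
    unfolding fibre_op_mult[OF T U vectors_finite[OF e(3)]]
    by (rule fibre_boundedD[OF C(1) e(1,2) fibre_op_vectors[OF U e(3)]])
  also have "\<dots> \<le> C * (D * vnorm \<zeta>)" by (intro mult_left_mono fibre_boundedD[OF D e] C(2))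
  finally show "vnorm (fibre_op (T \<odot> U) x \<zeta>) \<le> C * D * vnorm \<zeta>" by simp
qed

lemma fibre_op_norm_square_le:
  assumes T: "T \<in> KA" and e: "e \<in> idempotents" "x \<in> act_dom \<theta> e" and \<zeta>: "\<zeta> \<in> vectors e"
  shows "(vnorm (fibre_op T x \<zeta>))\<^sup>2 \<le> vnorm \<zeta> * vnorm (fibre_op (KS_star T) x (fibre_op T x \<zeta>))"
proof -
  have S: "KS_star T \<in> KA" using T by simp
  note fin = vectors_finite[OF \<zeta>] finite_vsupp_fibre_op[OF T vectors_finite[OF \<zeta>]]
  have "(vnorm (fibre_op T x \<zeta>))\<^sup>2 = cmod (vdot (fibre_op T x \<zeta>) (fibre_op T x \<zeta>))"
    by (rule vdot_self[OF fin(2), symmetric])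
  also have "\<dots> = cmod (vdot \<zeta> (fibre_op (KS_star T) x (fibre_op T x \<zeta>)))"
    unfolding fibre_op_adjoint[OF T fin] ..
  also have "\<dots> \<le> vnorm \<zeta> * vnorm (fibre_op (KS_star T) x (fibre_op T x \<zeta>))"
    by (rule vdot_Cauchy_Schwarz[OF fin(1) finite_vsupp_fibre_op[OF S fin(2)]])
  finally show ?thesis .
qed

lemma reduced_norm_star_le:
  assumes T: "T \<in> KA"
  shows "KS_reduced_norm X \<theta> (KS_star T) \<le> KS_reduced_norm X \<theta> T"
proof -
  have S: "KS_star T \<in> KA" using T by simp
  let ?N = "KS_reduced_norm X \<theta> T"
  have "fibre_bounded (KS_star T) ?N"
  proof (rule fibre_boundedI)
    fix e x \<zeta> assume e: "e \<in> idempotents" "x \<in> act_dom \<theta> e" "\<zeta> \<in> vectors e"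
    let ?v = "vnorm (fibre_op (KS_star T) x \<zeta>)"
    have "?v\<^sup>2 \<le> vnorm \<zeta> * vnorm (fibre_op T x (fibre_op (KS_star T) x \<zeta>))"
      using fibre_op_norm_square_le[OF S e] T by simp
    also have "\<dots> \<le> vnorm \<zeta> * (?N * ?v)"
      by (intro mult_left_mono fibre_boundedD[OF fibre_bounded_reduced_norm[OF T] e(1,2)]
          fibre_op_vectors[OF S e(3)] vnorm_nonneg)
    finally have "?v * ?v \<le> (?N * vnorm \<zeta>) * ?v" by (simp add: power2_eq_square mult_ac)
    then show "?v \<le> ?N * vnorm \<zeta>"
      using vnorm_nonneg[of "fibre_op (KS_star T) x \<zeta>"] reduced_norm_nonneg[OF T] vnorm_nonneg[of \<zeta>]
      by (cases "?v = 0") (auto dest: mult_right_le_imp_le)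
  qed
  then show ?thesis by (rule reduced_norm_le[OF S _ reduced_norm_nonneg[OF T]])
qed

text \<open>The usual argument for operator norms, for the star-representations on the fibres.\<close>

theorem cstar_seminorm_reduced: "cstar_seminorm (KS_alg X \<theta>) (KS_reduced_norm X \<theta>)"
  unfolding cstar_seminorm_def KS_add
proof (intro conjI ballI allI)
  let ?N = "KS_reduced_norm X \<theta>"
  have scale_le: "?N (KS_scale c T) \<le> cmod c * ?N T" if T: "T \<in> KA" for c T
    by (intro reduced_norm_le fibre_bounded_scale fibre_bounded_reduced_norm T KS_scale_closed
        mult_nonneg_nonneg norm_ge_zero reduced_norm_nonneg)
  fix T assume T: "T \<in> KA"
  have S: "KS_star T \<in> KA" and ST: "KS_star T \<odot> T \<in> KA" using T by simp_all
  show "0 \<le> ?N T" by (rule reduced_norm_nonneg[OF T])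
  show "?N (KS_scale c T) = cmod c * ?N T" for c
  proof (cases "c = 0")
    case True
    then show ?thesis using scale_le[OF T, of 0] reduced_norm_nonneg[OF KS_scale_closed[OF T], of c] by simp
  next
    case False
    have "?N T \<le> cmod (inverse c) * ?N (KS_scale c T)"
      using scale_le[OF KS_scale_closed[OF T], of "inverse c" c] False by simp
    then have "cmod c * ?N T \<le> ?N (KS_scale c T)"
      using False by (simp add: norm_inverse norm_divide field_simps)
    with scale_le[OF T, of c] show ?thesis by simp
  qed
  have mult_le: "?N (V \<odot> U) \<le> ?N V * ?N U" if V: "V \<in> KA" and U: "U \<in> KA" for V U
    by (intro reduced_norm_le fibre_bounded_mult fibre_bounded_reduced_norm V U KS_mult_closed
        mult_nonneg_nonneg reduced_norm_nonneg)
  show "?N (KS_star T \<odot> T) = (?N T)\<^sup>2"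
  proof (rule antisym)
    have "?N (KS_star T \<odot> T) \<le> ?N (KS_star T) * ?N T" by (rule mult_le[OF S T])
    also have "\<dots> \<le> ?N T * ?N T" by (intro mult_right_mono reduced_norm_star_le reduced_norm_nonneg T)
    finally show "?N (KS_star T \<odot> T) \<le> (?N T)\<^sup>2" by (simp add: power2_eq_square)
    have "fibre_bounded T (sqrt (?N (KS_star T \<odot> T)))"
    proof (rule fibre_boundedI)
      fix e x \<zeta> assume e: "e \<in> idempotents" "x \<in> act_dom \<theta> e" "\<zeta> \<in> vectors e"
      have "(vnorm (fibre_op T x \<zeta>))\<^sup>2 \<le> vnorm \<zeta> * vnorm (fibre_op (KS_star T \<odot> T) x \<zeta>)"
        using fibre_op_norm_square_le[OF T e] unfolding fibre_op_mult[OF S T vectors_finite[OF e(3)]] .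
      also have "\<dots> \<le> vnorm \<zeta> * (?N (KS_star T \<odot> T) * vnorm \<zeta>)"
        by (intro mult_left_mono fibre_boundedD[OF fibre_bounded_reduced_norm[OF ST] e] vnorm_nonneg)
      also have "\<dots> = (sqrt (?N (KS_star T \<odot> T)) * vnorm \<zeta>)\<^sup>2"
        using reduced_norm_nonneg[OF ST] by (simp add: power_mult_distrib power2_eq_square)
      finally show "vnorm (fibre_op T x \<zeta>) \<le> sqrt (?N (KS_star T \<odot> T)) * vnorm \<zeta>"
        by (rule power2_le_imp_le) (intro mult_nonneg_nonneg vnorm_nonneg real_sqrt_ge_zero reduced_norm_nonneg ST)
    qed
    then have "?N T \<le> sqrt (?N (KS_star T \<odot> T))"
      by (rule reduced_norm_le[OF T]) (intro real_sqrt_ge_zero reduced_norm_nonneg ST)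
    then have "(?N T)\<^sup>2 \<le> (sqrt (?N (KS_star T \<odot> T)))\<^sup>2"
      by (rule power_mono) (rule reduced_norm_nonneg[OF T])
    then show "(?N T)\<^sup>2 \<le> ?N (KS_star T \<odot> T)" using reduced_norm_nonneg[OF ST] by simp
  qed
  fix U assume U: "U \<in> KA"
  show "?N (T + U) \<le> ?N T + ?N U"
    by (intro reduced_norm_le fibre_bounded_add fibre_bounded_reduced_norm T U KS_add_closed
        add_nonneg_nonneg reduced_norm_nonneg)
  show "?N (T \<odot> U) \<le> ?N T * ?N U" by (rule mult_le[OF T U])
qed

text \<open>The matrix coefficient of \<open>\<ell>\<^sub>e(U \<delta>\<^sub>e b - \<delta>\<^sub>e b)\<close> at the basis vector \<open>e\<close>, over the point \<open>x\<close>: of the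
  components of \<open>U\<close>, exactly those at elements above \<open>e\<close> map this basis vector to itself.\<close>

lemma reduced_norm_coefficient:
  assumes U: "U \<in> KA" and e: "e \<in> idempotents" and x: "x \<in> act_dom \<theta> e"
    and b: "b \<in> C0_on X (act_dom \<theta> e)"
  shows "cmod (b x) * cmod ((\<Sum>s | s \<in> supp U \<and> e \<preceq> s. U s x) - 1)
    \<le> KS_reduced_norm X \<theta> (U \<odot> delta e b - delta e b)"
proof -
  let ?D = "delta e b" and ?w = "\<lambda>t. if t = e then 1 else (0::complex)"
  let ?V = "U \<odot> ?D - ?D"
  have ee: "e * e = e" and se: "e\<^sup>\<star> = e" using e by (simp_all add: idempotents_iff sinv_idempotent)
  have D: "?D \<in> KA" by (rule delta_idempotent_closed[OF e b])
  have UD: "U \<odot> ?D \<in> KA" and mD: "- ?D \<in> KA" and V: "?V \<in> KA" using U D by simp_all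
  have nz1: "vsupp ?w = {e}" by (auto simp: vsupp_def)
  have one: "?w \<in> vectors e" by (simp add: vectors_def nz1 source_fibre_def se ee)
  have vn1: "vnorm ?w = 1" unfolding vnorm_def nz1 by (simp add: L2_set_def)
  have fibD: "fibre_op ?D x ?w = (\<lambda>t. b x * ?w t)"
  proof
    fix r
    have "fibre_op ?D x ?w r = (if e * r = r then pull (e * r) b x * ?w (e * r) else 0)"
      using fibre_op_superset[of "{e}" ?D, OF _ supp_delta] by (simp add: delta_def se ee)
    then show "fibre_op ?D x ?w r = b x * ?w r"
      using x by (auto simp: ee pull_idempotent[OF e])
  qed
  have coeff: "fibre_op U x ?w e = (\<Sum>s | s \<in> supp U \<and> e \<preceq> s. U s x)"
  proof -
    have iff: "s * s\<^sup>\<star> * e = e \<and> s\<^sup>\<star> * e = e \<longleftrightarrow> e \<preceq> s" for s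
    proof
      assume "s * s\<^sup>\<star> * e = e \<and> s\<^sup>\<star> * e = e"
      then have 1: "s * (s\<^sup>\<star> * e) = e" and 2: "s\<^sup>\<star> * e = e" unfolding mult.assoc by blast+
      have "s * e = e" using 1 unfolding 2 .
      then show "e \<preceq> s" using e by (simp add: natural_le_idempotent)
    next
      assume le: "e \<preceq> s"
      then have 1: "s * e = e" using e by (simp add: natural_le_idempotent)
      have 2: "s\<^sup>\<star> * s * e = e"
        using natural_le_imp_le_source[OF e le] e by (simp add: natural_le_idempotent)
      have "s\<^sup>\<star> * e = e" using 2 unfolding mult.assoc 1 .
      then show "s * s\<^sup>\<star> * e = e \<and> s\<^sup>\<star> * e = e" using 1 by (simp add: mult.assoc)
    qed
    have "fibre_op U x ?w e = (\<Sum>s\<in>supp U. if e \<preceq> s then U s x else 0)"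
      unfolding fibre_op_def
    proof (intro sum.cong refl)
      fix s
      show "(if s * s\<^sup>\<star> * e = e then pull (s\<^sup>\<star> * e) (U s) x * ?w (s\<^sup>\<star> * e) else 0)
          = (if e \<preceq> s then U s x else 0)"
        unfolding iff[symmetric] using x by (auto simp: pull_idempotent[OF e])
    qed
    then show ?thesis by (simp add: sum.inter_filter[OF KA_supp[OF U]])
  qed
  have minus: "fibre_op (- ?D) x ?w e = - (b x)"
    using fibre_op_scale[OF D, of "-1" x ?w e] unfolding fibD by (simp add: KS.scale_minus_one)
  have "fibre_op ?V x ?w e = fibre_op (U \<odot> ?D) x ?w e + fibre_op (- ?D) x ?w e"
    unfolding diff_conv_add_uminus[of "U \<odot> ?D"] by (rule fibre_op_add[OF UD mD])
  also have "fibre_op (U \<odot> ?D) x ?w e = b x * fibre_op U x ?w e"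
    unfolding fibre_op_mult[OF U D vectors_finite[OF one]] fibD by (rule fibre_op_scale_vector)
  also have "b x * fibre_op U x ?w e + fibre_op (- ?D) x ?w e = b x * ((\<Sum>s | s \<in> supp U \<and> e \<preceq> s. U s x) - 1)"
    unfolding minus coeff right_diff_distrib mult_1_right by (rule diff_conv_add_uminus[symmetric])
  finally have fibV: "fibre_op ?V x ?w e = b x * ((\<Sum>s | s \<in> supp U \<and> e \<preceq> s. U s x) - 1)" .
  have "cmod (b x) * cmod ((\<Sum>s | s \<in> supp U \<and> e \<preceq> s. U s x) - 1) = cmod (fibre_op ?V x ?w e)"
    unfolding fibV by (rule norm_mult[symmetric])
  also have "\<dots> \<le> vnorm (fibre_op ?V x ?w)"
  proof -
    have F: "finite (insert e (vsupp (fibre_op ?V x ?w)))"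
      using finite_vsupp_fibre_op[OF V vectors_finite[OF one]] by simp
    have "(cmod (fibre_op ?V x ?w e))\<^sup>2 \<le> (vnorm (fibre_op ?V x ?w))\<^sup>2"
      unfolding vnorm_power2[OF F subset_insertI] by (rule member_le_sum) (use F in auto)
    then show ?thesis by (rule power2_le_imp_le) (rule vnorm_nonneg)
  qed
  also have "\<dots> \<le> KS_reduced_norm X \<theta> ?V"
    using fibre_boundedD[OF fibre_bounded_reduced_norm[OF V] e x one] by (simp add: vn1)
  finally show ?thesis .
qed

end

section \<open>From covers to units\<close>

context locally_compact_action
begin

lemma KA_induct [consumes 1, case_names zero add delta]:
  assumes T: "T \<in> KA" and zero: "P 0"
    and add: "\<And>T U. T \<in> KA \<Longrightarrow> U \<in> KA \<Longrightarrow> P T \<Longrightarrow> P U \<Longrightarrow> P (T + U)"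
    and delta: "\<And>s c. c \<in> C0_on X (act_dom \<theta> (s\<^sup>\<star> * s)) \<Longrightarrow> P (delta s c)"
  shows "P T"
proof -
  have "P (\<Sum>s\<in>F. delta s (T s))" if "finite F" for F
    using that
  proof (induction F rule: finite_induct)
    case (insert s F)
    show ?case unfolding sum.insert[OF insert.hyps]
      by (intro add delta delta_closed insert.IH delta_decomposition insert.hyps KA_C0[OF T])
  next
    case empty
    show ?case unfolding sum.empty by (rule zero)
  qed
  from this[OF KA_supp[OF T]] show ?thesis unfolding KA_decomposition[OF T, symmetric] .
qed

end

context KS_seminorm
begin

context
  fixes f :: "nat \<Rightarrow> 's" and a :: "nat \<Rightarrow> 'x \<Rightarrow> real"
  assumes f: "\<And>i. f i \<in> idempotents"
    and a: "\<And>i. (\<lambda>x. complex_of_real (a i x)) \<in> C0_on X (act_dom \<theta> (f i))"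
    and a0: "\<And>i x. 0 \<le> a i x" and a1: "\<And>i x. a i x \<le> 1"
begin

definition bump :: "nat \<Rightarrow> 's \<Rightarrow> 'x \<Rightarrow> complex"
  where "bump i = delta (f i) (\<lambda>x. complex_of_real (a i x))"

text \<open>\<open>partial_unit n\<close> is \<open>1 - (1 - bump 0) \<dots> (1 - bump (n - 1))\<close>.\<close>

primrec partial_unit :: "nat \<Rightarrow> 's \<Rightarrow> 'x \<Rightarrow> complex" where
  "partial_unit 0 = 0"
| "partial_unit (Suc n) = partial_unit n + bump n - bump n \<odot> partial_unit n"

definition residual :: "nat \<Rightarrow> ('s \<Rightarrow> 'x \<Rightarrow> complex) \<Rightarrow> ('s \<Rightarrow> 'x \<Rightarrow> complex)"
  where "residual n T = T - partial_unit n \<odot> T"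

lemma bump_closed: "bump i \<in> KA"
  unfolding bump_def by (rule delta_idempotent_closed[OF f a])

lemma bump_star: "KS_star (bump i) = bump i"
  unfolding bump_def delta_star_idempotent[OF f a] by simp

lemma bump_commute: "bump i \<odot> bump j = bump j \<odot> bump i"
  unfolding bump_def delta_mult_idempotent[OF f a] idempotent_commute[OF f[of i] f[of j]]
  by (simp add: mult.commute)

lemma partial_unit_closed: "partial_unit n \<in> KA"
proof (induction n)
  case 0
  show ?case unfolding partial_unit.simps by (rule KS.zero_closed)
next
  case (Suc n)
  show ?case unfolding partial_unit.simps
    by (intro KS.diff_closed KS.add_closed KS.mult_closed Suc bump_closed)
qed

lemma bump_partial_unit_commute: "bump i \<odot> partial_unit n = partial_unit n \<odot> bump i"
proof (induction n)
  case 0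
  show ?case unfolding partial_unit.simps KS.mult_zero_left[OF bump_closed] KS.mult_zero_right[OF bump_closed] ..
next
  case (Suc n)
  note cl = bump_closed[of i] bump_closed[of n] partial_unit_closed[of n]
  have "bump i \<odot> (bump n \<odot> partial_unit n) = bump n \<odot> partial_unit n \<odot> bump i"
    using KS.mult_assoc[OF cl(1,2,3)] KS.mult_assoc[OF cl(2,1,3)] KS.mult_assoc[OF cl(2,3,1)]
    by (simp only: bump_commute[of i n] Suc)
  then show ?case
    unfolding partial_unit.simps
    by (simp only: KS.mult_diff_left KS.mult_diff_right KS.mult_add_left KS.mult_add_right cl
        KS.add_closed KS.mult_closed Suc bump_commute[of i n])
qed

lemma partial_unit_star: "KS_star (partial_unit n) = partial_unit n"
proof (induction n)
  case 0
  show ?case unfolding partial_unit.simps by (rule KS.star_zero)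
next
  case (Suc n)
  note cl = bump_closed[of n] partial_unit_closed[of n]
  show ?case
    unfolding partial_unit.simps
    by (simp only: KS.star_diff KS.star_add KS.star_mult KS.add_closed KS.mult_closed cl Suc bump_star
        bump_partial_unit_commute)
qed

lemma residual_closed: "T \<in> KA \<Longrightarrow> residual n T \<in> KA"
  unfolding residual_def by (intro KS.diff_closed KS.mult_closed partial_unit_closed)

lemma residual_Suc:
  assumes T: "T \<in> KA"
  shows "residual (Suc n) T = residual n T - bump n \<odot> residual n T"
proof -
  note cl = bump_closed[of n] partial_unit_closed[of n] T
  have 1: "partial_unit (Suc n) \<odot> T = partial_unit n \<odot> T + bump n \<odot> T - bump n \<odot> (partial_unit n \<odot> T)"
    unfolding partial_unit.simps
    by (simp only: KS.mult_diff_left KS.mult_add_left KS.mult_assoc KS.add_closed KS.mult_closed cl)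
  have 2: "bump n \<odot> (T - partial_unit n \<odot> T) = bump n \<odot> T - bump n \<odot> (partial_unit n \<odot> T)"
    by (simp only: KS.mult_diff_right KS.mult_closed cl)
  have rearrange: "t - (u + b - v) = t - u - (b - v)" for t u b v :: "'g::ab_group_add"
    by simp
  show ?thesis unfolding residual_def 1 2 by (rule rearrange)
qed

lemma residual_Suc':
  assumes T: "T \<in> KA"
  shows "residual (Suc n) T = residual n (T - bump n \<odot> T)"
proof -
  note cl = bump_closed[of n] partial_unit_closed[of n] T
  have "bump n \<odot> (partial_unit n \<odot> T) = partial_unit n \<odot> (bump n \<odot> T)"
    using KS.mult_assoc[OF cl(1,2,3)] KS.mult_assoc[OF cl(2,1,3)] by (simp only: bump_partial_unit_commute)
  then have "bump n \<odot> residual n T = residual n (bump n \<odot> T)"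
    unfolding residual_def by (simp only: KS.mult_diff_right KS.mult_closed cl)
  moreover have "residual n (T - bump n \<odot> T) = residual n T - residual n (bump n \<odot> T)"
    unfolding residual_def by (simp only: KS.mult_diff_right KS.mult_closed cl algebra_simps)
  ultimately show ?thesis unfolding residual_Suc[OF T] by simp
qed

lemma norm_residual_Suc_le: "T \<in> KA \<Longrightarrow> p (residual (Suc n) T) \<le> p (residual n T)"
  unfolding residual_Suc bump_def by (rule norm_one_minus_delta[OF f a a0 a1 residual_closed])

lemma norm_residual_le: "T \<in> KA \<Longrightarrow> p (residual n T) \<le> p T"
proof (induction n)
  case 0
  show ?case unfolding residual_def partial_unit.simps KS.mult_zero_left[OF 0] by simp
next
  case (Suc n)
  then show ?case using norm_residual_Suc_le[OF Suc.prems, of n] by linarith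
qed

text \<open>The factors with \<open>f i \<ge> e\<close> act on \<open>\<delta>\<^sub>e b\<close> by multiplying \<open>b\<close> with \<open>1 - a i\<close>. As all factors commute, these
  can be applied first, and the other factors are contractions.\<close>

lemma norm_residual_delta:
  assumes e: "e \<in> idempotents" and b: "b \<in> C0_on X (act_dom \<theta> e)"
    and B: "\<And>x. (\<And>i. i < n \<Longrightarrow> e \<preceq> f i \<Longrightarrow> a i x \<noteq> 1) \<Longrightarrow> cmod (b x) \<le> \<epsilon>" and \<epsilon>: "\<epsilon> \<ge> 0"
  shows "p (residual n (delta e b)) \<le> \<epsilon>"
  using b B
proof (induction n arbitrary: b)
  case 0
  have "p (residual 0 (delta e b)) \<le> p (delta e b)"
    by (rule norm_residual_le[OF delta_idempotent_closed[OF e 0(1)]])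
  also have "\<dots> \<le> \<epsilon>"
    by (rule norm_delta_le) (use e 0 \<epsilon> in \<open>simp_all add: sinv_idempotent idempotents_iff\<close>)
  finally show ?case .
next
  case (Suc n)
  have D: "delta e b \<in> KA" by (rule delta_idempotent_closed[OF e Suc.prems(1)])
  show ?case
  proof (cases "e \<preceq> f n")
    case False
    have "p (residual n (delta e b)) \<le> \<epsilon>"
      using Suc.prems(2) False by (intro Suc.IH Suc.prems(1)) (metis less_SucE)
    then show ?thesis using norm_residual_Suc_le[OF D, of n] by linarith
  next
    case True
    let ?b = "\<lambda>x. b x + (-1) * (complex_of_real (a n x) * b x)"
    have fe: "f n * e = e" using True e by (simp add: natural_le_idempotent)
    have sub: "act_dom \<theta> (f n) \<inter> act_dom \<theta> e = act_dom \<theta> e"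
      using act_dom_mono[OF e f True] by blast
    have ab: "(\<lambda>x. complex_of_real (a n x) * b x) \<in> C0_on X (act_dom \<theta> e)"
      using C0_on_mult[OF Hausdorff a Suc.prems(1), of n] unfolding sub .
    have b': "?b \<in> C0_on X (act_dom \<theta> e)" by (intro C0_on_add C0_on_cmult Suc.prems(1) ab)
    have "bump n \<odot> delta e b = delta e (\<lambda>x. complex_of_real (a n x) * b x)"
      unfolding bump_def delta_mult_idempotent[OF e Suc.prems(1)] fe ..
    then have "delta e b - bump n \<odot> delta e b = delta e ?b"
      by (auto simp: delta_def fun_eq_iff)
    then have "residual (Suc n) (delta e b) = residual n (delta e ?b)"
      unfolding residual_Suc'[OF D] by simp
    moreover have "p (residual n (delta e ?b)) \<le> \<epsilon>"
    proof (rule Suc.IH[OF b'])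
      fix x assume x: "\<And>i. i < n \<Longrightarrow> e \<preceq> f i \<Longrightarrow> a i x \<noteq> 1"
      have eq: "?b x = complex_of_real (1 - a n x) * b x" by (simp add: algebra_simps)
      show "cmod (?b x) \<le> \<epsilon>"
      proof (cases "a n x = 1")
        case True
        then show ?thesis unfolding eq using \<epsilon> by simp
      next
        case False
        then have "cmod (b x) \<le> \<epsilon>" using x by (intro Suc.prems(2)) (metis less_SucE)
        moreover have "cmod (?b x) \<le> 1 * cmod (b x)"
          unfolding eq norm_mult norm_of_real using a0[of n x] a1[of n x] by (intro mult_right_mono) auto
        ultimately show ?thesis by simp
      qed
    qed
    ultimately show ?thesis by simp
  qed
qed

text \<open>A general \<open>\<delta>\<^sub>s c\<close> reduces to the idempotent case, as \<open>\<delta>\<^sub>s c (\<delta>\<^sub>s c)\<^sup>*\<close> lives on \<open>s s\<^sup>*\<close>.\<close>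

lemma norm_residual_square_le:
  assumes T: "T \<in> KA"
  shows "(p (residual n T))\<^sup>2 \<le> p (residual n (T \<odot> KS_star T))"
proof -
  let ?u = "partial_unit n" and ?S = "KS_star T" and ?R = "residual n T"
  note u = partial_unit_closed[of n] and us = partial_unit_star[of n]
  have S: "?S \<in> KA" and R: "?R \<in> KA" using T by (simp_all add: residual_closed)
  have w: "?R \<odot> ?S = residual n (T \<odot> ?S)"
    unfolding residual_def by (simp only: KS.mult_diff_left KS.mult_assoc KS.mult_closed u T S)
  let ?w = "residual n (T \<odot> ?S)"
  have W: "?w \<in> KA" by (intro residual_closed KS.mult_closed T S)
  have "KS_star ?R = ?S - ?S \<odot> ?u"
    unfolding residual_def by (simp only: KS.star_diff KS.star_mult KS.mult_closed u us T)
  then have RR: "?R \<odot> KS_star ?R = ?w - ?w \<odot> ?u"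
    using KS.mult_assoc[OF R S u] by (simp only: KS.mult_diff_right KS.mult_closed R S u w)
  have "KS_star (?w - ?w \<odot> ?u) = residual n (KS_star ?w)"
    unfolding residual_def[of n "KS_star ?w"]
    by (simp only: KS.star_diff KS.star_mult KS.mult_closed W u us)
  then have "p (?w - ?w \<odot> ?u) = p (residual n (KS_star ?w))"
    using KS.norm_star[of "?w - ?w \<odot> ?u"] W u by simp
  also have "\<dots> \<le> p (KS_star ?w)" by (rule norm_residual_le[OF KS.star_closed[OF W]])
  also have "\<dots> = p ?w" by (rule KS.norm_star[OF W])
  finally have "p (?R \<odot> KS_star ?R) \<le> p ?w" unfolding RR .
  then show ?thesis
    using KS.norm_cstar[OF KS.star_closed[OF R]] KS.norm_star[OF R] R by simp
qed

lemma delta_mult_star: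
  assumes c: "c \<in> C0_on X (act_dom \<theta> (s\<^sup>\<star> * s))"
  obtains b where "b \<in> C0_on X (act_dom \<theta> (s * s\<^sup>\<star>))"
    "delta s c \<odot> KS_star (delta s c) = delta (s * s\<^sup>\<star>) b"
proof -
  let ?Z = "delta s c \<odot> KS_star (delta s c)"
  have D: "delta s c \<in> KA" by (rule delta_closed[OF c])
  have "?Z \<in> KA" by (intro KS.mult_closed KS.star_closed D)
  then have "?Z (s * s\<^sup>\<star>) \<in> C0_on X (act_dom \<theta> ((s * s\<^sup>\<star>)\<^sup>\<star> * (s * s\<^sup>\<star>)))" by (rule KA_C0)
  then have "?Z (s * s\<^sup>\<star>) \<in> C0_on X (act_dom \<theta> (s * s\<^sup>\<star>))"
    by (simp add: sinv_mult sinv_sinv mult.assoc)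
  moreover have "?Z = delta (s * s\<^sup>\<star>) (?Z (s * s\<^sup>\<star>))"
    unfolding KS_star_delta KS_mult_delta by (simp add: delta_def fun_eq_iff)
  ultimately show ?thesis using that by blast
qed

lemma residual_add: "T \<in> KA \<Longrightarrow> U \<in> KA \<Longrightarrow> residual n (T + U) = residual n T + residual n U"
  unfolding residual_def by (simp only: KS.mult_add_right partial_unit_closed algebra_simps)

lemma residual_zero: "residual n 0 = 0"
  unfolding residual_def KS.mult_zero_right[OF partial_unit_closed] by simp

lemma norm_residual_zero:
  assumes cover: "\<And>e x. e \<in> idempotents \<Longrightarrow> x \<in> act_dom \<theta> e \<Longrightarrow> \<exists>i<n. e \<preceq> f i \<and> a i x = 1"
    and T: "T \<in> KA"
  shows "p (residual n T) = 0"
  using T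
proof (induction rule: KA_induct)
  case zero
  show ?case unfolding residual_zero by (rule KS.norm_zero)
next
  case (add T U)
  have "p (residual n (T + U)) \<le> p (residual n T) + p (residual n U)"
    unfolding residual_add[OF add(1,2)] by (rule KS.norm_add[OF residual_closed residual_closed]) fact+
  moreover have "0 \<le> p (residual n (T + U))"
    by (rule KS.norm_nonneg[OF residual_closed[OF KS.add_closed[OF add(1,2)]]])
  ultimately show ?case using add(3,4) by linarith
next
  case (delta s c)
  obtain b where b: "b \<in> C0_on X (act_dom \<theta> (s * s\<^sup>\<star>))"
      "delta s c \<odot> KS_star (delta s c) = delta (s * s\<^sup>\<star>) b"
    using delta_mult_star[OF delta] .
  have "p (residual n (delta (s * s\<^sup>\<star>) b)) \<le> 0"
  proof (rule norm_residual_delta[OF range_idempotent b(1)])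
    fix x assume no: "\<And>i. i < n \<Longrightarrow> s * s\<^sup>\<star> \<preceq> f i \<Longrightarrow> a i x \<noteq> 1"
    then have "x \<notin> act_dom \<theta> (s * s\<^sup>\<star>)" using cover[OF range_idempotent] by blast
    then show "cmod (b x) \<le> 0" using C0_on_off[OF b(1)] by simp
  qed simp
  then have "(p (residual n (delta s c)))\<^sup>2 \<le> 0"
    using norm_residual_square_le[OF delta_closed[OF delta], of n] unfolding b(2) by linarith
  then show ?case by simp
qed

lemma residual_tendsto_zero:
  assumes W: "\<And>i. openin X (W i)" "\<And>i x. x \<in> W i \<Longrightarrow> a i x = 1"
    and cover: "\<And>e x. e \<in> idempotents \<Longrightarrow> x \<in> act_dom \<theta> e \<Longrightarrow> \<exists>i. e \<preceq> f i \<and> x \<in> W i"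
    and T: "T \<in> KA"
  shows "(\<lambda>n. p (residual n T)) \<longlonglongrightarrow> 0"
  using T
proof (induction rule: KA_induct)
  case zero
  show ?case unfolding residual_zero KS.norm_zero by simp
next
  case (add T U)
  have lim: "(\<lambda>n. p (residual n T) + p (residual n U)) \<longlonglongrightarrow> 0"
    using tendsto_add[OF add(3,4)] by simp
  have le: "p (residual n (T + U)) \<le> p (residual n T) + p (residual n U)" for n
    unfolding residual_add[OF add(1,2)] by (rule KS.norm_add[OF residual_closed residual_closed]) fact+
  have nn: "0 \<le> p (residual n (T + U))" for n
    by (rule KS.norm_nonneg[OF residual_closed[OF KS.add_closed[OF add(1,2)]]])
  show ?case
    by (rule tendsto_sandwich[OF always_eventually[OF allI[OF nn]] always_eventually[OF allI[OF le]]
          tendsto_const lim])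
next
  case (delta s c)
  let ?e = "s * s\<^sup>\<star>"
  obtain b where b: "b \<in> C0_on X (act_dom \<theta> ?e)" "delta s c \<odot> KS_star (delta s c) = delta ?e b"
    using delta_mult_star[OF delta] .
  have nn: "0 \<le> p (residual n (delta s c))" for n
    by (rule KS.norm_nonneg[OF residual_closed[OF delta_closed[OF delta]]])
  show ?case
  proof (rule LIMSEQ_I)
    fix r :: real assume r: "r > 0"
    define \<epsilon> where "\<epsilon> = r\<^sup>2 / 2"
    have \<epsilon>: "\<epsilon> > 0" using r by (simp add: \<epsilon>_def)
    define K where "K = {x \<in> act_dom \<theta> ?e. \<epsilon> \<le> cmod (b x)}"
    have "compactin X K" unfolding K_def by (rule C0_on_compact[OF b(1) \<epsilon>])
    moreover have "\<forall>B\<in>W ` {i. ?e \<preceq> f i}. openin X B" using W(1) by auto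
    moreover have "K \<subseteq> \<Union>(W ` {i. ?e \<preceq> f i})"
      using cover[OF range_idempotent] by (fastforce simp: K_def)
    ultimately obtain \<F> where "finite \<F>" "\<F> \<subseteq> W ` {i. ?e \<preceq> f i}" "K \<subseteq> \<Union>\<F>"
      unfolding compactin_def by meson
    then obtain I where I: "finite I" "I \<subseteq> {i. ?e \<preceq> f i}" "K \<subseteq> \<Union>(W ` I)"
      by (metis finite_subset_image)
    obtain N where N: "\<forall>i\<in>I. i < N" using I(1) unfolding finite_nat_set_iff_bounded by (rule exE)
    have "p (residual n (delta s c)) < r" if n: "n \<ge> N" for n
    proof -
      have "p (residual n (delta ?e b)) \<le> \<epsilon>"
      proof (rule norm_residual_delta[OF range_idempotent b(1)])
        fix x assume no: "\<And>i. i < n \<Longrightarrow> ?e \<preceq> f i \<Longrightarrow> a i x \<noteq> 1"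
        show "cmod (b x) \<le> \<epsilon>"
        proof (cases "x \<in> K")
          case True
          then obtain i where i: "i \<in> I" "x \<in> W i" using I(3) by auto
          then have "i < n" "?e \<preceq> f i" "a i x = 1" using bspec[OF N i(1)] n I(2) W(2) i by auto
          then show ?thesis using no by auto
        next
          case False
          then show ?thesis
            using C0_on_off[OF b(1), of x] \<epsilon> by (cases "x \<in> act_dom \<theta> ?e") (auto simp: K_def)
        qed
      qed (use \<epsilon> in simp)
      then have "(p (residual n (delta s c)))\<^sup>2 \<le> \<epsilon>"
        using norm_residual_square_le[OF delta_closed[OF delta], of n] unfolding b(2) by linarith
      also have "\<epsilon> < r\<^sup>2" using r by (simp add: \<epsilon>_def)
      finally show ?thesis by (rule power2_less_imp_less) (use r in simp)
    qed
    then show "\<exists>N. \<forall>n\<ge>N. norm (p (residual n (delta s c)) - 0) < r"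
      using nn by auto
  qed
qed

lemma unital_completion_if_finite_cover:
  assumes "\<And>e x. e \<in> idempotents \<Longrightarrow> x \<in> act_dom \<theta> e \<Longrightarrow> \<exists>i<n. e \<preceq> f i \<and> a i x = 1"
  shows "unital_alg (completion_alg (KS_alg X \<theta>) p)"
proof (rule KS.unital_completionI[OF partial_unit_closed[of n]])
  fix T assume T: "T \<in> KA"
  note u = partial_unit_closed[of n]
  have eq: "p (partial_unit n \<odot> U - U) = 0" if "U \<in> KA" for U
    using norm_residual_zero[OF assms that] KS.norm_minus_commute[OF that KS.mult_closed[OF u that]]
    unfolding residual_def by simp
  show "p (partial_unit n \<odot> T - T) = 0" by (rule eq[OF T])
  have "KS_star (T \<odot> partial_unit n - T) = partial_unit n \<odot> KS_star T - KS_star T"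
    by (simp only: KS.star_diff KS.star_mult KS.mult_closed u T partial_unit_star)
  then show "p (T \<odot> partial_unit n - T) = 0"
    using KS.norm_star[of "T \<odot> partial_unit n - T"] eq[OF KS.star_closed[OF T]] T u by simp
qed

lemma sigma_unital_completion_if_countable_cover:
  assumes W: "\<And>i. openin X (W i)" "\<And>i x. x \<in> W i \<Longrightarrow> a i x = 1"
    and cover: "\<And>e x. e \<in> idempotents \<Longrightarrow> x \<in> act_dom \<theta> e \<Longrightarrow> \<exists>i. e \<preceq> f i \<and> x \<in> W i"
  shows "sigma_unital_alg (completion_alg (KS_alg X \<theta>) p)"
proof -
  have contr: "p (T - partial_unit n \<odot> T) \<le> p T" if "T \<in> KA" for n T
    using norm_residual_le[OF that] unfolding residual_def .
  have lim: "(\<lambda>n. p (partial_unit n \<odot> T - T)) \<longlonglongrightarrow> 0" if T: "T \<in> KA" for T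
    using residual_tendsto_zero[OF W cover T]
    unfolding residual_def KS.norm_minus_commute[OF T KS.mult_closed[OF partial_unit_closed T]] .
  show ?thesis
    by (rule KS.contractive_approximate_unit[of partial_unit])
      (use partial_unit_closed partial_unit_star contr lim KS.sigma_unital_completionI in \<open>blast+\<close>)
qed

end

text \<open>The functions equal \<open>1\<close> on neighbourhoods of the compact sets of the cover, so that compactness
  of the sets \<open>{\<bar>b\<bar> \<ge> \<epsilon>}\<close> takes effect. The cover is made nonempty by a pair \<open>(e, {})\<close>, so that it can be
  listed as a sequence.\<close>

proposition
  assumes P: "compact_family_cover X \<theta> P"
  shows unital_completion_of_finite_cover:
      "finite P \<Longrightarrow> unital_alg (completion_alg (KS_alg X \<theta>) p)"
    and sigma_unital_completion_of_countable_cover: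
      "countable P \<Longrightarrow> sigma_unital_alg (completion_alg (KS_alg X \<theta>) p)"
proof -
  obtain e0 :: 's where e0: "e0 \<in> idempotents" using idempotents_nonempty by blast
  define Q where "Q = insert (e0, {}) P"
  have pairs: "fst q \<in> idempotents \<and> snd q \<subseteq> act_dom \<theta> (fst q) \<and> compactin X (snd q)" if "q \<in> Q" for q
    using that P e0 by (cases q) (auto simp: Q_def compact_family_cover_def)
  let ?g = "from_nat_into Q"
  have gQ: "?g i \<in> Q" for i by (rule from_nat_into) (simp add: Q_def)
  have "\<exists>a W. (\<forall>x. 0 \<le> (a x :: real)) \<and> (\<forall>x. a x \<le> 1) \<and>
      (\<lambda>x. complex_of_real (a x)) \<in> C0_on X (act_dom \<theta> (fst (?g i))) \<and> openin X W \<and>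
      snd (?g i) \<subseteq> W \<and> (\<forall>x\<in>W. a x = 1)" for i
  proof -
    have q: "fst (?g i) \<in> idempotents" "snd (?g i) \<subseteq> act_dom \<theta> (fst (?g i))" "compactin X (snd (?g i))"
      using pairs[OF gQ] by auto
    obtain a W where "\<And>x. 0 \<le> (a x :: real)" "\<And>x. a x \<le> 1"
        "(\<lambda>x. complex_of_real (a x)) \<in> C0_on X (act_dom \<theta> (fst (?g i)))" "openin X W"
        "snd (?g i) \<subseteq> W" "W \<subseteq> act_dom \<theta> (fst (?g i))" "\<And>x. x \<in> W \<Longrightarrow> a x = 1"
      by (rule C0_on_bump[OF locally_compact Hausdorff act_dom_open[OF q(1)] q(3) q(2)]) (rule that)
    then show ?thesis by (intro exI[of _ a] exI[of _ W]) simp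
  qed
  then obtain a W where a0: "\<And>i x. 0 \<le> (a i x :: real)" and a1: "\<And>i x. a i x \<le> 1"
      and a: "\<And>i. (\<lambda>x. complex_of_real (a i x)) \<in> C0_on X (act_dom \<theta> (fst (?g i)))"
      and W: "\<And>i. openin X (W i)" "\<And>i. snd (?g i) \<subseteq> W i" "\<And>i x. x \<in> W i \<Longrightarrow> a i x = 1"
    by metis
  have f: "fst (?g i) \<in> idempotents" for i using pairs[OF gQ] by simp
  have cover: "\<exists>q\<in>Q. \<forall>i. ?g i = q \<longrightarrow> e \<preceq> fst (?g i) \<and> x \<in> W i"
    if e: "e \<in> idempotents" and x: "x \<in> act_dom \<theta> e" for e x
  proof -
    have "act_dom \<theta> e \<subseteq> \<Union>{K. \<exists>f. (f, K) \<in> P \<and> e \<preceq> f}"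
      using P e unfolding compact_family_cover_def by simp
    from subsetD[OF this x] obtain f K where fK: "(f, K) \<in> P" "e \<preceq> f" "x \<in> K" by auto
    have "\<forall>i. ?g i = (f, K) \<longrightarrow> e \<preceq> fst (?g i) \<and> x \<in> W i"
    proof (intro allI impI)
      fix i assume "?g i = (f, K)"
      then show "e \<preceq> fst (?g i) \<and> x \<in> W i" using fK W(2)[of i] by auto
    qed
    then show ?thesis using fK(1) by (intro bexI[of _ "(f, K)"]) (auto simp: Q_def)
  qed
  have range: "range ?g = Q" if "countable P"
    using that by (intro range_from_nat_into) (auto simp: Q_def)
  show "sigma_unital_alg (completion_alg (KS_alg X \<theta>) p)" if cnt: "countable P"
  proof (rule sigma_unital_completion_if_countable_cover[OF f a a0 a1 W(1,3)])
    fix e x assume "e \<in> idempotents" "x \<in> act_dom \<theta> e"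
    from cover[OF this] obtain q where q: "q \<in> Q" "\<forall>i. ?g i = q \<longrightarrow> e \<preceq> fst (?g i) \<and> x \<in> W i"
      by (rule bexE)
    have "q \<in> range ?g" using q(1) range[OF cnt] by simp
    then obtain i where "?g i = q" by auto
    then show "\<exists>i. e \<preceq> fst (?g i) \<and> x \<in> W i" using q(2) by auto
  qed
  show "unital_alg (completion_alg (KS_alg X \<theta>) p)" if fin: "finite P"
  proof -
    have "finite Q" using fin by (simp add: Q_def)
    then obtain I where I: "finite I" "Q = ?g ` I"
      using finite_subset_image[of Q ?g UNIV] range[OF countable_finite[OF fin]] by auto
    obtain n where n: "\<forall>i\<in>I. i < n" using I(1) unfolding finite_nat_set_iff_bounded by (rule exE)
    show ?thesis
    proof (rule unital_completion_if_finite_cover[OF f a a0 a1, of n])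
      fix e x assume "e \<in> idempotents" "x \<in> act_dom \<theta> e"
      from cover[OF this] obtain q where q: "q \<in> Q" "\<forall>i. ?g i = q \<longrightarrow> e \<preceq> fst (?g i) \<and> x \<in> W i"
        by (rule bexE)
      obtain i where i: "i \<in> I" "?g i = q" using subsetD[OF equalityD1[OF I(2)] q(1)] by auto
      then have "e \<preceq> fst (?g i)" "a i x = 1" using q(2) W(3) by auto
      then show "\<exists>i<n. e \<preceq> fst (?g i) \<and> a i x = 1" using bspec[OF n i(1)] by auto
    qed
  qed
qed

section \<open>From units to covers\<close>

text \<open>If \<open>U\<close> nearly acts as a unit, then at each point of \<open>X\<^sub>e\<close> the components of \<open>U\<close> above \<open>e\<close> add up
  to nearly \<open>1\<close>, so that one of the finitely many components is bounded below there.\<close>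

definition component_pairs :: "('s \<Rightarrow> 'x \<Rightarrow> complex) \<Rightarrow> ('s \<times> 'x set) set"
  where "component_pairs U = (\<lambda>s. (s\<^sup>\<star> * s,
    {x \<in> act_dom \<theta> (s\<^sup>\<star> * s). 1 / (2 * (real (card (supp U)) + 1)) \<le> cmod (U s x)})) ` supp U"

lemma component_pairs_compact:
  assumes "U \<in> KA"
  shows "\<forall>(f, K)\<in>component_pairs U. f \<in> idempotents \<and> K \<subseteq> act_dom \<theta> f \<and> compactin X K"
proof -
  have pos: "1 / (2 * (real (card (supp U)) + 1)) > 0" by simp
  show ?thesis
    unfolding component_pairs_def using C0_on_compact[OF KA_C0[OF assms] pos] by auto
qed

lemma component_pairs_cover:
  assumes U: "U \<in> KA" and e: "e \<in> idempotents" and x: "x \<in> act_dom \<theta> e"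
    and near: "cmod ((\<Sum>s | s \<in> supp U \<and> e \<preceq> s. U s x) - 1) \<le> 1 / 2"
  shows "\<exists>(f, K)\<in>component_pairs U. e \<preceq> f \<and> x \<in> K"
proof -
  let ?F = "{s. s \<in> supp U \<and> e \<preceq> s}" and ?c = "1 / (2 * (real (card (supp U)) + 1))"
  have "\<exists>s\<in>?F. ?c \<le> cmod (U s x)"
  proof (rule ccontr)
    assume "\<not> ?thesis"
    then have small: "cmod (U s x) \<le> ?c" if "s \<in> ?F" for s using that by force
    have "cmod (\<Sum>s\<in>?F. U s x) \<le> (\<Sum>s\<in>?F. ?c)"
      by (rule order_trans[OF norm_sum]) (rule sum_mono[OF small])
    also have "\<dots> = real (card ?F) * ?c" by simp
    also have "\<dots> \<le> real (card (supp U)) * ?c"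
      using KA_supp[OF U] by (intro mult_right_mono) (auto intro: card_mono)
    also have "\<dots> < 1 / 2" by (simp add: field_simps)
    finally have "cmod (\<Sum>s\<in>?F. U s x) < 1 / 2" .
    moreover have "1 \<le> cmod (\<Sum>s\<in>?F. U s x) + cmod ((\<Sum>s\<in>?F. U s x) - 1)"
      using norm_triangle_ineq4[of "\<Sum>s\<in>?F. U s x" "(\<Sum>s\<in>?F. U s x) - 1"] by simp
    ultimately show False using near by linarith
  qed
  then obtain s where s: "s \<in> supp U" "e \<preceq> s" "?c \<le> cmod (U s x)" by auto
  have le: "e \<preceq> s\<^sup>\<star> * s" by (rule natural_le_imp_le_source[OF e s(2)])
  then have "x \<in> act_dom \<theta> (s\<^sup>\<star> * s)" using act_dom_mono[OF e source_idempotent] x by blast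
  then show ?thesis unfolding component_pairs_def using s le by auto
qed

lemma coefficient_near_one:
  assumes above: "\<And>T. T \<in> KA \<Longrightarrow> KS_reduced_norm X \<theta> T \<le> p T"
    and U: "U \<in> KA" and e: "e \<in> idempotents" and x: "x \<in> act_dom \<theta> e"
    and b: "b \<in> C0_on X (act_dom \<theta> e)" "b x = 1" and near: "p (U \<odot> delta e b - delta e b) \<le> 1 / 2"
  shows "cmod ((\<Sum>s | s \<in> supp U \<and> e \<preceq> s. U s x) - 1) \<le> 1 / 2"
proof -
  have D: "delta e b \<in> KA" by (rule delta_idempotent_closed[OF e b(1)])
  have "U \<odot> delta e b - delta e b \<in> KA" by (intro KS.diff_closed KS.mult_closed U D)
  from above[OF this] reduced_norm_coefficient[OF U e x b(1)] near show ?thesis by (simp add: b(2))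
qed

lemma bump_at_point:
  assumes e: "e \<in> idempotents" and x: "x \<in> act_dom \<theta> e"
  obtains b where "b \<in> C0_on X (act_dom \<theta> e)" "b x = 1" "delta e b \<in> KA" "p (delta e b) \<le> 1"
proof -
  have "x \<in> topspace X" using act_dom_subset_topspace[OF e] x by blast
  then have cx: "compactin X {x}" by simp
  obtain a W where a: "\<And>y. 0 \<le> (a y :: real)" "\<And>y. a y \<le> 1"
      "(\<lambda>y. complex_of_real (a y)) \<in> C0_on X (act_dom \<theta> e)" "openin X W" "{x} \<subseteq> W"
      "W \<subseteq> act_dom \<theta> e" "\<And>y. y \<in> W \<Longrightarrow> a y = 1"
    by (rule C0_on_bump[OF locally_compact Hausdorff act_dom_open[OF e] cx _]) (use x in simp, rule that)
  have "p (delta e (\<lambda>y. complex_of_real (a y))) \<le> 1"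
    by (rule norm_delta_real_le_one[OF e a(3)]) (simp add: a(1,2))
  then show ?thesis using that[OF a(3)] delta_idempotent_closed[OF e a(3)] a(5,7) by simp
qed

proposition finite_cover_of_unital_completion:
  assumes above: "\<And>T. T \<in> KA \<Longrightarrow> KS_reduced_norm X \<theta> T \<le> p T"
    and unital: "unital_alg (completion_alg (KS_alg X \<theta>) p)"
  shows "\<exists>P. finite P \<and> compact_family_cover X \<theta> P"
proof -
  obtain U where U: "U \<in> KA" "\<And>T. T \<in> KA \<Longrightarrow> p (U \<odot> T - T) \<le> 1 / 2 * p T"
    by (rule KS.unital_completionD[OF unital, of "1 / 2"]) auto
  have "compact_family_cover X \<theta> (component_pairs U)"
    unfolding compact_family_cover_def
  proof (intro conjI component_pairs_compact U(1) ballI subsetI)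
    fix e x assume e: "e \<in> idempotents" and x: "x \<in> act_dom \<theta> e"
    obtain b where b: "b \<in> C0_on X (act_dom \<theta> e)" "b x = 1" "delta e b \<in> KA" "p (delta e b) \<le> 1"
      using bump_at_point[OF e x] .
    have "p (U \<odot> delta e b - delta e b) \<le> 1 / 2" using U(2)[OF b(3)] b(4) by linarith
    from component_pairs_cover[OF U(1) e x coefficient_near_one[OF above U(1) e x b(1,2) this]]
    show "x \<in> \<Union>{K. \<exists>f. (f, K) \<in> component_pairs U \<and> e \<preceq> f}" by auto
  qed
  moreover have "finite (component_pairs U)" using KA_supp[OF U(1)] by (simp add: component_pairs_def)
  ultimately show ?thesis by blast
qed

proposition countable_cover_of_sigma_unital_completion:
  assumes above: "\<And>T. T \<in> KA \<Longrightarrow> KS_reduced_norm X \<theta> T \<le> p T"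
    and unital: "sigma_unital_alg (completion_alg (KS_alg X \<theta>) p)"
  shows "\<exists>P. countable P \<and> compact_family_cover X \<theta> P"
proof -
  obtain V where V: "\<And>n::nat. V n \<in> KA" "\<And>T. T \<in> KA \<Longrightarrow> (\<lambda>n. p (V n \<odot> T - T)) \<longlonglongrightarrow> 0"
    by (rule KS.sigma_unital_completionD[OF unital]) auto
  let ?P = "\<Union>n. component_pairs (V n)"
  have "compact_family_cover X \<theta> ?P"
    unfolding compact_family_cover_def
  proof (intro conjI ballI subsetI)
    show "case q of (f, K) \<Rightarrow> f \<in> idempotents \<and> K \<subseteq> act_dom \<theta> f \<and> compactin X K" if "q \<in> ?P" for q
      using that component_pairs_compact[OF V(1)] by blast
    fix e x assume e: "e \<in> idempotents" and x: "x \<in> act_dom \<theta> e"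
    obtain b where b: "b \<in> C0_on X (act_dom \<theta> e)" "b x = 1" "delta e b \<in> KA" "p (delta e b) \<le> 1"
      using bump_at_point[OF e x] .
    obtain n where "norm (p (V n \<odot> delta e b - delta e b) - 0) < 1 / 2"
      using LIMSEQ_D[OF V(2)[OF b(3)], of "1 / 2"] by auto
    then have "p (V n \<odot> delta e b - delta e b) \<le> 1 / 2" by simp
    from component_pairs_cover[OF V(1) e x coefficient_near_one[OF above V(1) e x b(1,2) this]]
    show "x \<in> \<Union>{K. \<exists>f. (f, K) \<in> ?P \<and> e \<preceq> f}" by auto
  qed
  moreover have "countable ?P"
    using KA_supp[OF V(1)] by (intro countable_UN) (auto simp: component_pairs_def intro: countable_finite)
  ultimately show ?thesis by blast
qed

end

section \<open>The equivalence\<close>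

theorem corollary4p3p4:
  fixes X :: "'x topology" and \<theta> :: "'s::inverse_semigroup \<Rightarrow> 'x \<rightharpoonup> 'x"
  assumes "locally_compact_space X" and "Hausdorff_space X"
    and "semigroup_action X \<theta>"
  shows
    "((\<exists>P. finite P \<and> compact_family_cover X \<theta> P) \<longleftrightarrow> compact_space (KS_space X \<theta>)) \<and>
     (compact_space (KS_space X \<theta>) \<longleftrightarrow> unital_alg (KS_full X \<theta>)) \<and>
     (unital_alg (KS_full X \<theta>) \<longleftrightarrow> unital_alg (KS_reduced X \<theta>)) \<and>
     ((\<exists>P. countable P \<and> compact_family_cover X \<theta> P) \<longleftrightarrow> sigma_compact_space (KS_space X \<theta>)) \<and>
     (sigma_compact_space (KS_space X \<theta>) \<longleftrightarrow> sigma_unital_alg (KS_full X \<theta>)) \<and>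
     (sigma_unital_alg (KS_full X \<theta>) \<longleftrightarrow> sigma_unital_alg (KS_reduced X \<theta>))"
proof -
  interpret locally_compact_action X \<theta>
    by (intro locally_compact_action.intro inverse_semigroup_action.intro
        locally_compact_action_axioms.intro assms)
  interpret full: KS_seminorm X \<theta> "max_cstar_seminorm (KS_alg X \<theta>)"
    by (rule KS_seminormI[OF cstar_seminorm_max_KS])
  interpret reduced: KS_seminorm X \<theta> "KS_reduced_norm X \<theta>"
    by (rule KS_seminormI[OF cstar_seminorm_reduced])
  have above: "KS_reduced_norm X \<theta> T \<le> max_cstar_seminorm (KS_alg X \<theta>) T" if "T \<in> KA" for T
    by (rule cstar_seminorm_le_max[OF _ cstar_seminorm_reduced that])
  have full: "unital_alg (KS_full X \<theta>) \<longleftrightarrow> (\<exists>P. finite P \<and> compact_family_cover X \<theta> P)"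
    and full_sigma: "sigma_unital_alg (KS_full X \<theta>) \<longleftrightarrow> (\<exists>P. countable P \<and> compact_family_cover X \<theta> P)"
    unfolding KS_full_def enveloping_cstar_algebra_def
    using full.unital_completion_of_finite_cover full.finite_cover_of_unital_completion[OF above]
      full.sigma_unital_completion_of_countable_cover
      full.countable_cover_of_sigma_unital_completion[OF above]
    by blast+
  have reduced: "unital_alg (KS_reduced X \<theta>) \<longleftrightarrow> (\<exists>P. finite P \<and> compact_family_cover X \<theta> P)"
    and reduced_sigma:
      "sigma_unital_alg (KS_reduced X \<theta>) \<longleftrightarrow> (\<exists>P. countable P \<and> compact_family_cover X \<theta> P)"
    unfolding KS_reduced_def
    using reduced.unital_completion_of_finite_cover
      reduced.finite_cover_of_unital_completion[OF order_refl]
      reduced.sigma_unital_completion_of_countable_cover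
      reduced.countable_cover_of_sigma_unital_completion[OF order_refl]
    by blast+
  show ?thesis
    using finite_cover_iff_compact_KS_space countable_cover_iff_sigma_compact_KS_space
      full full_sigma reduced reduced_sigma
    by simp
qed

end
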